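(* Let $E$ be an arbitrary directed graph and let $K$ be any field. Then $I(P_c)$ is the largest locally left noetherian ideal of $L_K(E)$ not having minimal idempotents, and likewise the largest locally right noetherian ideal of $L_K(E)$ not having minimal idempotents. (Here "largest" means that $I(P_c)$ has the stated property and contains every two-sided ideal of $L_K(E)$ having that property.)
   Context: A directed graph $E=(E^0,E^1,s,r)$ consists of arbitrary sets $E^0$ (vertices), $E^1$ (edges) and maps $s,r:E^1\to E^0$ (source, range). A vertex $v$ is a sink if $s^{-1}(v)=\emptyset$, an infinite emitter if $s^{-1}(v)$ is infinite, and regular otherwise. A path is a vertex (length $0$) or a finite sequence of edges $e_1\cdots e_n$ with $r(e_i)=s(e_{i+1})$. A cycle is a path $e_1\cdots e_n$, $n>0$, with $r(e_n)=s(e_1)$ and $s(e_i)\ne s(e_j)$ for $i\neq j$. An exit for a path $e_1\cdots e_n$ is an edge $e$ with $s(e)=s(e_i)$ and $e\ne e_i$ for some $i$. $P_c$ is the set of vertices of $E$ lying in cycles without exits. The Leavitt path algebra $L_K(E)$ is the $K$-algebra generated by $\{v: v\in E^0\}\cup\{e,e^*: e\in E^1\}$ subject to: $vw=\delta_{v,w}v$ for $v,w\in E^0$; $s(e)e=e\,r(e)=e$ and $r(e)e^*=e^*s(e)=e^*$ for $e\in E^1$; $e^*e'=\delta_{e,e'}r(e)$ for $e,e'\in E^1$; $v=\sum_{s(e)=v}ee^*$ for every regular vertex $v$. For $X\subseteq L_K(E)$, $I(X)$ is the two-sided ideal generated by $X$. A ring $R$ (not necessarily unital) is locally left (right) noetherian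 if for every finite subset $X\subseteq R$ there is an idempotent $e\in R$ with $X\subseteq eRe$ and $eRe$ left (right) noetherian. An ideal is said to be locally left (right) noetherian if it is so as a ring. A nonzero idempotent $e$ of a semiprime ring $R$ (such as $L_K(E)$) is minimal if $eRe$ is a division ring. *)

theory Defs
  imports
    "HOL-Algebra.QuotRing"
    "HOL-Library.Poly_Mapping"
    "Graph_Theory.Arc_Walk"
begin

section \<open>Rings without a unit\<close>

text \<open>
  A ring need not be unital here. It is still represented by a ring record, whose field
  \<open>one\<close> is then irrelevant: no definition below looks at \<open>\<one>\<close> except for the
  corner rings \<open>eRe\<close>, where it is set to \<open>e\<close>. The locale \<open>ideal\<close> of the library
  presupposes a unital ring, hence the following variants.
\<close>

definition left_ideal :: "'a set \<Rightarrow> ('a, 'm) ring_scheme \<Rightarrow> bool" where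
  "left_ideal I R \<longleftrightarrow> additive_subgroup I R \<and> (\<forall>a\<in>I. \<forall>x\<in>carrier R. x \<otimes>\<^bsub>R\<^esub> a \<in> I)"

definition right_ideal :: "'a set \<Rightarrow> ('a, 'm) ring_scheme \<Rightarrow> bool" where
  "right_ideal I R \<longleftrightarrow> additive_subgroup I R \<and> (\<forall>a\<in>I. \<forall>x\<in>carrier R. a \<otimes>\<^bsub>R\<^esub> x \<in> I)"

definition two_sided_ideal :: "'a set \<Rightarrow> ('a, 'm) ring_scheme \<Rightarrow> bool" where
  "two_sided_ideal I R \<longleftrightarrow> left_ideal I R \<and> right_ideal I R"

definition generated_ideal :: "('a, 'm) ring_scheme \<Rightarrow> 'a set \<Rightarrow> 'a set" where
  "generated_ideal R X = \<Inter>{I. two_sided_ideal I R \<and> X \<subseteq> I}"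

definition idempotent :: "('a, 'm) ring_scheme \<Rightarrow> 'a \<Rightarrow> bool" where
  "idempotent R e \<longleftrightarrow> e \<in> carrier R \<and> e \<otimes>\<^bsub>R\<^esub> e = e"

definition corner :: "('a, 'm) ring_scheme \<Rightarrow> 'a \<Rightarrow> ('a, 'm) ring_scheme" where
  "corner R e = R\<lparr>carrier := {e \<otimes>\<^bsub>R\<^esub> x \<otimes>\<^bsub>R\<^esub> e | x. x \<in> carrier R}, one := e\<rparr>"

locale left_noetherian_ring = ring R for R (structure) +
  assumes left_acc:
    "\<lbrakk>\<And>n::nat. left_ideal (I n) R; \<And>n. I n \<subseteq> I (Suc n)\<rbrakk> \<Longrightarrow> \<exists>N. \<forall>n\<ge>N. I n = I N"

locale right_noetherian_ring = ring R for R (structure) +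
  assumes right_acc:
    "\<lbrakk>\<And>n::nat. right_ideal (I n) R; \<And>n. I n \<subseteq> I (Suc n)\<rbrakk> \<Longrightarrow> \<exists>N. \<forall>n\<ge>N. I n = I N"

locale skew_field = ring R for R (structure) +
  assumes skew_field_Units: "Units R = carrier R - {\<zero>}"

definition locally_left_noetherian :: "('a, 'm) ring_scheme \<Rightarrow> bool" where
  "locally_left_noetherian R \<longleftrightarrow>
    (\<forall>X \<subseteq> carrier R. finite X \<longrightarrow>
      (\<exists>e. idempotent R e \<and> X \<subseteq> carrier (corner R e) \<and> left_noetherian_ring (corner R e)))"

definition locally_right_noetherian :: "('a, 'm) ring_scheme \<Rightarrow> bool" where
  "locally_right_noetherian R \<longleftrightarrow>
    (\<forall>X \<subseteq> carrier R. finite X \<longrightarrow>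
      (\<exists>e. idempotent R e \<and> X \<subseteq> carrier (corner R e) \<and> right_noetherian_ring (corner R e)))"

definition minimal_idempotent :: "('a, 'm) ring_scheme \<Rightarrow> 'a \<Rightarrow> bool" where
  "minimal_idempotent R e \<longleftrightarrow> idempotent R e \<and> e \<noteq> \<zero>\<^bsub>R\<^esub> \<and> skew_field (corner R e)"

definition largest_ideal_with :: "('a, 'm) ring_scheme \<Rightarrow> ('a set \<Rightarrow> bool) \<Rightarrow> 'a set \<Rightarrow> bool" where
  "largest_ideal_with R P I \<longleftrightarrow>
    two_sided_ideal I R \<and> P I \<and> (\<forall>J. two_sided_ideal J R \<and> P J \<longrightarrow> J \<subseteq> I)"


section \<open>Cycles without exits\<close>

text \<open>
  A directed graph in the sense of Leavitt path algebras is a \<^locale>\<open>wf_digraph\<close>, with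
  \<open>tail\<close> the source and \<open>head\<close> the range map. A cycle of the library is a nonempty closed walk
  that repeats no vertex; its vertices are the sources of its edges.
\<close>

definition has_exit :: "('v, 'e) pre_digraph \<Rightarrow> 'e list \<Rightarrow> bool" where
  "has_exit G p \<longleftrightarrow> (\<exists>e\<in>arcs G. \<exists>f\<in>set p. tail G e = tail G f \<and> e \<noteq> f)"

definition verts_on_cycles_without_exits :: "('v, 'e) pre_digraph \<Rightarrow> 'v set" where
  "verts_on_cycles_without_exits G =
    {v. \<exists>p. pre_digraph.cycle G p \<and> \<not> has_exit G p \<and> v \<in> tail G ` set p}"

definition regular_vertex :: "('v, 'e) pre_digraph \<Rightarrow> 'v \<Rightarrow> bool" where
  "regular_vertex G v \<longleftrightarrow> v \<in> verts G \<and> out_arcs G v \<noteq> {} \<and> finite (out_arcs G v)"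


section \<open>Leavitt path algebras\<close>

datatype 'a word = Word (letters: "'a list")

instantiation word :: (type) monoid_add
begin
definition "0 = Word []"
definition "u + w = Word (letters u @ letters w)"
instance by standard (simp_all add: zero_word_def plus_word_def)
end

datatype ('v, 'e) lpa_gen = Vertex 'v | Edge 'e | Ghost 'e

definition lpa_gens :: "('v, 'e) pre_digraph \<Rightarrow> ('v, 'e) lpa_gen set" where
  "lpa_gens G = Vertex ` verts G \<union> Edge ` arcs G \<union> Ghost ` arcs G"

text \<open>
  With the concatenation of words as addition on the exponents, the product of
  \<^typ>\<open>'a word \<Rightarrow>\<^sub>0 'k\<close> is the one of the free unital associative algebra on \<^typ>\<open>'a\<close>. Its
  elements without constant term form the free algebra without unit.
\<close>

definition free_unital_algebra :: "'a set \<Rightarrow> ('a word \<Rightarrow>\<^sub>0 'k::field) ring" where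
  "free_unital_algebra A =
    \<lparr>carrier = {p. \<forall>w\<in>Poly_Mapping.keys p. set (letters w) \<subseteq> A},
     mult = (*), one = 1, zero = 0, add = (+)\<rparr>"

definition free_algebra :: "'a set \<Rightarrow> ('a word \<Rightarrow>\<^sub>0 'k::field) ring" where
  "free_algebra A = (free_unital_algebra A)
    \<lparr>carrier := {p \<in> carrier (free_unital_algebra A). Poly_Mapping.lookup p 0 = 0}\<rparr>"

definition gen :: "'a \<Rightarrow> 'a word \<Rightarrow>\<^sub>0 'k::field" where
  "gen a = Poly_Mapping.single (Word [a]) 1"

abbreviation vtx :: "'v \<Rightarrow> ('v, 'e) lpa_gen word \<Rightarrow>\<^sub>0 'k::field" where
  "vtx v \<equiv> gen (Vertex v)"

abbreviation edge :: "'e \<Rightarrow> ('v, 'e) lpa_gen word \<Rightarrow>\<^sub>0 'k::field" where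
  "edge e \<equiv> gen (Edge e)"

abbreviation ghost :: "'e \<Rightarrow> ('v, 'e) lpa_gen word \<Rightarrow>\<^sub>0 'k::field" where
  "ghost e \<equiv> gen (Ghost e)"

definition lpa_relators :: "('v, 'e) pre_digraph \<Rightarrow> (('v, 'e) lpa_gen word \<Rightarrow>\<^sub>0 'k::field) set" where
  "lpa_relators G =
     {vtx v * vtx w - (if v = w then vtx v else 0) | v w. v \<in> verts G \<and> w \<in> verts G}
   \<union> {vtx (tail G e) * edge e - edge e | e. e \<in> arcs G}
   \<union> {edge e * vtx (head G e) - edge e | e. e \<in> arcs G}
   \<union> {vtx (head G e) * ghost e - ghost e | e. e \<in> arcs G}
   \<union> {ghost e * vtx (tail G e) - ghost e | e. e \<in> arcs G}
   \<union> {ghost e * edge f - (if e = f then vtx (head G e) else 0) | e f. e \<in> arcs G \<and> f \<in> arcs G}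
   \<union> {vtx v - (\<Sum>e\<in>out_arcs G v. edge e * ghost e) | v. regular_vertex G v}"

text \<open>
  The ideal of relations is generated inside the \<^emph>\<open>unital\<close> free algebra, whose ring ideals are
  closed under scalars (the constants); it lies in \<^const>\<open>free_algebra\<close>, and there it is the
  algebra ideal generated by the relators.
\<close>

definition lpa_ideal :: "('v, 'e) pre_digraph \<Rightarrow> (('v, 'e) lpa_gen word \<Rightarrow>\<^sub>0 'k::field) set" where
  "lpa_ideal G = genideal (free_unital_algebra (lpa_gens G)) (lpa_relators G)"

text \<open>Only the ring structure of the algebra is recorded.\<close>

definition leavitt_path_algebra ::
  "'k::field itself \<Rightarrow> ('v, 'e) pre_digraph \<Rightarrow> (('v, 'e) lpa_gen word \<Rightarrow>\<^sub>0 'k) set ring" where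
  "leavitt_path_algebra _ G = free_algebra (lpa_gens G) Quot lpa_ideal G"

definition lpa_vertex ::
  "'k::field itself \<Rightarrow> ('v, 'e) pre_digraph \<Rightarrow> 'v \<Rightarrow> (('v, 'e) lpa_gen word \<Rightarrow>\<^sub>0 'k) set" where
  "lpa_vertex _ G v = lpa_ideal G +>\<^bsub>free_algebra (lpa_gens G)\<^esub> vtx v"

text \<open>
  Without the next fact, \<^const>\<open>genideal\<close> in the definition of \<^const>\<open>lpa_ideal\<close> would be an
  intersection over the empty family.
\<close>

lemma ring_free_unital_algebra: "ring (free_unital_algebra A :: ('a word \<Rightarrow>\<^sub>0 'k::field) ring)"
proof (rule ringI)
  let ?F = "free_unital_algebra A :: ('a word \<Rightarrow>\<^sub>0 'k) ring"
  have uminus: "- p \<in> carrier ?F" if "p \<in> carrier ?F" for p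
    using that by (simp add: free_unital_algebra_def in_keys_iff)
  show "abelian_group ?F"
  proof (rule abelian_groupI)
    fix p q assume "p \<in> carrier ?F" "q \<in> carrier ?F"
    then show "p \<oplus>\<^bsub>?F\<^esub> q \<in> carrier ?F"
      using keys_add[of p q] by (auto simp: free_unital_algebra_def)
  next
    fix p assume "p \<in> carrier ?F"
    then show "\<exists>q\<in>carrier ?F. q \<oplus>\<^bsub>?F\<^esub> p = \<zero>\<^bsub>?F\<^esub>"
      by (intro bexI[OF _ uminus]) (auto simp: free_unital_algebra_def)
  qed (auto simp: free_unital_algebra_def ac_simps)
  show "monoid ?F"
  proof (rule monoidI)
    fix p q assume "p \<in> carrier ?F" "q \<in> carrier ?F"
    then show "p \<otimes>\<^bsub>?F\<^esub> q \<in> carrier ?F"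
      using keys_mult[of p q] by (fastforce simp: free_unital_algebra_def plus_word_def)
  qed (auto simp: free_unital_algebra_def mult.assoc zero_word_def)
qed (auto simp: free_unital_algebra_def algebra_simps)

lemma lpa_relators_subset:
  assumes "wf_digraph G"
  shows "lpa_relators G \<subseteq> carrier (free_algebra (lpa_gens G))"
proof -
  interpret wf_digraph G by fact
  let ?F = "free_algebra (lpa_gens G)"
  have gen2: "gen a * gen b \<in> carrier ?F" if "a \<in> lpa_gens G" "b \<in> lpa_gens G" for a b
    using that by (auto simp: free_algebra_def free_unital_algebra_def gen_def mult_single
        plus_word_def zero_word_def lookup_single)
  have gen1: "gen a \<in> carrier ?F" if "a \<in> lpa_gens G" for a
    using that by (auto simp: free_algebra_def free_unital_algebra_def gen_def
        zero_word_def lookup_single)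
  have zero: "0 \<in> carrier ?F"
    by (auto simp: free_algebra_def free_unital_algebra_def)
  have diff: "p - q \<in> carrier ?F" if "p \<in> carrier ?F" "q \<in> carrier ?F" for p q
    using that keys_diff[of p q]
    by (auto simp: free_algebra_def free_unital_algebra_def lookup_minus)
  have add: "p + q \<in> carrier ?F" if "p \<in> carrier ?F" "q \<in> carrier ?F" for p q
    using that keys_add[of p q]
    by (auto simp: free_algebra_def free_unital_algebra_def lookup_add)
  have sum: "sum f X \<in> carrier ?F" if "\<And>x. x \<in> X \<Longrightarrow> f x \<in> carrier ?F" for f and X :: "'b set"
    using that by (induction X rule: infinite_finite_induct) (auto intro: zero add)
  have mem [simp]: "v \<in> verts G \<Longrightarrow> Vertex v \<in> lpa_gens G" "e \<in> arcs G \<Longrightarrow> Edge e \<in> lpa_gens G"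
    "e \<in> arcs G \<Longrightarrow> Ghost e \<in> lpa_gens G" for v e
    by (auto simp: lpa_gens_def)
  show ?thesis
    unfolding lpa_relators_def regular_vertex_def
    by (auto intro!: diff gen1 gen2 zero sum simp: out_arcs_def)
qed

end

theory Submission
  imports Defs "HOL-Computational_Algebra.Polynomial"
begin

text \<open>
  Inside the ideal of the exitless cycles every finite set lies in the corner at a finite sum of
  projections onto paths that enter such a cycle. The Peirce components of this corner are zero
  or copies of the ring of Laurent polynomials, which is a noetherian principal ideal domain
  but not a division ring; hence the ideal is locally noetherian and has no minimal idempotents.

  Conversely let \<open>J\<close> be an ideal with both properties. Its idempotents dominate no infinite
  sequence of orthogonal nonzero idempotents. A vertex of \<open>J\<close> outside the ideal of the exitless
  cycles would give a minimal idempotent or, by branching forever, such a sequence; so the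
  vertices of \<open>J\<close> lie in that ideal. By the reduction theorem every nonzero idempotent \<open>e\<close> of
  \<open>J\<close> satisfies \<open>a * e * b = v\<close> for some vertex \<open>v\<close>, and \<open>e * b * v * a * e\<close> splits off a nonzero
  idempotent of the ideal; splitting off such idempotents must stop, which can only happen when
  the remaining idempotent lies in the ideal.
\<close>

section \<open>Additive endomorphisms\<close>

text \<open>The algebra is not a type: it is a record on cosets, usually without unit. The
  calculations take place instead in a type of class \<open>ring_1\<close>, in which it is a mere
  subset \<open>A\<close>. Additive endomorphisms serve as that type because left multiplication,
  followed by a projection along the relations, represents the quotient faithfully. The defining
  relations alone could hold with all elements zero; the independence of paths excludes this and is
  secured by a separate representation. For maximality, the only thing drawn from either noetherian
  condition, apart from local units, is the absence of infinite orthogonal sequences of idempotents.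
  This is left-right symmetric, so one argument covers both halves. The exitless cycles are the
  obstacle in the reduction: no exit separates the powers of such a cycle, and division in a
  principal ideal domain takes its place.\<close>

typedef (overloaded) 'a endo = "{f :: 'a::ring_1 \<Rightarrow> 'a. \<forall>x y. f (x + y) = f x + f y}"
  morphisms app Endo
  by (rule exI[of _ id]) simp

lemma app_add_arg: "app f (x + y) = app f x + app f y"
  using app[of f] by auto

lemma app_zero_arg [simp]: "app f 0 = 0"
  using app_add_arg[of f 0 0] by simp

lemma endo_eqI: "(\<And>x. app f x = app g x) \<Longrightarrow> f = g"
  by (simp add: app_inject[symmetric] fun_eq_iff)

instantiation endo :: (ring_1) ring_1
begin
definition "0 = Endo (\<lambda>_. 0)"
definition "1 = Endo (\<lambda>x. x)"
definition "f + g = Endo (\<lambda>x. app f x + app g x)"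
definition "- f = Endo (\<lambda>x. - app f x)"
definition "f - g = Endo (\<lambda>x. app f x - app g x)"
definition "f * g = Endo (\<lambda>x. app f (app g x))"

lemma app_simps [simp]:
  "app 0 x = 0" "app 1 x = x" "app (f + g) x = app f x + app g x" "app (- f) x = - app f x"
  "app (f - g) x = app f x - app g x" "app (f * g) x = app f (app g x)"
  unfolding zero_endo_def one_endo_def plus_endo_def uminus_endo_def minus_endo_def times_endo_def
  by (subst Endo_inverse; simp add: app_add_arg)+

instance
proof
  show "(0::'a endo) \<noteq> 1"
  proof
    assume "(0::'a endo) = 1"
    then have "app (0::'a endo) 1 = app 1 1" by simp
    then show False by simp
  qed
qed (auto intro!: endo_eqI simp: app_add_arg algebra_simps)
end

section \<open>Chain conditions\<close>

definition addsub :: "'r::ab_group_add set \<Rightarrow> bool" where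
  "addsub J \<longleftrightarrow> 0 \<in> J \<and> (\<forall>x\<in>J. \<forall>y\<in>J. x + y \<in> J) \<and> (\<forall>x\<in>J. - x \<in> J)"

lemma addsub_diff: "addsub J \<Longrightarrow> x \<in> J \<Longrightarrow> y \<in> J \<Longrightarrow> x - y \<in> J"
  unfolding addsub_def by (metis diff_conv_add_uminus)

lemma addsub_sum: "addsub J \<Longrightarrow> (\<And>i. i \<in> S \<Longrightarrow> f i \<in> J) \<Longrightarrow> sum f S \<in> J"
  by (induction S rule: infinite_finite_induct) (auto simp: addsub_def)

lemma addsub_image:
  fixes f :: "'a::ab_group_add \<Rightarrow> 'b::ab_group_add"
  assumes J: "addsub J" and f: "\<And>x y. f (x + y) = f x + f y"
  shows "addsub (f ` J)"
proof -
  have f0: "f 0 = 0" using f[of 0 0] by simp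
  have fm: "f (- x) = - f x" for x
    using f[of x "- x"] f0 by (simp add: eq_neg_iff_add_eq_0 add.commute)
  show ?thesis
    unfolding addsub_def
  proof (intro conjI ballI)
    show "0 \<in> f ` J" using J f0 by (metis addsub_def image_eqI)
    show "x + y \<in> f ` J" if "x \<in> f ` J" "y \<in> f ` J" for x y
    proof -
      from that obtain a b where "x = f a" "y = f b" "a \<in> J" "b \<in> J" by blast
      then have "x + y = f (a + b)" "a + b \<in> J" using J f by (auto simp: addsub_def)
      then show ?thesis by blast
    qed
    show "- x \<in> f ` J" if "x \<in> f ` J" for x
    proof -
      from that obtain a where "x = f a" "a \<in> J" by blast
      then have "- x = f (- a)" "- a \<in> J" using J fm by (auto simp: addsub_def)
      then show ?thesis by blast
    qed
  qed
qed

text \<open>The acting set \<open>B\<close> and the ambient group \<open>U\<close> are kept apart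
  because an off-diagonal Peirce component is acted on by a diagonal one.\<close>

definition submod :: "('r \<Rightarrow> 'r \<Rightarrow> 'r) \<Rightarrow> 'r set \<Rightarrow> 'r set \<Rightarrow> 'r::ab_group_add set \<Rightarrow> bool" where
  "submod m B U J \<longleftrightarrow> J \<subseteq> U \<and> addsub J \<and> (\<forall>b\<in>B. \<forall>x\<in>J. m b x \<in> J)"

definition acc :: "('r \<Rightarrow> 'r \<Rightarrow> 'r) \<Rightarrow> 'r set \<Rightarrow> 'r::ab_group_add set \<Rightarrow> bool" where
  "acc m B U \<longleftrightarrow> (\<forall>J::nat \<Rightarrow> 'r set. (\<forall>n. submod m B U (J n)) \<and> (\<forall>n. J n \<subseteq> J (Suc n)) \<longrightarrow>
     (\<exists>N. \<forall>n\<ge>N. J n = J N))"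

lemma accD:
  assumes "acc m B U" "\<And>n. submod m B U (J n)" "\<And>n. J n \<subseteq> J (Suc n)"
  obtains N where "\<And>n. n \<ge> N \<Longrightarrow> J n = J N"
  using assms unfolding acc_def by blast

text \<open>
  Left and right chain conditions are treated at once by leaving the multiplication open: it is
  either the given one or its opposite.
\<close>

locale biadditive_assoc =
  fixes m :: "'r \<Rightarrow> 'r \<Rightarrow> 'r::ring_1" (infixl "\<odot>" 70)
  assumes assoc: "x \<odot> y \<odot> z = x \<odot> (y \<odot> z)"
    and ldistr: "(x + y) \<odot> z = x \<odot> z + y \<odot> z"
    and rdistr: "z \<odot> (x + y) = z \<odot> x + z \<odot> y"
begin

lemma zero_left [simp]: "0 \<odot> x = 0"
  using ldistr[of 0 0 x] by simp

lemma zero_right [simp]: "x \<odot> 0 = 0"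
  using rdistr[of x 0 0] by simp

lemma minus_left: "(- x) \<odot> y = - (x \<odot> y)"
  using ldistr[of x "- x" y] by (simp add: eq_neg_iff_add_eq_0 add.commute)

lemma diff_left: "(x - y) \<odot> z = x \<odot> z - y \<odot> z"
  using ldistr[of x "- y" z] by (simp add: minus_left)

lemma sum_left: "sum f S \<odot> x = (\<Sum>i\<in>S. f i \<odot> x)"
  by (induction S rule: infinite_finite_induct) (auto simp: ldistr)

lemma sum_right: "x \<odot> sum f S = (\<Sum>i\<in>S. x \<odot> f i)"
  by (induction S rule: infinite_finite_induct) (auto simp: rdistr)

text \<open>The left ideals of elements fixed on the right by the partial sums \<open>s n\<close>
  increase, and strictly so: \<open>f N\<close> is fixed by \<open>s (Suc N)\<close> but killed by
  \<open>s N\<close>.\<close>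

lemma no_orthogonal_sequence:
  assumes acc: "acc m B B" and B: "addsub B" "\<And>x y. x \<in> B \<Longrightarrow> y \<in> B \<Longrightarrow> x \<odot> y \<in> B"
    and f: "\<And>n::nat. f n \<in> B" "\<And>n. f n \<noteq> 0" "\<And>n. f n \<odot> f n = f n"
      "\<And>i j. i \<noteq> j \<Longrightarrow> f i \<odot> f j = 0"
  shows False
proof -
  define s where "s n = (\<Sum>i<n. f i)" for n
  define J where "J n = {x \<in> B. x \<odot> s n = x}" for n
  have sub: "submod m B B (J n)" for n
    using B by (auto simp: submod_def addsub_def J_def ldistr minus_left assoc)
  have fs: "f i \<odot> s n = (if i < n then f i else 0)" for i n
  proof -
    have "f i \<odot> s n = (\<Sum>j<n. if j = i then f i else 0)"
      unfolding s_def sum_right by (rule sum.cong) (auto simp: f(3,4))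
    then show ?thesis by simp
  qed
  have ss: "s n \<odot> s (Suc n) = s n" for n
  proof -
    have "s n \<odot> s (Suc n) = (\<Sum>i<n. f i \<odot> s (Suc n))"
      by (subst s_def) (simp only: sum_left)
    also have "\<dots> = s n" unfolding s_def[of n] by (rule sum.cong) (auto simp: fs)
    finally show ?thesis .
  qed
  have chain: "J n \<subseteq> J (Suc n)" for n
  proof
    fix x assume "x \<in> J n"
    then have x: "x \<in> B" "x \<odot> s n = x" by (auto simp: J_def)
    have "x \<odot> s (Suc n) = x \<odot> s n \<odot> s (Suc n)" by (simp only: x(2))
    also have "\<dots> = x" by (subst assoc) (simp only: ss x(2))
    finally show "x \<in> J (Suc n)" by (simp add: J_def x)
  qed
  obtain N where N: "\<And>n. n \<ge> N \<Longrightarrow> J n = J N"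
    using accD[where J = J, OF acc sub chain] by metis
  have "f N \<in> J (Suc N)" by (simp add: J_def f fs)
  then have "f N \<in> J N" using N[of "Suc N"] by simp
  then show False using f(2)[of N] by (simp add: J_def fs)
qed

text \<open>A submodule is controlled column by column. The entries
  \<open>e i \<odot> x \<odot> e k\<close> of its members form submodules over the diagonal
  components, so each column stabilises, and finitely many columns have a common bound.\<close>

lemma acc_Peirce:
  assumes S: "finite S" and B: "addsub B" "\<And>x y. x \<in> B \<Longrightarrow> y \<in> B \<Longrightarrow> x \<odot> y \<in> B"
    and e: "\<And>i. i \<in> S \<Longrightarrow> e i \<in> B" "\<And>i. i \<in> S \<Longrightarrow> e i \<odot> e i = e i"
      "\<And>i j. i \<in> S \<Longrightarrow> j \<in> S \<Longrightarrow> i \<noteq> j \<Longrightarrow> e i \<odot> e j = 0"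
    and unit: "\<And>x. x \<in> B \<Longrightarrow> sum e S \<odot> x = x" "\<And>x. x \<in> B \<Longrightarrow> x \<odot> sum e S = x"
    and acc: "\<And>i j. i \<in> S \<Longrightarrow> j \<in> S \<Longrightarrow>
      acc m {x \<in> B. e i \<odot> x = x \<and> x \<odot> e i = x} {x \<in> B. e i \<odot> x = x \<and> x \<odot> e j = x}"
  shows "acc m B B"
  unfolding acc_def
proof (intro allI impI)
  fix J :: "nat \<Rightarrow> 'r set"
  assume J: "(\<forall>n. submod m B B (J n)) \<and> (\<forall>n. J n \<subseteq> J (Suc n))"
  then have JB: "\<And>n. J n \<subseteq> B" and Jadd: "\<And>n. addsub (J n)"
    and Jm: "\<And>n b x. b \<in> B \<Longrightarrow> x \<in> J n \<Longrightarrow> b \<odot> x \<in> J n"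
    by (auto simp: submod_def)
  have mono: "J i \<subseteq> J j" if "i \<le> j" for i j
    using that J lift_Suc_mono_le[of J] by blast
  \<comment> \<open>\<open>T\<close> is the set of columns in which \<open>x\<close> may still be
    non-zero. For \<open>T = S\<close> the condition on \<open>x\<close> is void and the claim is
    the stabilisation itself.\<close>
  have "\<exists>N. \<forall>n\<ge>N. \<forall>x\<in>J n. (\<forall>j\<in>S - T. x \<odot> e j = 0) \<longrightarrow> x \<in> J N" if "T \<subseteq> S" for T
    using finite_subset[OF that S] that
  proof (induction T rule: finite_induct)
    case empty
    have "x \<in> J 0" if "x \<in> J n" "\<forall>j\<in>S - {}. x \<odot> e j = 0" for n x
    proof -
      have "x = x \<odot> sum e S" using unit(2)[of x, symmetric] JB[of n] that(1) by blast
      also have "\<dots> = 0" unfolding sum_right using that(2) by simp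
      finally show ?thesis using Jadd[of 0] by (simp add: addsub_def)
    qed
    then show ?case by blast
  next
    case (insert k T)
    then obtain N1 where N1: "\<And>n x. n \<ge> N1 \<Longrightarrow> x \<in> J n \<Longrightarrow> \<forall>j\<in>S - T. x \<odot> e j = 0 \<Longrightarrow> x \<in> J N1"
      by blast
    from insert have k: "k \<in> S" by auto
    define Q where "Q n = {x \<in> J n. \<forall>j\<in>S - insert k T. x \<odot> e j = 0}" for n
    \<comment> \<open>\<open>K i n\<close> collects the entries in row \<open>i\<close> and column
      \<open>k\<close>. For \<open>b\<close> in the diagonal component at \<open>i\<close> one has
      \<open>b \<odot> (e i \<odot> x \<odot> e k) = e i \<odot> (b \<odot> x) \<odot> e k\<close>,
      which makes it a submodule.\<close>
    define K where "K i n = (\<lambda>x. e i \<odot> x \<odot> e k) ` Q n" for i n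
    have Qadd: "addsub (Q n)" for n
      using Jadd[of n] by (auto simp: Q_def addsub_def ldistr minus_left)
    have "\<exists>N. \<forall>n\<ge>N. K i n = K i N" if i: "i \<in> S" for i
    proof -
      have sub: "submod m {x \<in> B. e i \<odot> x = x \<and> x \<odot> e i = x}
          {x \<in> B. e i \<odot> x = x \<and> x \<odot> e k = x} (K i n)" for n
        unfolding submod_def
      proof (intro conjI ballI)
        show "K i n \<subseteq> {x \<in> B. e i \<odot> x = x \<and> x \<odot> e k = x}"
        proof
          fix z assume "z \<in> K i n"
          then obtain x where x: "x \<in> J n" "z = e i \<odot> x \<odot> e k" by (auto simp: K_def Q_def)
          have "z \<in> B" using x JB[of n] e(1) i k B(2) by auto
          moreover have "e i \<odot> z = z" unfolding x assoc[symmetric] using e(2)[OF i] by simp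
          moreover have "z \<odot> e k = z" unfolding x assoc using e(2)[OF k] by simp
          ultimately show "z \<in> {x \<in> B. e i \<odot> x = x \<and> x \<odot> e k = x}" by simp
        qed
        show "addsub (K i n)"
          unfolding K_def by (rule addsub_image[OF Qadd]) (simp add: ldistr rdistr)
        fix b z assume b: "b \<in> {x \<in> B. e i \<odot> x = x \<and> x \<odot> e i = x}" and "z \<in> K i n"
        then obtain x where x: "x \<in> Q n" "z = e i \<odot> x \<odot> e k" by (auto simp: K_def)
        from b have bb: "b \<in> B" "e i \<odot> b = b" "b \<odot> e i = b" by auto
        have "b \<odot> z = b \<odot> e i \<odot> x \<odot> e k" unfolding x by (simp only: assoc)
        also have "\<dots> = e i \<odot> (b \<odot> x) \<odot> e k" by (simp only: assoc[symmetric] bb)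
        finally have "b \<odot> z = e i \<odot> (b \<odot> x) \<odot> e k" .
        moreover have "b \<odot> x \<in> Q n" using x(1) Jm bb(1) by (auto simp: Q_def assoc)
        ultimately show "b \<odot> z \<in> K i n" by (auto simp: K_def)
      qed
      have "K i n \<subseteq> K i (Suc n)" for n using J unfolding K_def Q_def by blast
      from accD[where J = "K i", OF acc[OF i k] sub this] show ?thesis by metis
    qed
    then obtain M where M: "\<And>i n. i \<in> S \<Longrightarrow> n \<ge> M i \<Longrightarrow> K i n = K i (M i)" by metis
    define N where "N = Max (insert N1 (M ` S))"
    have NM: "M i \<le> N" if "i \<in> S" for i using S that by (auto simp: N_def)
    have NN: "N1 \<le> N" using S by (auto simp: N_def)
    have "x \<in> J N" if n: "n \<ge> N" and x: "x \<in> J n" "\<forall>j\<in>S - insert k T. x \<odot> e j = 0" for n x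
    proof -
      have "\<exists>y. y \<in> Q N \<and> e i \<odot> x \<odot> e k = e i \<odot> y \<odot> e k" if i: "i \<in> S" for i
      proof -
        have "e i \<odot> x \<odot> e k \<in> K i n" using x by (auto simp: K_def Q_def)
        also have "K i n = K i N" using M[OF i] NM[OF i] n by (metis order_trans)
        finally show ?thesis by (auto simp: K_def)
      qed
      then obtain y where y: "\<And>i. i \<in> S \<Longrightarrow> y i \<in> Q N"
        "\<And>i. i \<in> S \<Longrightarrow> e i \<odot> x \<odot> e k = e i \<odot> y i \<odot> e k" by metis
      \<comment> \<open>The entries of column \<open>k\<close> of \<open>x\<close> also come from
        elements \<open>y i\<close> of \<open>J N\<close>. Reassembled row by row they give an
        element of \<open>J N\<close> with the same column \<open>k\<close>, so \<open>x - z\<close>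
        has one column less.\<close>
      define z where "z = (\<Sum>i\<in>S. e i \<odot> y i)"
      have zN: "z \<in> J N" unfolding z_def using y(1)
        by (intro addsub_sum Jadd Jm e) (auto simp: Q_def)
      have "z \<odot> e k = sum e S \<odot> x \<odot> e k"
        unfolding z_def sum_left using y(2) by (intro sum.cong) auto
      also have "\<dots> = x \<odot> e k" using unit(1)[of x] x(1) JB[of n] by (simp add: subset_iff)
      finally have zk: "(x - z) \<odot> e k = 0" by (simp add: diff_left)
      have zj: "z \<odot> e j = 0" if "j \<in> S - insert k T" for j
        unfolding z_def sum_left using y(1) that by (intro sum.neutral) (auto simp: Q_def assoc)
      have "x - z \<in> J n" using zN x(1) mono[OF n] Jadd by (blast intro: addsub_diff)
      moreover have "\<forall>j\<in>S - T. (x - z) \<odot> e j = 0"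
      proof
        fix j assume "j \<in> S - T"
        then show "(x - z) \<odot> e j = 0" using zk zj[of j] x(2)
          by (cases "j = k") (auto simp: diff_left)
      qed
      ultimately have "x - z \<in> J N1" using N1 NN n by (meson order_trans)
      then have "x - z \<in> J N" using mono[OF NN] by auto
      then have "(x - z) + z \<in> J N" using zN Jadd[of N] unfolding addsub_def by blast
      then show ?thesis by simp
    qed
    then show ?case by blast
  qed
  from this[of S] obtain N where N: "\<And>n x. n \<ge> N \<Longrightarrow> x \<in> J n \<Longrightarrow> x \<in> J N" by auto
  have "J n = J N" if "n \<ge> N" for n using N[OF that] mono[OF that] by blast
  then show "\<exists>N. \<forall>n\<ge>N. J n = J N" by blast
qed

end

text \<open>Each \<open>b'\<close> has only to be imitated by some \<open>b\<close>: the images are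
  then submodules, and injectivity of \<open>f\<close> carries the stabilisation of the image chain
  back.\<close>

lemma acc_embed:
  fixes f :: "'b::ab_group_add \<Rightarrow> 'c::ab_group_add"
  assumes acc: "acc m' B' U'"
    and f: "\<And>x. x \<in> U \<Longrightarrow> f x \<in> U'" "inj_on f U" "\<And>x y. f (x + y) = f x + f y"
    and B: "\<And>b'. b' \<in> B' \<Longrightarrow> \<exists>b\<in>B. \<forall>x\<in>U. f (m b x) = m' b' (f x)"
  shows "acc m B U"
  unfolding acc_def
proof (intro allI impI)
  fix J :: "nat \<Rightarrow> 'b set"
  assume J: "(\<forall>n. submod m B U (J n)) \<and> (\<forall>n. J n \<subseteq> J (Suc n))"
  have "submod m' B' U' (f ` J n)" for n
    unfolding submod_def
  proof (intro conjI ballI)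
    have Jn: "J n \<subseteq> U" "addsub (J n)" "\<And>b x. b \<in> B \<Longrightarrow> x \<in> J n \<Longrightarrow> m b x \<in> J n"
      using J by (auto simp: submod_def)
    show "f ` J n \<subseteq> U'" using Jn f(1) by auto
    show "addsub (f ` J n)" using Jn(2) f(3) by (rule addsub_image)
    fix b' y assume "b' \<in> B'" "y \<in> f ` J n"
    then obtain x b where "x \<in> J n" "y = f x" "b \<in> B" "\<forall>x\<in>U. f (m b x) = m' b' (f x)"
      using B by blast
    then have "m' b' y = f (m b x)" "m b x \<in> J n" using Jn by auto
    then show "m' b' y \<in> f ` J n" by blast
  qed
  moreover have "f ` J n \<subseteq> f ` J (Suc n)" for n using J by blast
  ultimately obtain N where N: "\<And>n. n \<ge> N \<Longrightarrow> f ` J n = f ` J N"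
    using accD[OF acc, of "\<lambda>n. f ` J n"] by metis
  have "J n = J N" if "n \<ge> N" for n
  proof -
    have "J n \<subseteq> U" "J N \<subseteq> U" using J by (auto simp: submod_def)
    with N[OF that] show ?thesis using inj_on_image_eq_iff[OF f(2)] by blast
  qed
  then show "\<exists>N. \<forall>n\<ge>N. J n = J N" by blast
qed

interpretation mult: biadditive_assoc "(*)"
  by standard (simp_all add: algebra_simps)

interpretation opp_mult: biadditive_assoc "\<lambda>x y. y * x"
  by standard (simp_all add: algebra_simps)

section \<open>Ring records inside a type-class ring\<close>

lemma carrier_corner:
  "carrier (corner R e) = {e \<otimes>\<^bsub>R\<^esub> x \<otimes>\<^bsub>R\<^esub> e | x. x \<in> carrier R}"
  by (simp add: corner_def)

text \<open>No unit is mentioned, so that ideals and corners qualify too. Negatives are demanded of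
  the image only, since \<open>a_inv\<close> of a record has no meaning before the group laws are
  known.\<close>

definition ring_embedding :: "('a, 'm) ring_scheme \<Rightarrow> ('a \<Rightarrow> 'r::ring_1) \<Rightarrow> bool" where
  "ring_embedding R h \<longleftrightarrow> inj_on h (carrier R) \<and> \<zero>\<^bsub>R\<^esub> \<in> carrier R \<and> h \<zero>\<^bsub>R\<^esub> = 0 \<and>
     (\<forall>x\<in>carrier R. \<forall>y\<in>carrier R. x \<oplus>\<^bsub>R\<^esub> y \<in> carrier R \<and> h (x \<oplus>\<^bsub>R\<^esub> y) = h x + h y \<and>
        x \<otimes>\<^bsub>R\<^esub> y \<in> carrier R \<and> h (x \<otimes>\<^bsub>R\<^esub> y) = h x * h y) \<and>
     (\<forall>x\<in>carrier R. - h x \<in> h ` carrier R)"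

context
  fixes R :: "('a, 'm) ring_scheme" (structure) and h :: "'a \<Rightarrow> 'r::ring_1"
  assumes emb: "ring_embedding R h"
begin

lemma emb_inj: "x \<in> carrier R \<Longrightarrow> y \<in> carrier R \<Longrightarrow> h x = h y \<longleftrightarrow> x = y"
  using emb unfolding ring_embedding_def by (auto simp: inj_on_def)

lemma emb_mem: "I \<subseteq> carrier R \<Longrightarrow> x \<in> carrier R \<Longrightarrow> h x \<in> h ` I \<longleftrightarrow> x \<in> I"
  using emb_inj by (metis image_iff subsetD)

lemma emb_simps [simp]:
  "\<zero> \<in> carrier R" "h \<zero> = 0"
  "x \<in> carrier R \<Longrightarrow> y \<in> carrier R \<Longrightarrow> x \<oplus> y \<in> carrier R"
  "x \<in> carrier R \<Longrightarrow> y \<in> carrier R \<Longrightarrow> h (x \<oplus> y) = h x + h y"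
  "x \<in> carrier R \<Longrightarrow> y \<in> carrier R \<Longrightarrow> x \<otimes> y \<in> carrier R"
  "x \<in> carrier R \<Longrightarrow> y \<in> carrier R \<Longrightarrow> h (x \<otimes> y) = h x * h y"
  using emb unfolding ring_embedding_def by auto

lemma emb_neg:
  assumes "x \<in> carrier R"
  obtains y where "y \<in> carrier R" "h y = - h x"
  using emb assms unfolding ring_embedding_def by (metis imageE)

lemma emb_abelian_group: "abelian_group R"
proof (rule abelian_groupI)
  fix x assume x: "x \<in> carrier R"
  obtain y where "y \<in> carrier R" "h y = - h x" using emb_neg[OF x] .
  then show "\<exists>y\<in>carrier R. y \<oplus> x = \<zero>" using x
    by (intro bexI[of _ y]) (auto simp: emb_inj[symmetric])
qed (auto simp: emb_inj[symmetric] algebra_simps)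

lemma emb_a_inv:
  assumes "x \<in> carrier R"
  shows "\<ominus> x \<in> carrier R" "h (\<ominus> x) = - h x"
proof -
  interpret abelian_group R by (rule emb_abelian_group)
  show c: "\<ominus> x \<in> carrier R" using assms by simp
  have "h (\<ominus> x \<oplus> x) = 0" using l_neg[OF assms] by simp
  then show "h (\<ominus> x) = - h x" using c assms by (simp add: eq_neg_iff_add_eq_0)
qed

lemma emb_ring:
  assumes "\<one> \<in> carrier R" "\<And>x. x \<in> carrier R \<Longrightarrow> h \<one> * h x = h x \<and> h x * h \<one> = h x"
  shows "ring R"
proof (rule ringI)
  show "abelian_group R" by (rule emb_abelian_group)
  show "monoid R" using assms by (intro monoidI) (auto simp: emb_inj[symmetric] mult.assoc)
qed (auto simp: emb_inj[symmetric] algebra_simps)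

lemma emb_additive_subgroup:
  "additive_subgroup I R \<longleftrightarrow> I \<subseteq> carrier R \<and> addsub (h ` I)"
proof
  interpret abelian_group R by (rule emb_abelian_group)
  assume "additive_subgroup I R"
  then interpret I: additive_subgroup I R .
  have sub: "I \<subseteq> carrier R" using I.a_subset .
  have "- h x \<in> h ` I" if "x \<in> I" for x
    using that sub I.a_inv_closed[OF that] emb_a_inv(2)[of x] by (metis image_eqI subsetD)
  moreover have "h x + h y \<in> h ` I" if "x \<in> I" "y \<in> I" for x y
    using that sub I.a_closed[OF that] emb_simps(4)[of x y] by (metis image_eqI subsetD)
  moreover have "0 \<in> h ` I" using I.zero_closed by (metis emb_simps(2) image_eqI)
  ultimately show "I \<subseteq> carrier R \<and> addsub (h ` I)" using sub by (auto simp: addsub_def)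
next
  interpret abelian_group R by (rule emb_abelian_group)
  assume I: "I \<subseteq> carrier R \<and> addsub (h ` I)"
  have mem: "x \<in> I" if "x \<in> carrier R" "h x \<in> h ` I" for x
    using that I emb_mem by blast
  show "additive_subgroup I R"
  proof (rule additive_subgroupI, rule add.subgroupI)
    show "I \<subseteq> carrier R" "I \<noteq> {}" using I by (auto simp: addsub_def)
    fix a b assume ab: "a \<in> I" "b \<in> I"
    show "\<ominus> a \<in> I"
      using ab I by (intro mem) (auto simp: emb_a_inv addsub_def subset_iff)
    show "a \<oplus> b \<in> I"
      using ab I by (intro mem) (auto simp: addsub_def subset_iff)
  qed
qed

lemma emb_left_ideal:
  "left_ideal I R \<longleftrightarrow> I \<subseteq> carrier R \<and> submod (*) (h ` carrier R) (h ` carrier R) (h ` I)"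
proof (cases "I \<subseteq> carrier R")
  case True
  have "x \<otimes> a \<in> I \<longleftrightarrow> h x * h a \<in> h ` I" if "a \<in> I" "x \<in> carrier R" for a x
    using that True emb_mem[OF True, of "x \<otimes> a"] by (auto simp: subset_iff)
  then show ?thesis
    using True by (auto simp: left_ideal_def submod_def emb_additive_subgroup)
next
  case False
  then show ?thesis by (auto simp: left_ideal_def emb_additive_subgroup)
qed

lemma emb_right_ideal:
  "right_ideal I R \<longleftrightarrow>
    I \<subseteq> carrier R \<and> submod (\<lambda>x y. y * x) (h ` carrier R) (h ` carrier R) (h ` I)"
proof (cases "I \<subseteq> carrier R")
  case True
  have "a \<otimes> x \<in> I \<longleftrightarrow> h a * h x \<in> h ` I" if "a \<in> I" "x \<in> carrier R" for a x
    using that True emb_mem[OF True, of "a \<otimes> x"] by (auto simp: subset_iff)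
  then show ?thesis
    using True by (auto simp: right_ideal_def submod_def emb_additive_subgroup)
next
  case False
  then show ?thesis by (auto simp: right_ideal_def emb_additive_subgroup)
qed

lemma emb_preimage: "J \<subseteq> h ` carrier R \<Longrightarrow> h ` {x \<in> carrier R. h x \<in> J} = J"
  by auto

text \<open>\<open>h\<close> matches the ideals described by \<open>P\<close> with submodules of the
  image, and by \<open>emb_preimage\<close> every submodule is reached, so chains transfer both
  ways. \<open>P\<close> stands for left and for right ideals.\<close>

lemma emb_chain_condition:
  assumes P: "\<And>I. P I \<longleftrightarrow> I \<subseteq> carrier R \<and> submod m (h ` carrier R) (h ` carrier R) (h ` I)"
  shows "(\<forall>I::nat \<Rightarrow> 'a set. (\<forall>n. P (I n)) \<longrightarrow> (\<forall>n. I n \<subseteq> I (Suc n)) \<longrightarrow> (\<exists>N. \<forall>n\<ge>N. I n = I N)) \<longleftrightarrow>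
    acc m (h ` carrier R) (h ` carrier R)" (is "?L \<longleftrightarrow> ?R")
proof
  assume l: ?L
  show ?R
    unfolding acc_def
  proof (intro allI impI)
    fix J :: "nat \<Rightarrow> 'r set"
    assume J: "(\<forall>n. submod m (h ` carrier R) (h ` carrier R) (J n)) \<and> (\<forall>n. J n \<subseteq> J (Suc n))"
    then have im: "h ` {x \<in> carrier R. h x \<in> J n} = J n" for n
      by (intro emb_preimage) (auto simp: submod_def)
    then have "\<forall>n. P {x \<in> carrier R. h x \<in> J n}" using J by (auto simp: P)
    moreover have "\<forall>n. {x \<in> carrier R. h x \<in> J n} \<subseteq> {x \<in> carrier R. h x \<in> J (Suc n)}" using J
      by auto
    ultimately obtain N where N: "{x \<in> carrier R. h x \<in> J n} = {x \<in> carrier R. h x \<in> J N}" if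
      "n \<ge> N" for n
      using l[rule_format, of "\<lambda>n. {x \<in> carrier R. h x \<in> J n}"] by blast
    have "J n = J N" if "n \<ge> N" for n using arg_cong[OF N[OF that], of "image h"] by (simp only: im)
    then show "\<exists>N. \<forall>n\<ge>N. J n = J N" by blast
  qed
next
  assume acc: ?R
  show ?L
  proof (intro allI impI)
    fix I :: "nat \<Rightarrow> 'a set"
    assume I: "\<forall>n. P (I n)" "\<forall>n. I n \<subseteq> I (Suc n)"
    have "\<exists>N. \<forall>n\<ge>N. h ` I n = h ` I N"
      using I acc[unfolded acc_def, rule_format, of "\<lambda>n. h ` I n"] by (auto simp: P image_mono)
    moreover have "inj_on h (carrier R)" "\<And>n. I n \<subseteq> carrier R"
      using I(1) by (auto simp: P inj_on_def emb_inj)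
    ultimately show "\<exists>N. \<forall>n\<ge>N. I n = I N" by (simp add: inj_on_image_eq_iff)
  qed
qed

lemma emb_left_noetherian:
  "left_noetherian_ring R \<longleftrightarrow> ring R \<and> acc (*) (h ` carrier R) (h ` carrier R)"
  unfolding left_noetherian_ring_def left_noetherian_ring_axioms_def
    emb_chain_condition[OF emb_left_ideal, symmetric] by blast

lemma emb_right_noetherian:
  "right_noetherian_ring R \<longleftrightarrow> ring R \<and> acc (\<lambda>x y. y * x) (h ` carrier R) (h ` carrier R)"
  unfolding right_noetherian_ring_def right_noetherian_ring_axioms_def
    emb_chain_condition[OF emb_right_ideal, symmetric] by blast

lemma emb_idempotent: "idempotent R e \<longleftrightarrow> e \<in> carrier R \<and> h e * h e = h e"
  unfolding idempotent_def using emb_inj[of "e \<otimes> e" e] by auto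

lemma emb_subring:
  assumes "two_sided_ideal I R"
  shows "ring_embedding (R\<lparr>carrier := I\<rparr>) h"
proof -
  have sub: "I \<subseteq> carrier R" "addsub (h ` I)" and m: "\<And>x y. x \<in> I \<Longrightarrow> y \<in> I \<Longrightarrow> x \<otimes> y \<in> I"
    using assms by (auto simp: two_sided_ideal_def left_ideal_def emb_additive_subgroup)
  interpret I: additive_subgroup I R using assms by (simp add: two_sided_ideal_def left_ideal_def)
  show ?thesis
    unfolding ring_embedding_def using sub m I.a_closed I.zero_closed
    by (auto simp: inj_on_def emb_inj subset_iff addsub_def)
qed

text \<open>Idempotence identifies the products with \<open>h e\<close> on both sides with the
  elements fixed by it; all later chain conditions are stated for this set of fixed
  elements.\<close>

lemma emb_image_corner:
  assumes "idempotent R e"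
  shows "h ` carrier (corner R e) = {x \<in> h ` carrier R. h e * x = x \<and> x * h e = x}"
proof safe
  have e: "e \<in> carrier R" "h e * h e = h e" using assms by (auto simp: emb_idempotent)
  fix z assume "z \<in> carrier (corner R e)"
  then obtain x where x: "x \<in> carrier R" "z = e \<otimes> x \<otimes> e" by (auto simp: carrier_corner)
  then have hz: "h z = h e * h x * h e" using e by simp
  show "h z \<in> h ` carrier R" using x e by (intro imageI) simp
  show "h e * h z = h z" unfolding hz mult.assoc[symmetric] e(2) ..
  show "h z * h e = h z" unfolding hz mult.assoc e(2) ..
next
  have e: "e \<in> carrier R" using assms by (auto simp: emb_idempotent)
  fix x assume x: "x \<in> carrier R" "h e * h x = h x" "h x * h e = h x"
  then have "h x = h (e \<otimes> x \<otimes> e)" using e by simp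
  then show "h x \<in> h ` carrier (corner R e)" using x(1) by (auto simp: carrier_corner)
qed

lemma emb_corner:
  assumes e: "idempotent R e"
  shows "ring_embedding (corner R e) h"
proof -
  have ee: "e \<in> carrier R" "h e * h e = h e" using e by (auto simp: emb_idempotent)
  have mem: "x \<in> carrier (corner R e) \<longleftrightarrow> x \<in> carrier R \<and> h e * h x = h x \<and> h x * h e = h x" for x
  proof
    assume x: "x \<in> carrier (corner R e)"
    then have "x \<in> carrier R" using ee by (auto simp: carrier_corner)
    moreover have "h x \<in> h ` carrier (corner R e)" using x by simp
    ultimately show "x \<in> carrier R \<and> h e * h x = h x \<and> h x * h e = h x"
      unfolding emb_image_corner[OF e] by simp
  next
    assume x: "x \<in> carrier R \<and> h e * h x = h x \<and> h x * h e = h x"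
    then have "x = e \<otimes> x \<otimes> e" using ee by (auto simp: emb_inj[symmetric])
    then show "x \<in> carrier (corner R e)" using x by (auto simp: carrier_corner)
  qed
  have ops: "x \<oplus>\<^bsub>corner R e\<^esub> y = x \<oplus> y" "x \<otimes>\<^bsub>corner R e\<^esub> y = x \<otimes> y"
    "\<zero>\<^bsub>corner R e\<^esub> = \<zero>" for x y by (simp_all add: corner_def)
  show "ring_embedding (corner R e) h"
    unfolding ring_embedding_def ops
  proof (intro conjI ballI)
    show "inj_on h (carrier (corner R e))" by (auto simp: inj_on_def mem emb_inj)
    fix x assume x: "x \<in> carrier (corner R e)"
    show "- h x \<in> h ` carrier (corner R e)"
      using x emb_a_inv[of x] by (intro image_eqI[of _ _ "\<ominus> x"]) (auto simp: mem)
    fix y assume y: "y \<in> carrier (corner R e)"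
    show "x \<otimes> y \<in> carrier (corner R e)"
    proof -
      have "h e * (h x * h y) = h x * h y" "h x * h y * h e = h x * h y"
        using x y by (simp_all add: mem mult.assoc flip: mult.assoc[of "h e"])
      then show ?thesis using x y by (simp add: mem)
    qed
  qed (auto simp: mem distrib_left distrib_right)
qed

end

lemma ring_corner:
  assumes "ring_embedding R h" "idempotent R e"
  shows "ring (corner R e)"
proof (rule emb_ring[OF emb_corner[OF assms]])
  have one: "\<one>\<^bsub>corner R e\<^esub> = e" by (simp add: corner_def)
  have e: "e \<in> carrier R" "h e * h e = h e" using emb_idempotent[OF assms(1), of e] assms(2) by auto
  show "\<one>\<^bsub>corner R e\<^esub> \<in> carrier (corner R e)"
    using assms(2) by (auto simp: corner_def idempotent_def intro!: exI[of _ e])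
  fix x assume "x \<in> carrier (corner R e)"
  then have "h x \<in> h ` carrier (corner R e)" by simp
  then show "h \<one>\<^bsub>corner R e\<^esub> * h x = h x \<and> h x * h \<one>\<^bsub>corner R e\<^esub> = h x"
    unfolding one emb_image_corner[OF assms] by simp
qed

section \<open>Leavitt families\<close>

text \<open>Sums of generators without negatives. The sets to which this is applied contain all
  scalar multiples of their members, so it is a linear span, and inductions add one monomial at a
  time.\<close>

inductive_set aspan :: "'r::ab_group_add set \<Rightarrow> 'r set" for S where
  zero: "0 \<in> aspan S"
| add: "s \<in> S \<Longrightarrow> x \<in> aspan S \<Longrightarrow> s + x \<in> aspan S"

lemma aspan_base: "s \<in> S \<Longrightarrow> s \<in> aspan S"
  using aspan.add[OF _ aspan.zero] by force

lemma aspan_add: "x \<in> aspan S \<Longrightarrow> y \<in> aspan S \<Longrightarrow> x + y \<in> aspan S"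
  by (induction rule: aspan.induct) (auto simp: add.assoc intro: aspan.intros)

lemma aspan_map:
  fixes f :: "'r::ab_group_add \<Rightarrow> 'q::ab_group_add"
  assumes "x \<in> aspan S" "\<And>s. s \<in> S \<Longrightarrow> f s \<in> aspan S'" "\<And>x y. f (x + y) = f x + f y"
  shows "f x \<in> aspan S'"
  using assms(1)
proof induction
  case zero
  have "f 0 = 0" using assms(3)[of 0 0] by simp
  then show ?case by (simp add: aspan.zero)
qed (auto simp: assms aspan_add)

lemma aspan_mono: "x \<in> aspan S \<Longrightarrow> S \<subseteq> S' \<Longrightarrow> x \<in> aspan S'"
  using aspan_map[of x S "\<lambda>x. x" S'] by (auto intro: aspan_base)

lemma aspan_least: "x \<in> aspan S \<Longrightarrow> addsub J \<Longrightarrow> S \<subseteq> J \<Longrightarrow> x \<in> J"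
  by (induction rule: aspan.induct) (auto simp: addsub_def)

text \<open>
  The relations of a Leavitt path algebra between elements of a ring, together with the linear
  independence of the paths ending at a common vertex. The scalars act by multiplication with the
  elements \<open>sc k\<close>. A path \<open>p\<close> is the product \<open>el p\<close> of its edges and \<open>gl p\<close> is its ghost; both
  are \<open>1\<close> for the empty list, so it is \<open>el p * V w\<close> that represents a path from \<open>u\<close> to \<open>w\<close>
  independently of its length.
\<close>

locale leavitt_family = wf_digraph G for G :: "('v, 'e) pre_digraph" +
  fixes V :: "'v \<Rightarrow> 'r::ring_1" and D H :: "'e \<Rightarrow> 'r" and sc :: "'k::field \<Rightarrow> 'r"
  assumes V_V: "\<And>v w. v \<in> verts G \<Longrightarrow> w \<in> verts G \<Longrightarrow> V v * V w = (if v = w then V v else 0)"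
    and V_D: "\<And>e. e \<in> arcs G \<Longrightarrow> V (tail G e) * D e = D e"
    and D_V: "\<And>e. e \<in> arcs G \<Longrightarrow> D e * V (head G e) = D e"
    and V_H: "\<And>e. e \<in> arcs G \<Longrightarrow> V (head G e) * H e = H e"
    and H_V: "\<And>e. e \<in> arcs G \<Longrightarrow> H e * V (tail G e) = H e"
    and H_D: "\<And>e f. e \<in> arcs G \<Longrightarrow> f \<in> arcs G \<Longrightarrow> H e * D f = (if e = f then V (head G e) else 0)"
    and V_sum: "\<And>v. regular_vertex G v \<Longrightarrow> V v = (\<Sum>e\<in>out_arcs G v. D e * H e)"
    and sc_add: "\<And>a b. sc (a + b) = sc a + sc b"
    and sc_mult: "\<And>a b. sc (a * b) = sc a * sc b"
    and sc_one: "\<And>v. v \<in> verts G \<Longrightarrow> sc 1 * V v = V v"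
    and sc_V: "\<And>a v. v \<in> verts G \<Longrightarrow> V v * sc a = sc a * V v"
    and sc_D: "\<And>a e. e \<in> arcs G \<Longrightarrow> D e * sc a = sc a * D e"
    and sc_H: "\<And>a e. e \<in> arcs G \<Longrightarrow> H e * sc a = sc a * H e"
    and independent: "\<And>v S k p. finite S \<Longrightarrow> (\<And>q. q \<in> S \<Longrightarrow> \<exists>u. awalk u q v) \<Longrightarrow>
      (\<Sum>q\<in>S. sc (k q) * (prod_list (map D q) * V v)) = 0 \<Longrightarrow> p \<in> S \<Longrightarrow> k p = 0"
begin

definition el :: "'e list \<Rightarrow> 'r" where "el p = prod_list (map D p)"
definition gl :: "'e list \<Rightarrow> 'r" where "gl p = prod_list (rev (map H p))"

lemma el_simps [simp]: "el [] = 1" "el (e # p) = D e * el p" "el (p @ q) = el p * el q"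
  by (simp_all add: el_def)

lemma gl_simps [simp]: "gl [] = 1" "gl (e # p) = gl p * H e" "gl (p @ q) = gl q * gl p"
  by (simp_all add: gl_def)

lemma sc_zero [simp]: "sc 0 = 0"
  using sc_add[of 0 0] by simp

lemma sc_minus: "sc (- a) = - sc a"
  using sc_add[of a "- a"] by (simp add: eq_neg_iff_add_eq_0 add.commute)

lemma sc_el: "set p \<subseteq> arcs G \<Longrightarrow> el p * sc a = sc a * el p"
  by (induction p) (auto simp: mult.assoc sc_D, simp add: sc_D flip: mult.assoc)

lemma sc_gl: "set p \<subseteq> arcs G \<Longrightarrow> gl p * sc a = sc a * gl p"
  by (induction p) (auto simp: mult.assoc sc_H, simp flip: mult.assoc)

lemma V_idem: "v \<in> verts G \<Longrightarrow> V v * V v = V v"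
  by (simp add: V_V)

lemma V_idem': "v \<in> verts G \<Longrightarrow> V v * (V v * x) = V v * x"
  by (simp add: V_V flip: mult.assoc)

lemma V_ne: "v \<in> verts G \<Longrightarrow> w \<in> verts G \<Longrightarrow> v \<noteq> w \<Longrightarrow> V v * V w = 0"
  "v \<in> verts G \<Longrightarrow> w \<in> verts G \<Longrightarrow> v \<noteq> w \<Longrightarrow> V v * (V w * x) = 0"
  by (simp_all add: V_V flip: mult.assoc)

text \<open>Commuting vertices past a path, instead of absorbing them, stays true for the empty
  list, where \<open>el p\<close> is 1.\<close>

lemma V_el: "awalk u p w \<Longrightarrow> V u * el p = el p * V w"
proof (induction p arbitrary: u)
  case (Cons e p)
  then have e: "e \<in> arcs G" "u = tail G e" "awalk (head G e) p w" by (auto simp: awalk_Cons_iff)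
  have "V u * el (e # p) = V (tail G e) * D e * el p" by (simp add: e mult.assoc)
  also have "\<dots> = D e * (V (head G e) * el p)" by (simp add: e V_D D_V flip: mult.assoc)
  also have "\<dots> = el (e # p) * V w" by (simp add: Cons.IH[OF e(3)] mult.assoc)
  finally show ?case .
qed (auto simp: awalk_Nil_iff)

lemma gl_V: "awalk u p w \<Longrightarrow> gl p * V u = V w * gl p"
proof (induction p arbitrary: u)
  case (Cons e p)
  then have e: "e \<in> arcs G" "u = tail G e" "awalk (head G e) p w" by (auto simp: awalk_Cons_iff)
  have "gl (e # p) * V u = gl p * (V (head G e) * H e)" by (simp add: e mult.assoc V_H H_V)
  also have "\<dots> = V w * gl (e # p)" by (simp add: Cons.IH[OF e(3)] flip: mult.assoc)
  finally show ?case .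
qed (auto simp: awalk_Nil_iff)

lemma V_el': "awalk u p w \<Longrightarrow> V u * (el p * x) = el p * (V w * x)"
  by (simp add: V_el flip: mult.assoc)

lemma gl_V': "awalk u p w \<Longrightarrow> gl p * (V u * x) = V w * (gl p * x)"
  by (simp add: gl_V flip: mult.assoc)

lemma gl_el: "awalk u p w \<Longrightarrow> V w * (gl p * el p) = V w"
proof (induction p arbitrary: u)
  case (Cons e p)
  then have e: "e \<in> arcs G" "awalk (head G e) p w" by (auto simp: awalk_Cons_iff)
  have "V w * (gl (e # p) * el (e # p)) = V w * gl p * (H e * D e) * el p" by (simp add: mult.assoc)
  also have "\<dots> = V w * (gl p * V (head G e)) * el p" using e by (simp add: H_D mult.assoc)
  also have "\<dots> = V w * (gl p * el p)"
    using e by (simp add: gl_V mult.assoc V_idem' awalk_last_in_verts)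
  finally show ?case using Cons.IH[OF e(2)] by simp
qed (auto simp: awalk_Nil_iff)

lemma gl_el': "awalk u p w \<Longrightarrow> V w * (gl p * (el p * x)) = V w * x"
  using gl_el by (simp flip: mult.assoc)

lemma gl_el_V: "awalk u p w \<Longrightarrow> gl p * (el p * V w) = V w"
  "awalk u p w \<Longrightarrow> gl p * (el p * (V w * x)) = V w * x"
  by (simp_all add: V_el[symmetric] gl_V gl_V' gl_el V_el'[symmetric] gl_el')

text \<open>If neither path extends the other there is a first place where they branch. Everything
  before it cancels, and then the ghost of one edge meets a different edge, which gives 0.\<close>

lemma gl_el_incomparable:
  assumes "awalk u p w" "awalk u q x" "\<nexists>s. q = p @ s" "\<nexists>s. p = q @ s"
  shows "gl p * el q = 0"
  using assms
proof (induction p arbitrary: u q)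
  case (Cons e p)
  then obtain f q' where q: "q = f # q'" by (cases q) auto
  from Cons.prems q have e: "e \<in> arcs G" "awalk (head G e) p w" "f \<in> arcs G" "awalk (head G f) q' x"
    by (auto simp: awalk_Cons_iff)
  have eq: "gl (e # p) * el q = gl p * (H e * D f) * el q'" by (simp add: q mult.assoc)
  show ?case
  proof (cases "e = f")
    case True
    have "gl p * el q' = 0" by (rule Cons.IH[OF e(2)]) (use Cons.prems e True q in auto)
    then show ?thesis unfolding eq using e True by (simp add: H_D gl_V mult.assoc)
  next
    case False
    then show ?thesis unfolding eq using e by (simp add: H_D)
  qed
qed auto

lemma gl_el_different:
  assumes "awalk u p w" "awalk u' q x" "u \<noteq> u'"
  shows "V w * (gl p * (el q * V x)) = 0"
proof -
  have "V w * (gl p * (el q * V x)) = gl p * (V u * (V u' * el q))"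
    by (simp add: V_el[OF assms(2)] gl_V'[OF assms(1)])
  then show ?thesis using assms by (simp add: V_ne awalk_hd_in_verts)
qed

section \<open>Monomials, their spans and local units\<close>

definition mon :: "'e list \<Rightarrow> 'v \<Rightarrow> 'e list \<Rightarrow> 'r" where
  "mon p w q = el p * (V w * gl q)"

text \<open>\<open>mon p w q\<close> is the path \<open>p\<close> times the ghost of
  \<open>q\<close>; the middle factor \<open>V w\<close> keeps this right when both are empty.
  Restricting the vertex where they meet yields the ideal generated by a hereditary
  \<open>W\<close>, and for \<open>verts G\<close> the whole algebra.\<close>

definition span :: "'v set \<Rightarrow> 'r set" where
  "span W = aspan {sc k * mon p w q | k p w q. w \<in> W \<and> (\<exists>u. awalk u p w) \<and> (\<exists>u. awalk u q w)}"

lemma span_mono: "x \<in> span W \<Longrightarrow> W \<subseteq> W' \<Longrightarrow> x \<in> span W'"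
  unfolding span_def by (erule aspan_mono) blast

lemma span_scmonI: "w \<in> W \<Longrightarrow> awalk u p w \<Longrightarrow> awalk u' q w \<Longrightarrow> sc k * mon p w q \<in> span W"
  unfolding span_def by (rule aspan_base) blast

lemma sc_one_mon: "awalk u p w \<Longrightarrow> sc 1 * mon p w q = mon p w q"
proof -
  assume p: "awalk u p w"
  then have "set p \<subseteq> arcs G" "w \<in> verts G" by auto
  then have "sc 1 * mon p w q = el p * (sc 1 * V w) * gl q"
    unfolding mon_def by (simp only: mult.assoc[symmetric] sc_el)
  then show ?thesis using p by (simp add: mon_def sc_one mult.assoc awalk_last_in_verts)
qed

lemma span_monI: "w \<in> W \<Longrightarrow> awalk u p w \<Longrightarrow> awalk u' q w \<Longrightarrow> mon p w q \<in> span W"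
  using span_scmonI[of w W u p u' q 1] sc_one_mon by simp

lemma span_add: "x \<in> span W \<Longrightarrow> y \<in> span W \<Longrightarrow> x + y \<in> span W"
  unfolding span_def by (rule aspan_add)

lemma span_zero [simp]: "0 \<in> span W"
  unfolding span_def by (rule aspan.zero)

lemma span_map:
  assumes "x \<in> span W"
    and "\<And>k p w q u u'. w \<in> W \<Longrightarrow> awalk u p w \<Longrightarrow> awalk u' q w \<Longrightarrow> f (sc k * mon p w q) \<in> span W'"
    and "\<And>x y. f (x + y) = f x + f y"
  shows "f x \<in> span W'"
  unfolding span_def
proof (rule aspan_map[OF assms(1)[unfolded span_def] _ assms(3)])
  fix s assume "s \<in> {sc k * mon p w q | k p w q. w \<in> W \<and> (\<exists>u. awalk u p w) \<and> (\<exists>u. awalk u q w)}"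
  then show "f s \<in> aspan {sc k * mon p w q | k p w q. w \<in> W' \<and> (\<exists>u. awalk u p w) \<and>
    (\<exists>u. awalk u q w)}"
    using assms(2)[unfolded span_def] by blast
qed

lemma span_sc: "x \<in> span W \<Longrightarrow> sc k * x \<in> span W"
  by (erule span_map[where f = "\<lambda>x. sc k * x"])
    (auto simp: distrib_left sc_mult[symmetric] span_scmonI simp flip: mult.assoc)

lemma span_addsub: "addsub (span W)"
proof -
  have "- x \<in> span W" if "x \<in> span W" for x
    by (rule span_map[OF that]) (auto simp: sc_minus[symmetric] span_scmonI simp flip:
      mult_minus_left)
  then show ?thesis by (auto simp: addsub_def span_add)
qed

lemma span_left_gen:
  assumes x: "x \<in> span W" and g: "\<And>p w q u u'. w \<in> W \<Longrightarrow> awalk u p w \<Longrightarrow> awalk u' q w \<Longrightarrow> g * mon p w q \<in>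
    span W"
    and c: "\<And>k. g * sc k = sc k * g"
  shows "g * x \<in> span W"
proof (rule span_map[OF x])
  fix k p w q u u' assume "w \<in> W" "awalk u p w" "awalk u' q w"
  then have "sc k * (g * mon p w q) \<in> span W" by (intro span_sc g)
  then show "g * (sc k * mon p w q) \<in> span W" by (simp add: c flip: mult.assoc)
qed (rule distrib_left)

lemma span_right_gen:
  assumes x: "x \<in> span W" and g: "\<And>p w q u u'. w \<in> W \<Longrightarrow> awalk u p w \<Longrightarrow> awalk u' q w \<Longrightarrow> mon p w q * g \<in>
    span W"
  shows "x * g \<in> span W"
proof (rule span_map[OF x])
  fix k p w q u u' assume "w \<in> W" "awalk u p w" "awalk u' q w"
  then have "sc k * (mon p w q * g) \<in> span W" by (intro span_sc g)
  then show "sc k * mon p w q * g \<in> span W" by (simp add: mult.assoc)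
qed (rule distrib_right)

lemma V_mon: "v \<in> verts G \<Longrightarrow> awalk u p w \<Longrightarrow> V v * mon p w q = (if v = u then mon p w q else 0)"
proof -
  assume v: "v \<in> verts G" and p: "awalk u p w"
  have m: "mon p w q = V u * (el p * gl q)" by (simp add: mon_def V_el'[OF p])
  show ?thesis unfolding m using v p by (auto simp: V_idem' V_ne awalk_hd_in_verts)
qed

lemma mon_V: "v \<in> verts G \<Longrightarrow> awalk u q w \<Longrightarrow> mon p w q * V v = (if v = u then mon p w q else 0)"
proof -
  assume v: "v \<in> verts G" and q: "awalk u q w"
  have m: "mon p w q = el p * (gl q * V u)" by (simp add: mon_def gl_V[OF q])
  show ?thesis unfolding m using v q by (auto simp: mult.assoc V_idem V_ne awalk_hd_in_verts)
qed

definition hereditary :: "'v set \<Rightarrow> bool" where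
  "hereditary W \<longleftrightarrow> W \<subseteq> verts G \<and> (\<forall>e\<in>arcs G. tail G e \<in> W \<longrightarrow> head G e \<in> W)"

lemma span_V:
  assumes "v \<in> verts G" "x \<in> span W" shows "V v * x \<in> span W" "x * V v \<in> span W"
proof -
  show "V v * x \<in> span W"
    by (rule span_left_gen[OF assms(2)]) (simp_all add: V_mon assms(1) sc_V span_monI)
  show "x * V v \<in> span W"
    by (rule span_right_gen[OF assms(2)]) (simp add: mon_V assms(1) span_monI)
qed

text \<open>Heredity enters in one situation: an edge to the right of an empty ghost path moves the
  meeting vertex from its tail to its head. Otherwise the edge lengthens \<open>p\<close> or cancels
  against \<open>q\<close>.\<close>

lemma span_D: assumes "hereditary W" "e \<in> arcs G" "x \<in> span W" shows "D e * x \<in> span W"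
  "x * D e \<in> span W"
proof -
  show "D e * x \<in> span W"
  proof (rule span_left_gen[OF assms(3)])
    fix p w q u u' assume w: "w \<in> W" and p: "awalk u p w" and q: "awalk u' q w"
    have "D e * mon p w q = D e * (V (head G e) * mon p w q)" using assms
      by (simp add: D_V flip: mult.assoc)
    also have "\<dots> = (if head G e = u then mon (e # p) w q else 0)"
      using assms p by (simp add: V_mon head_in_verts) (simp add: mon_def mult.assoc)
    finally show "D e * mon p w q \<in> span W"
      using w p q assms by (auto intro!: span_monI[of w W "tail G e"
        "e # p" u' q] simp: awalk_Cons_iff)
  qed (simp add: sc_D assms)
  show "x * D e \<in> span W"
  proof (rule span_right_gen[OF assms(3)])
    fix p w q u u' assume w: "w \<in> W" and p: "awalk u p w" and q: "awalk u' q w"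
    show "mon p w q * D e \<in> span W"
    proof (cases q)
      case Nil
      then have wv: "w \<in> verts G" "u' = w" using q by (auto simp: awalk_Nil_iff)
      have "V w * D e = (if w = tail G e then D e else 0)"
        using assms V_ne(2)[of w "tail G e" "D e"] wv by (auto simp: V_D)
      then have "mon p w q * D e = (if w = tail G e then mon (p @ [e]) (head G e) [] else 0)"
        using assms by (simp add: mon_def Nil mult.assoc D_V)
      then show ?thesis
        using w p assms by (auto intro!: span_monI[of _ W u "p @ [e]" "head G e" "[]"]
            simp: awalk_simps hereditary_def awlast_of_awalk)
    next
      case (Cons f q')
      then have f: "f \<in> arcs G" "awalk (head G f) q' w" using q by (auto simp: awalk_Cons_iff)
      have "mon p w q * D e = el p * (V w * (gl q' * (H f * D e)))"
        by (simp add: mon_def Cons mult.assoc)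
      also have "\<dots> = (if f = e then mon p w q' else 0)"
        using assms f by (auto simp: H_D gl_V V_idem' mon_def awalk_last_in_verts)
      finally show ?thesis using w p f by (auto intro: span_monI)
    qed
  qed
qed

lemma span_H: assumes "hereditary W" "e \<in> arcs G" "x \<in> span W" shows "H e * x \<in> span W"
  "x * H e \<in> span W"
proof -
  show "x * H e \<in> span W"
  proof (rule span_right_gen[OF assms(3)])
    fix p w q u u' assume w: "w \<in> W" and p: "awalk u p w" and q: "awalk u' q w"
    have "mon p w q * H e = mon p w q * V (head G e) * H e" using assms
      by (simp add: V_H mult.assoc)
    also have "\<dots> = (if head G e = u' then mon p w (e # q) else 0)"
      using assms q by (simp add: mon_V head_in_verts) (simp add: mon_def mult.assoc)
    finally show "mon p w q * H e \<in> span W"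
      using w p q assms by (auto intro!: span_monI[of w W u p "tail G e"
        "e # q"] simp: awalk_Cons_iff)
  qed
  show "H e * x \<in> span W"
  proof (rule span_left_gen[OF assms(3)])
    fix p w q u u' assume w: "w \<in> W" and p: "awalk u p w" and q: "awalk u' q w"
    show "H e * mon p w q \<in> span W"
    proof (cases p)
      case Nil
      then have wv: "w \<in> verts G" "u = w" using p by (auto simp: awalk_Nil_iff)
      have "H e * mon p w q = H e * V (tail G e) * (V w * gl q)" using assms
        by (simp add: mon_def Nil H_V)
      also have "\<dots> = (if w = tail G e then mon [] (head G e) (q @ [e]) else 0)"
        using assms wv by (auto simp: V_ne tail_in_verts mon_def mult.assoc V_idem')
          (simp add: H_V V_H flip: mult.assoc)
      finally show ?thesis
        using w q assms by (auto intro!: span_monI[of _ W "head G e" "[]" u' "q @ [e]"]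
            simp: awalk_simps hereditary_def awlast_of_awalk)
    next
      case (Cons f p')
      then have f: "f \<in> arcs G" "awalk (head G f) p' w" using p by (auto simp: awalk_Cons_iff)
      have "H e * mon p w q = (H e * D f) * (el p' * (V w * gl q))"
        by (simp add: mon_def Cons mult.assoc)
      also have "\<dots> = (if e = f then mon p' w q else 0)"
        using assms f by (auto simp: H_D V_el' V_idem' mon_def awalk_last_in_verts)
      finally show ?thesis using w q f by (auto intro: span_monI)
    qed
  qed (simp add: sc_H assms)
qed

text \<open>The Leavitt path algebra as a subset of the ambient unital ring; neither 1 nor the
  scalars \<open>sc k\<close> have to belong to it.\<close>

definition A :: "'r set" where "A = span (verts G)"

lemma hereditary_verts: "hereditary (verts G)"
  by (auto simp: hereditary_def)

lemma span_el: assumes "hereditary W" "set p \<subseteq> arcs G" "x \<in> span W" shows "el p * x \<in> span W"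
  "x * el p \<in> span W"
proof -
  show "el p * x \<in> span W" using assms(2) by (induction p) (auto simp: mult.assoc span_D assms)
  show "x * el p \<in> span W" using assms(2,3)
    by (induction p arbitrary: x) (auto simp: span_D assms(1) simp flip: mult.assoc)
qed

lemma span_gl: assumes "hereditary W" "set p \<subseteq> arcs G" "x \<in> span W" shows "gl p * x \<in> span W"
  "x * gl p \<in> span W"
proof -
  show "x * gl p \<in> span W" using assms(2)
    by (induction p) (auto simp: span_H assms simp flip: mult.assoc)
  show "gl p * x \<in> span W" using assms(2,3)
    by (induction p arbitrary: x) (auto simp: span_H assms(1) mult.assoc)
qed

lemma span_right_sc: "x \<in> span W \<Longrightarrow> x * sc k \<in> span W"
proof (rule span_right_gen)
  fix p w q u u' assume "w \<in> W" and pq: "awalk u p w" "awalk u' q w"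
  moreover have "mon p w q * sc k = sc k * mon p w q"
  proof -
    have a: "set p \<subseteq> arcs G" "set q \<subseteq> arcs G" "w \<in> verts G" using pq by auto
    show ?thesis unfolding mon_def by (metis a mult.assoc sc_V sc_el sc_gl)
  qed
  ultimately show "mon p w q * sc k \<in> span W" by (simp add: span_scmonI)
qed

lemma span_ideal:
  assumes W: "hereditary W" and x: "x \<in> span W" and a: "a \<in> A"
  shows "a * x \<in> span W" "x * a \<in> span W"
proof -
  have "a * x \<in> span W \<and> x * a \<in> span W"
    using a unfolding A_def span_def[of "verts G"]
  proof (induction)
    case (add s a)
    then obtain k p w q u u' where s: "s = sc k * mon p w q" "w \<in> verts G" "awalk u p w"
      "awalk u' q w" by blast
    then have set: "set p \<subseteq> arcs G" "set q \<subseteq> arcs G" by auto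
    have "s * x \<in> span W" unfolding s mon_def mult.assoc
      by (intro span_sc span_el span_gl span_V W set s x)
    moreover have "x * s \<in> span W" unfolding s mon_def mult.assoc[symmetric]
      by (intro span_right_sc span_el span_gl span_V W set s x)
    ultimately show ?case using add.IH by (auto simp: distrib_left distrib_right span_add)
  qed simp
  then show "a * x \<in> span W" "x * a \<in> span W" by auto
qed

lemma A_mult: "x \<in> A \<Longrightarrow> y \<in> A \<Longrightarrow> x * y \<in> A"
  unfolding A_def using span_ideal[OF hereditary_verts] by (simp add: A_def)

lemma A_addsub: "addsub A"
  unfolding A_def by (rule span_addsub)

lemma A_elV: "awalk u p w \<Longrightarrow> el p * V w \<in> A"
  using span_monI[of w "verts G" u p w "[]"]
    by (auto simp: A_def mon_def awalk_simps awalk_last_in_verts)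

lemma A_Vgl: "awalk u p w \<Longrightarrow> V w * gl p \<in> A"
  using span_monI[of w "verts G" w "[]" u p]
    by (auto simp: A_def mon_def awalk_simps awalk_last_in_verts)

lemma A_V: "v \<in> verts G \<Longrightarrow> V v \<in> A"
  using A_elV[of v "[]" v] by (simp add: awalk_simps)

lemma A_D: "e \<in> arcs G \<Longrightarrow> D e \<in> A"
  using A_elV[of "tail G e" "[e]" "head G e"] by (simp add: awalk_simps D_V)

lemma A_sc: "x \<in> A \<Longrightarrow> sc k * x \<in> A"
  unfolding A_def by (rule span_sc)

lemma A_sub: "span W \<subseteq> A" if "W \<subseteq> verts G"
  unfolding A_def using span_mono that by blast

lemma V_nonzero: "v \<in> verts G \<Longrightarrow> V v \<noteq> 0"
  using independent[of "{[]}" v "\<lambda>_. 1" "[]"] by (auto simp: awalk_simps)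

text \<open>Admitting all larger finite sets \<open>F'\<close> lets the induction pass: a further
  summand merely enlarges \<open>F\<close>.\<close>

lemma A_local_unit: "x \<in> A \<Longrightarrow> \<exists>F. finite F \<and> F \<subseteq> verts G \<and> (\<forall>F'. finite F' \<and> F \<subseteq> F' \<and> F' \<subseteq> verts G \<longrightarrow>
  x * sum V F' = x)"
  unfolding A_def span_def
proof (induction rule: aspan.induct)
  case (add s x)
  from add.IH obtain F where F: "finite F" "F \<subseteq> verts G"
    "\<forall>F'. finite F' \<and> F \<subseteq> F' \<and> F' \<subseteq> verts G \<longrightarrow> x * sum V F' = x"
    by (elim exE conjE)
  from add.hyps(1) obtain k p w q u u' where s: "s = sc k * mon p w q" "w \<in> verts G" "awalk u p w"
    "awalk u' q w" by blast
  have "s * sum V F' = s" if "finite F'" "insert u' F \<subseteq> F'" "F' \<subseteq> verts G" for F'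
  proof -
    have "mon p w q * sum V F' = (\<Sum>v\<in>F'. if v = u' then mon p w q else 0)"
      unfolding sum_distrib_left using that s by (intro sum.cong) (auto simp: mon_V)
    then show ?thesis using that by (simp add: s mult.assoc)
  qed
  then show ?case using F s
    by (intro exI[of _ "insert u' F"]) (auto simp: distrib_right awalk_hd_in_verts)
qed auto

lemma A_nonzero_V:
  assumes "x \<in> A" "x \<noteq> 0"
  obtains v where "v \<in> verts G" "x * V v \<noteq> 0"
proof -
  obtain F where F: "finite F" "F \<subseteq> verts G" "x * sum V F = x" using A_local_unit[OF assms(1)]
    by blast
  then have "(\<Sum>v\<in>F. x * V v) \<noteq> 0" using assms by (simp add: sum_distrib_left)
  then obtain v where "v \<in> F" "x * V v \<noteq> 0" by (meson sum.neutral)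
  then show ?thesis using that F by blast
qed

section \<open>The reduction theorem\<close>

definition real_span :: "'v \<Rightarrow> 'r set" where
  "real_span v = aspan {sc k * (el p * V v) | k p. \<exists>u. awalk u p v}"

text \<open>A filtration of the elements with right unit \<open>V v\<close> by the length of their
  ghost paths. In degree 0 only combinations of real paths remain, the elements of
  \<open>real_span v\<close>.\<close>

definition ghost_span :: "nat \<Rightarrow> 'v \<Rightarrow> 'r set" where
  "ghost_span n v = aspan {sc k * mon p w q | k p w q. length q \<le> n \<and> awalk v q w \<and>
    (\<exists>u. awalk u p w)}"

lemma real_spanI: "awalk u p v \<Longrightarrow> sc k * (el p * V v) \<in> real_span v"
  unfolding real_span_def by (rule aspan_base) blast

lemma ghost_spanI: "length q \<le> n \<Longrightarrow> awalk v q w \<Longrightarrow> awalk u p w \<Longrightarrow> sc k * mon p w q \<in> ghost_span n v"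
  unfolding ghost_span_def by (rule aspan_base) blast

lemma ghost_span_mono:
  assumes "x \<in> ghost_span n v" "n \<le> m"
  shows "x \<in> ghost_span m v"
  using assms(1) unfolding ghost_span_def[of n]
proof (induction rule: aspan.induct)
  case zero
  then show ?case by (simp add: ghost_span_def aspan.zero)
next
  case (add s x)
  from add.hyps(1) obtain k p w q u where "s = sc k * mon p w q" "length q \<le> n" "awalk v q w"
    "awalk u p w"
    by blast
  then have "s \<in> ghost_span m v" using ghost_spanI[of q m] assms(2) by simp
  then show ?case using add.IH by (simp add: ghost_span_def aspan_add)
qed

lemma real_span_canonical:
  assumes "x \<in> real_span v"
  obtains S k where "finite S" "\<forall>p\<in>S. \<exists>u. awalk u p v" "\<forall>p\<in>S. k p \<noteq> 0"
    "x = (\<Sum>p\<in>S. sc (k p) * (el p * V v))"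
proof -
  have "\<exists>S k. finite S \<and> (\<forall>p\<in>S. \<exists>u. awalk u p v) \<and> x = (\<Sum>p\<in>S. sc (k p) * (el p * V v))"
    using assms unfolding real_span_def
  proof (induction rule: aspan.induct)
    case zero
    show ?case by (rule exI[of _ "{}"]) simp
  next
    case (add s x)
    from add.hyps(1) obtain a p u where s: "s = sc a * (el p * V v)" "awalk u p v" by blast
    from add.IH obtain S k where S: "finite S" "\<forall>p\<in>S. \<exists>u. awalk u p v"
      "x = (\<Sum>p\<in>S. sc (k p) * (el p * V v))" by (elim exE conjE)
    define k' where "k' = (\<lambda>q. if q = p then a + (if p \<in> S then k p else 0) else k q)"
    have rest: "(\<Sum>q\<in>S - {p}. sc (k' q) * (el q * V v)) = (\<Sum>q\<in>S - {p}. sc (k q) * (el q * V v))"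
      by (rule sum.cong) (auto simp: k'_def)
    have "s + x = (\<Sum>q\<in>insert p S. sc (k' q) * (el q * V v))"
      using S(1) by (simp add: sum.insert_remove rest)
        (auto simp: k'_def sc_add distrib_right s S(3) sum.remove add.assoc)
    then show ?case using S s(2) by (intro exI[of _ "insert p S"] exI[of _ k']) auto
  qed
  then obtain S k where S: "finite S" "\<forall>p\<in>S. \<exists>u. awalk u p v" "x = (\<Sum>p\<in>S. sc (k p) * (el p * V v))"
    by (elim exE conjE)
  have "x = (\<Sum>p\<in>{p \<in> S. k p \<noteq> 0}. sc (k p) * (el p * V v))"
    unfolding S(3) using S(1) by (intro sum.mono_neutral_right) auto
  then show ?thesis using S by (intro that[of "{p \<in> S. k p \<noteq> 0}" k]) auto
qed

lemma real_span_sub: "real_span v \<subseteq> ghost_span n v"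
proof
  fix x assume "x \<in> real_span v"
  then show "x \<in> ghost_span n v"
    unfolding real_span_def ghost_span_def
  proof (rule aspan_mono)
    show "{sc k * (el p * V v) | k p. \<exists>u. awalk u p v} \<subseteq>
       {sc k * mon p w q | k p w q. length q \<le> n \<and> awalk v q w \<and> (\<exists>u. awalk u p w)}"
    proof clarify
      fix k p u assume p: "awalk u p v"
      then have "awalk v [] v" by (simp add: awalk_Nil_iff awalk_last_in_verts)
      moreover have "sc k * (el p * V v) = sc k * mon p v []" by (simp add: mon_def)
      ultimately show "\<exists>k' p' w q. sc k * (el p * V v) = sc k' * mon p' w q \<and> length q \<le> n \<and>
        awalk v q w \<and>
          (\<exists>u. awalk u p' w)" using p le0 list.size(3) by metis
    qed
  qed
qed

lemma ghost_span_0: "ghost_span 0 v \<subseteq> real_span v"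
proof
  fix x assume "x \<in> ghost_span 0 v"
  then show "x \<in> real_span v"
    unfolding real_span_def ghost_span_def
    by (rule aspan_mono) (auto simp: mon_def awalk_Nil_iff)
qed

lemma ghost_span_A: "ghost_span n v \<subseteq> A"
proof
  fix x assume "x \<in> ghost_span n v"
  then show "x \<in> A"
    unfolding A_def span_def ghost_span_def
    by (rule aspan_mono) (blast intro: awalk_last_in_verts)
qed

lemma ghost_span_V: "x \<in> ghost_span n v \<Longrightarrow> x * V v = x"
  unfolding ghost_span_def
proof (induction rule: aspan.induct)
  case (add s x)
  from add.hyps(1) obtain k p w q u where s: "s = sc k * mon p w q" "awalk v q w" by blast
  then have "s * V v = s" by (simp add: mult.assoc mon_V[OF awalk_hd_in_verts])
  then show ?case using add.IH by (simp add: distrib_right)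
qed simp

lemma A_V_ghost_span:
  assumes "x \<in> A" "v \<in> verts G"
  shows "\<exists>n. x * V v \<in> ghost_span n v"
  using assms(1) unfolding A_def span_def
proof (induction rule: aspan.induct)
  case zero
  then show ?case by (auto simp: ghost_span_def aspan.zero)
next
  case (add s x)
  from add.hyps(1) obtain k p w q u u' where s: "s = sc k * mon p w q" "awalk u p w" "awalk u' q w"
    by blast
  from add.IH obtain n where n: "x * V v \<in> ghost_span n v" by blast
  have "s * V v \<in> ghost_span (max n (length q)) v"
  proof (cases "v = u'")
    case True
    then have "s * V v = sc k * mon p w q" using s assms(2) by (simp add: mult.assoc mon_V)
    then show ?thesis using s(2,3) True ghost_spanI[of q "max n (length q)" v w u p k] by simp
  next
    case False
    then have "s * V v = 0" using s assms(2) by (simp add: mult.assoc mon_V)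
    then show ?thesis by (simp add: ghost_span_def aspan.zero)
  qed
  moreover have "x * V v \<in> ghost_span (max n (length q)) v"
    using n by (rule ghost_span_mono) simp
  ultimately show ?case
    by (intro exI[of _ "max n (length q)"]) (simp add: distrib_right ghost_span_def aspan_add)
qed

text \<open>The ghost of \<open>e # q\<close> ends in \<open>H e\<close>, so the terms are grouped
  by the first edge of their ghost path, and the coefficient \<open>c e\<close> has shorter ghosts.
  Terms with empty ghost path form \<open>b'\<close>. Extending \<open>c\<close> by 0 outside
  \<open>T\<close> lets all edges at \<open>v\<close> be treated alike.\<close>

lemma ghost_span_split:
  assumes "b \<in> ghost_span (Suc m) v"
  shows "\<exists>T c b'. finite T \<and> T \<subseteq> out_arcs G v \<and> (\<forall>e. e \<notin> T \<longrightarrow> c e = 0) \<and>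
     (\<forall>e. c e \<in> ghost_span m (head G e)) \<and> b' \<in> real_span v \<and> b = b' + (\<Sum>e\<in>T. c e * H e)"
  using assms unfolding ghost_span_def[of "Suc m"]
proof (induction rule: aspan.induct)
  case zero
  show ?case by (rule exI[of _ "{}"], rule exI[of _ "\<lambda>_. 0"], rule exI[of _ 0])
      (simp add: ghost_span_def real_span_def aspan.zero)
next
  case (add s x)
  from add.hyps(1) obtain k p w q u where s: "s = sc k * mon p w q" "length q \<le> Suc m" "awalk v q w"
    "awalk u p w"
    by blast
  from add.IH obtain T c b' where T: "finite T" "T \<subseteq> out_arcs G v" "\<forall>e. e \<notin> T \<longrightarrow> c e = 0"
    "\<forall>e. c e \<in> ghost_span m (head G e)" "b' \<in> real_span v" "x = b' + (\<Sum>e\<in>T. c e * H e)"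
    by (elim exE conjE)
  show ?case
  proof (cases q)
    case Nil
    then have "s \<in> real_span v"
      using s real_spanI[of u p v k] by (auto simp: awalk_Nil_iff mon_def)
    then have "s + b' \<in> real_span v" using T by (simp add: real_span_def aspan_add)
    then show ?thesis using T by (intro exI[of _ T] exI[of _ c] exI[of _
      "s + b'"]) (simp add: add.assoc)
  next
    case (Cons e q')
    then have e: "e \<in> arcs G" "tail G e = v" "awalk (head G e) q' w" using s
      by (auto simp: awalk_Cons_iff)
    define d where "d = sc k * mon p w q'"
    have d: "d \<in> ghost_span m (head G e)"
      unfolding d_def using s e Cons by (intro ghost_spanI) auto
    have sd: "s = d * H e" by (simp add: s d_def mon_def Cons mult.assoc)
    define c' where "c' = c(e := c e + d)"
    have "(\<Sum>f\<in>insert e T. c' f * H f) = c' e * H e + (\<Sum>f\<in>T - {e}. c f * H f)"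
      using T(1) by (simp add: sum.insert_remove c'_def)
    also have "\<dots> = d * H e + (c e * H e + (\<Sum>f\<in>T - {e}. c f * H f))"
      by (simp add: c'_def distrib_right add.assoc add.commute add.left_commute)
    also have "c e * H e + (\<Sum>f\<in>T - {e}. c f * H f) = (\<Sum>f\<in>T. c f * H f)"
      using T(1,3) by (cases "e \<in> T") (auto simp: sum.remove)
    finally have "s + x = b' + (\<Sum>f\<in>insert e T. c' f * H f)"
      by (simp add: T(6) sd add.left_commute)
    moreover have "c' f \<in> ghost_span m (head G f)" for f
      using T(4) d by (auto simp: c'_def ghost_span_def intro: aspan_add)
    ultimately show ?thesis using T(1-3,5) e
      by (intro exI[of _ "insert e T"] exI[of _ c'] exI[of _ b']) (auto simp: c'_def)
  qed
qed

text \<open>Appending \<open>e\<close> is injective on paths, so distinct paths stay independent and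
  right multiplication by an edge loses nothing on real elements. \<open>butlast\<close> finds the
  coefficient of a lengthened path.\<close>

lemma real_span_D:
  assumes "x \<in> real_span v" "e \<in> out_arcs G v"
  shows "x * D e \<in> real_span (head G e)" "x * D e = 0 \<Longrightarrow> x = 0"
proof -
  from assms(2) have e: "e \<in> arcs G" "tail G e = v" by auto
  have step: "el p * V v * D e = el (p @ [e]) * V (head G e)" for p
    using e V_D[of e] D_V[of e] by (simp add: mult.assoc)
  have walk: "awalk u (p @ [e]) (head G e)" if "awalk u p v" for u p
    using awalk_appendI[OF that, of "[e]" "head G e"] e arc_implies_awalk[of e] by simp
  show "x * D e \<in> real_span (head G e)"
    using assms(1) unfolding real_span_def
  proof (rule aspan_map)
    fix s assume "s \<in> {sc k * (el p * V v) | k p. \<exists>u. awalk u p v}"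
    then obtain k p u where s: "s = sc k * (el p * V v)" "awalk u p v" by blast
    have "s * D e = sc k * (el (p @ [e]) * V (head G e))" unfolding s(1) step[symmetric]
      by (simp only: mult.assoc)
    then show "s * D e \<in> aspan {sc k * (el p * V (head G e)) | k p. \<exists>u. awalk u p (head G e)}"
      using walk[OF s(2)] by (intro aspan_base) blast
  qed (rule distrib_right)
  assume z: "x * D e = 0"
  obtain S k where S: "finite S" "\<forall>p\<in>S. \<exists>u. awalk u p v" "\<forall>p\<in>S. k p \<noteq> 0"
    "x = (\<Sum>p\<in>S. sc (k p) * (el p * V v))" using real_span_canonical[OF assms(1)] .
  have "S = {}"
  proof (rule ccontr)
    assume "S \<noteq> {}"
    then obtain p where p: "p \<in> S" by blast
    have "0 = (\<Sum>p\<in>S. sc (k p) * (el (p @ [e]) * V (head G e)))"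
      unfolding z[symmetric] S(4) sum_distrib_right
      by (rule sum.cong) (simp_all only: step[symmetric] mult.assoc)
    also have "\<dots> = (\<Sum>q\<in>(\<lambda>p. p @ [e]) ` S. sc (k (butlast q)) * (el q * V (head G e)))"
      by (subst sum.reindex) (auto simp: inj_on_def)
    finally have "(\<Sum>q\<in>(\<lambda>p. p @ [e]) ` S. sc (k (butlast q)) * (el q * V (head G e))) = 0" ..
    moreover have "\<exists>u. awalk u q (head G e)" if "q \<in> (\<lambda>p. p @ [e]) ` S" for q
      using that S(2) walk by blast
    ultimately have "k (butlast (p @ [e])) = 0"
      using S(1) p unfolding el_def by (intro independent[of "(\<lambda>p. p @ [e]) ` S" "head G e"]) auto
    then show False using S(3) p by simp
  qed
  then show "x = 0" using S by simp
qed

text \<open>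
  Among the nonzero right multiples of \<open>x\<close> one involving the shortest ghost paths is real:
  otherwise multiplying it by an edge kills it, so that it is \<open>b' * (V v - (\<Sum>e. D e * H e))\<close> for
  a real \<open>b'\<close>, and then either it vanishes by the relation at the regular vertex \<open>v\<close> or some
  further edge detects \<open>b'\<close>.
\<close>

lemma A_nonzero_real:
  assumes "x \<in> A" "x \<noteq> 0"
  obtains y v where "v \<in> verts G" "y \<in> A" "x * y \<in> real_span v" "x * y \<noteq> 0"
proof -
  define P where "P n \<longleftrightarrow> (\<exists>y\<in>A. \<exists>v\<in>verts G. x * y \<noteq> 0 \<and> x * y \<in> ghost_span n v)" for n
  obtain v where v: "v \<in> verts G" "x * V v \<noteq> 0" using A_nonzero_V[OF assms] .
  obtain n0 where "x * V v \<in> ghost_span n0 v" using A_V_ghost_span[OF assms(1) v(1)] by blast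
  then have "P n0" unfolding P_def using v A_V by blast
  define n where "n = (LEAST n. P n)"
  have Pn: "P n" unfolding n_def using \<open>P n0\<close> by (rule LeastI)
  have least: "n \<le> m" if "P m" for m unfolding n_def using that by (rule Least_le)
  from Pn obtain y v where y: "y \<in> A" "v \<in> verts G" "x * y \<noteq> 0" "x * y \<in> ghost_span n v"
    unfolding P_def by blast
  show ?thesis
  proof (cases n)
    case 0
    then show ?thesis using that y ghost_span_0 by blast
  next
    case (Suc m)
    obtain T c b' where T: "finite T" "T \<subseteq> out_arcs G v" "\<forall>e. e \<notin> T \<longrightarrow> c e = 0"
      "\<forall>e. c e \<in> ghost_span m (head G e)" "b' \<in> real_span v" "x * y = b' + (\<Sum>e\<in>T. c e * H e)"
      using ghost_span_split[OF y(4)[unfolded Suc]] by (elim exE conjE)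
    have bV: "b' * V v = b'" using T(5) real_span_sub[of v 0] ghost_span_V by blast
    \<comment> \<open>Multiplication by \<open>D e\<close> picks out \<open>c e\<close>, whose ghost
      length is at most \<open>m\<close>, and \<open>b' * D e\<close> is real. Since
      \<open>n = Suc m\<close> was minimal, the product must be 0.\<close>
    have D0: "b' * D e + c e = 0" if e: "e \<in> out_arcs G v" for e
    proof -
      have ea: "e \<in> arcs G" "head G e \<in> verts G" using e by auto
      have "(\<Sum>f\<in>T. c f * H f) * D e = (\<Sum>f\<in>T. if f = e then c e else 0)"
        unfolding sum_distrib_right
      proof (rule sum.cong)
        fix f assume "f \<in> T"
        then have "f \<in> arcs G" using T(2) by auto
        then have "c f * H f * D e = c f * (if f = e then V (head G f) else 0)" using ea
          by (simp add: mult.assoc H_D)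
        then show "c f * H f * D e = (if f = e then c e else 0)" using ghost_span_V T(4) by auto
      qed simp
      also have "\<dots> = c e" using T(1,3) by auto
      finally have eq: "x * (y * D e) = b' * D e + c e"
        by (simp add: T(6) distrib_right flip: mult.assoc)
      have "b' * D e \<in> ghost_span m (head G e)" using real_span_D(1)[OF T(5) e] real_span_sub
        by blast
      then have "x * (y * D e) \<in> ghost_span m (head G e)" unfolding eq using T(4)
        by (simp add: ghost_span_def aspan_add)
      moreover have "y * D e \<in> A" using y(1) ea A_mult A_D by blast
      ultimately have "x * (y * D e) = 0" using least[of m] ea unfolding P_def Suc by fastforce
      then show ?thesis by (simp add: eq)
    qed
    have b: "x * y = b' * (V v - (\<Sum>e\<in>T. D e * H e))"
    proof -
      have "c e = - (b' * D e)" if "e \<in> T" for e using D0[of e] T(2) that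
        by (auto simp: eq_neg_iff_add_eq_0 add.commute)
      then have "(\<Sum>e\<in>T. c e * H e) = (\<Sum>e\<in>T. - (b' * (D e * H e)))"
        by (intro sum.cong) (auto simp: mult.assoc)
      then show ?thesis by (simp add: T(6) right_diff_distrib bV sum_negf sum_distrib_left)
    qed
    have b'0: "b' \<noteq> 0" using b y(3) by auto
    have "T = out_arcs G v"
    proof (rule ccontr)
      assume "T \<noteq> out_arcs G v"
      then obtain f where f: "f \<in> out_arcs G v" "f \<notin> T" using T(2) by blast
      then have "b' * D f = 0" using D0[of f] T(3) by auto
      then show False using real_span_D(2)[OF T(5) f(1)] b'0 by simp
    qed
    \<comment> \<open>This excludes sinks, to which \<open>V_sum\<close> does not apply: without
      ghost terms \<open>x * y\<close> would be real, against \<open>n > 0\<close>.\<close>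
    moreover have "T \<noteq> {}"
    proof
      assume "T = {}"
      then have "x * y = b'" using T(6) by simp
      then have "P 0" unfolding P_def using y T(5) real_span_sub by (metis subsetD)
      then show False using least[of 0] Suc by simp
    qed
    ultimately have "regular_vertex G v" using T(1) y(2) by (auto simp: regular_vertex_def)
    then have "x * y = 0" unfolding b using V_sum \<open>T = out_arcs G v\<close> by simp
    then show ?thesis using y by simp
  qed
qed

section \<open>Cycles without exits\<close>

abbreviation Pc :: "'v set" where "Pc \<equiv> verts_on_cycles_without_exits G"

text \<open>A cycle with a chosen base point. Absence of exits is put as a condition on
  \<open>out_arcs\<close>, the form in which the relation at a regular vertex uses it.\<close>

definition exitless_cycle :: "'v \<Rightarrow> 'e list \<Rightarrow> bool" where
  "exitless_cycle v c \<longleftrightarrow> awalk v c v \<and> c \<noteq> [] \<and> distinct (map (tail G) c) \<and>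
     (\<forall>e\<in>set c. out_arcs G (tail G e) = {e})"

text \<open>\<open>cycle\<close> of the library wants distinct heads, \<open>exitless_cycle\<close>
  distinct tails. Along a closed walk both lists run through the same vertices, shifted by one
  place.\<close>

lemma closed_walk_tails:
  assumes "awalk u p u" "p \<noteq> []"
  shows "tl (awalk_verts u p) = map (head G) p" "mset (map (tail G) p) = mset (map (head G) p)"
proof -
  have c: "cas u p u" "awlast u p = u" using assms(1) by auto
  show a: "tl (awalk_verts u p) = map (head G) p" using awalk_verts_conv'[OF c(1)] assms(2) by simp
  have "head G (last p) = u" using c(2) assms(2) by (simp add: awalk_verts_conv)
  then have "awalk_verts u p = map (tail G) p @ [u]" using assms(2) by (simp add: awalk_verts_conv)
  moreover have "awalk_verts u p = u # map (head G) p"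
    using awalk_verts_conv'[OF c(1)] assms by (cases p) (auto simp: awalk_Cons_iff)
  ultimately have "mset (map (tail G) p @ [u]) = mset (u # map (head G) p)" by (simp only:)
  then show "mset (map (tail G) p) = mset (map (head G) p)" by simp
qed

lemma distinct_tails_iff:
  assumes "awalk u p u" "p \<noteq> []"
  shows "distinct (map (tail G) p) \<longleftrightarrow> distinct (tl (awalk_verts u p))"
  unfolding closed_walk_tails(1)[OF assms]
    by (rule mset_eq_imp_distinct_iff) (rule closed_walk_tails(2)[OF assms])

lemma exitless_cycle_Pc: "exitless_cycle v c \<Longrightarrow> v \<in> Pc"
proof -
  assume c: "exitless_cycle v c"
  then have "cycle c" using distinct_tails_iff[of v c] by (auto simp: exitless_cycle_def cycle_def)
  moreover have "\<not> has_exit G c" using c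
    by (fastforce simp: has_exit_def exitless_cycle_def out_arcs_def)
  moreover have "v \<in> tail G ` set c" using c
    by (cases c) (auto simp: exitless_cycle_def awalk_Cons_iff)
  ultimately show "v \<in> Pc" unfolding verts_on_cycles_without_exits_def by blast
qed

text \<open>Rotating the cycle at the edge that leaves \<open>v\<close> makes \<open>v\<close> its
  base point.\<close>

lemma Pc_exitless_cycle:
  assumes "v \<in> Pc"
  obtains c where "exitless_cycle v c"
proof -
  obtain p u f where p: "awalk u p u" "distinct (tl (awalk_verts u p))" "p \<noteq> []" "\<not> has_exit G p"
    and f: "f \<in> set p" "v = tail G f"
    using assms unfolding verts_on_cycles_without_exits_def cycle_def by blast
  obtain p1 p2 where p12: "p = p1 @ f # p2" using f(1) by (meson split_list)
  from p(1)[unfolded p12] have "awalk u p1 v" "awalk v (f # p2) u"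
    by (auto simp: f(2) awalk_Cons_iff)
  then have w: "awalk v ((f # p2) @ p1) v" by (meson awalk_appendI)
  have "distinct (map (tail G) p)" using p distinct_tails_iff by blast
  then have "distinct (map (tail G) ((f # p2) @ p1))" unfolding p12 by auto
  moreover have "out_arcs G (tail G e) = {e}" if "e \<in> set ((f # p2) @ p1)" for e
  proof -
    have e: "e \<in> set p" using that p12 by auto
    then have "e \<in> arcs G" using p(1) by auto
    then show ?thesis using p(4) e by (auto simp: has_exit_def)
  qed
  ultimately show ?thesis using w
    by (intro that[of "(f # p2) @ p1"]) (auto simp: exitless_cycle_def)
qed

lemma Pc_verts: "Pc \<subseteq> verts G"
  using Pc_exitless_cycle by (metis awalk_hd_in_verts exitless_cycle_def subsetI)

text \<open>The first edge is kept and the rest shortened to a path without repeated vertices;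
  together they close up to a cycle still based at \<open>v\<close>.\<close>

lemma cycle_through:
  assumes "awalk v t v" "t \<noteq> []"
  obtains c where "awalk v c v" "c \<noteq> []" "distinct (map (tail G) c)"
proof -
  obtain e t' where t: "t = e # t'" using assms(2) by (cases t) auto
  then have e: "e \<in> arcs G" "v = tail G e" "awalk (head G e) t' v" using assms(1)
    by (auto simp: awalk_Cons_iff)
  have ap: "apath (head G e) (awalk_to_apath t') v" using e(3) by (rule apath_awalk_to_apath)
  have w: "awalk v (e # awalk_to_apath t') v" using ap e by (auto simp: awalk_Cons_iff apath_def)
  have "distinct (map (tail G) (e # awalk_to_apath t'))"
    using distinct_tails_iff[OF w] ap by (simp add: apath_def)
  with w show ?thesis by (intro that) auto
qed

definition pow :: "nat \<Rightarrow> 'e list \<Rightarrow> 'e list" where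
  "pow n c = concat (replicate n c)"

lemma pow_simps [simp]: "pow 0 c = []" "pow (Suc n) c = c @ pow n c"
  "length (pow n c) = n * length c"
  by (simp_all add: pow_def length_concat sum_list_replicate)

lemma set_pow: "set (pow n c) \<subseteq> set c"
  by (induction n) auto

lemma awalk_pow: "awalk v c v \<Longrightarrow> awalk v (pow n c) v"
  by (induction n) (auto simp: awalk_Nil_iff awalk_hd_in_verts simp del: awalk_append_iff intro:
    awalk_appendI)

lemma el_pow: "el (pow n c) = el c ^ n"
  by (induction n) auto

lemma gl_pow: "gl (pow n c) = gl c ^ n"
  by (induction n) (auto simp: power_commutes)

text \<open>
  A path that winds around a cycle and then leaves it through an exit is not a prefix of any of
  its translates by a closed path.
\<close>

lemma real_reduction:
  assumes b: "b \<in> real_span v" "b \<noteq> 0" and v: "v \<notin> Pc"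
  shows "\<exists>w\<in>verts G. \<exists>y\<in>A. \<exists>z\<in>A. y * b * z = V w"
proof -
  obtain S k where S: "finite S" "\<forall>p\<in>S. \<exists>u. awalk u p v" "\<forall>p\<in>S. k p \<noteq> 0"
    "b = (\<Sum>p\<in>S. sc (k p) * (el p * V v))" using real_span_canonical[OF b(1)] .
  have "S \<noteq> {}" using S(4) b(2) by auto
  \<comment> \<open>No other member of \<open>S\<close> is a prefix of a shortest one, so
    multiplying by the ghost of \<open>p0\<close> turns every other term into 0 or into a
    non-trivial closed path at \<open>v\<close>.\<close>
  then obtain p0 where p0: "p0 \<in> S" "\<forall>p\<in>S. length p0 \<le> length p"
    using ex_min_if_finite[of "length ` S"] S(1) by (metis arg_min_if_finite(1) arg_min_least)
  obtain u0 where u0: "awalk u0 p0 v" using S p0 by blast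
  then have vv: "v \<in> verts G" by (rule awalk_last_in_verts)
  define z where "z p = V v * (gl p0 * (el p * V v))" for p
  have z: "z p = 0 \<or> (\<exists>t. t \<noteq> [] \<and> awalk v t v \<and> p = p0 @ t \<and> z p = el t * V v)" if p: "p \<in> S"
    "p \<noteq> p0" for p
  proof -
    obtain u where u: "awalk u p v" using S p by blast
    show ?thesis
    proof (cases "u = u0")
      case False
      then show ?thesis using gl_el_different[OF u0 u] by (simp add: z_def)
    next
      case True
      show ?thesis
      proof (cases "\<exists>t. p = p0 @ t")
        case True
        then obtain t where t: "p = p0 @ t" by blast
        have "awlast u p0 = v" using u0 \<open>u = u0\<close> by simp
        then have tw: "awalk v t v" using u t by simp
        have "z p = V v * (el t * V v)" unfolding z_def t by (simp add: mult.assoc gl_el'[OF u0])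
        also have "\<dots> = el t * V v" using V_el'[OF tw, of "V v"] by (simp add: V_idem vv)
        finally show ?thesis using tw t p(2) by auto
      next
        case False
        moreover have "\<nexists>s. p0 = p @ s" using p0 p by fastforce
        ultimately have "gl p0 * el p = 0" using gl_el_incomparable[OF u0 u[unfolded True]] by blast
        then show ?thesis by (simp add: z_def flip: mult.assoc)
      qed
    qed
  qed
  \<comment> \<open>It remains to remove the closed paths: conjugation by \<open>\<eta>\<close> has
    to kill each of them while it turns \<open>V v\<close> into \<open>V w\<close>.\<close>
  have "\<exists>\<eta> w. awalk v \<eta> w \<and> (\<forall>p\<in>S - {p0}. V w * (gl \<eta> * (z p * (el \<eta> * V w))) = 0)"
  proof (cases "\<exists>p\<in>S - {p0}. z p \<noteq> 0")
    case False
    then show ?thesis using vv by (intro exI[of _ "[]"] exI[of _ v]) (auto simp: awalk_Nil_iff)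
  next
    case True
    then obtain t where "awalk v t v" "t \<noteq> []" using z by blast
    then obtain c where c: "awalk v c v" "c \<noteq> []" "distinct (map (tail G) c)" using cycle_through
      by blast
    have carcs: "set c \<subseteq> arcs G" using c(1) by auto
    obtain g f where gf: "g \<in> set c" "f \<in> arcs G" "tail G f = tail G g" "f \<noteq> g"
    proof -
      have "\<not> exitless_cycle v c" using v exitless_cycle_Pc by blast
      then obtain g where "g \<in> set c" "out_arcs G (tail G g) \<noteq> {g}" using c
        by (auto simp: exitless_cycle_def)
      moreover then have "g \<in> out_arcs G (tail G g)" using carcs by auto
      ultimately obtain f where "f \<in> out_arcs G (tail G g)" "f \<noteq> g" by blast
      then show ?thesis using that \<open>g \<in> set c\<close> by auto
    qed
    have fc: "f \<notin> set c" using c(3) gf by (auto simp: distinct_map inj_on_def)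
    obtain c1 c2 where c12: "c = c1 @ g # c2" using gf(1) by (meson split_list)
    \<comment> \<open>\<open>N\<close> windings are at least as long as every \<open>t\<close> that
      can occur, so in the comparison below the shift by \<open>t\<close> stays inside
      \<open>\<theta>\<close>.\<close>
    define N where "N = Max (length ` S)"
    define \<theta> where "\<theta> = pow N c @ c1"
    have "awalk v c1 (tail G g)" using c(1)[unfolded c12] by (auto simp: awalk_Cons_iff)
    then have \<theta>w: "awalk v (\<theta> @ [f]) (head G f)"
      unfolding \<theta>_def using awalk_pow[OF c(1)] gf arc_implies_awalk[of f]
        by (metis append.assoc awalk_appendI)
    have \<theta>c: "set \<theta> \<subseteq> set c" using set_pow[of N c] c12 by (auto simp: \<theta>_def)
    have "V (head G f) * (gl (\<theta> @ [f]) * (z p * (el (\<theta> @ [f]) * V (head G f)))) = 0" if p: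
      "p \<in> S - {p0}" for p
    proof -
      have "z p = 0 \<or> (\<exists>t. t \<noteq> [] \<and> awalk v t v \<and> p = p0 @ t \<and> z p = el t * V v)" using z[of p] p
        by blast
      then show ?thesis
      proof (elim disjE exE conjE)
        fix t assume t: "t \<noteq> []" "awalk v t v" "p = p0 @ t" "z p = el t * V v"
        have "length t \<le> length p" using t by simp
        also have "\<dots> \<le> N" using p S(1) by (auto simp: N_def)
        also have "N \<le> length \<theta>" using c(2) by (cases c) (auto simp: \<theta>_def)
        finally have lt: "length t \<le> length \<theta>" .
        \<comment> \<open>Comparing the letters at position \<open>length \<theta>\<close>: one side
          has \<open>f\<close> there, the other a letter of \<open>\<theta>\<close>, hence of
          \<open>c\<close>, because \<open>t\<close> is not empty.\<close>
        have "\<nexists>s. t @ \<theta> @ [f] = (\<theta> @ [f]) @ s"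
        proof
          assume "\<exists>s. t @ \<theta> @ [f] = (\<theta> @ [f]) @ s"
          then obtain s where s: "t @ \<theta> @ [f] = (\<theta> @ [f]) @ s" by blast
          have "f = ((\<theta> @ [f]) @ s) ! length \<theta>" by (simp add: nth_append)
          also have "\<dots> = (\<theta> @ [f]) ! (length \<theta> - length t)" unfolding s[symmetric] using lt
            by (simp add: nth_append)
          also have "\<dots> = \<theta> ! (length \<theta> - length t)" using t(1) lt
            by (cases t) (auto simp: nth_append)
          also have "\<dots> \<in> set \<theta>" using t(1) lt by (cases t) auto
          finally show False using \<theta>c fc by blast
        qed
        moreover have "\<nexists>s. \<theta> @ [f] = (t @ \<theta> @ [f]) @ s" using t(1)
          by (auto dest: arg_cong[of _ _ length])
        ultimately have "gl (\<theta> @ [f]) * el (t @ \<theta> @ [f]) = 0"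
          using \<theta>w by (intro gl_el_incomparable[OF \<theta>w awalk_appendI[OF t(2) \<theta>w]])
        then have "gl (\<theta> @ [f]) * (el t * (V v * (el (\<theta> @ [f]) * V (head G f)))) = 0"
          using V_el'[OF \<theta>w, of "V (head G f)"] gf(2)
            by (simp add: V_idem head_in_verts flip: mult.assoc)
        then show ?thesis unfolding t(4) by (simp only: mult.assoc mult_zero_right)
      qed simp
    qed
    then show ?thesis using \<theta>w by blast
  qed
  then obtain \<eta> w where \<eta>: "awalk v \<eta> w" "\<And>p. p \<in> S - {p0} \<Longrightarrow> V w * (gl \<eta> * (z p * (el \<eta> * V w))) =
    0" by blast
  have arcs: "set \<eta> \<subseteq> arcs G" "set p0 \<subseteq> arcs G" and w: "w \<in> verts G" using \<eta>(1) u0 by auto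
  \<comment> \<open>Read from right to left, \<open>Y\<close> strips \<open>p0\<close> and then
    applies the ghost of \<open>\<eta>\<close>. Of all terms just that of \<open>p0\<close>
    survives, and its coefficient is divided out at the end.\<close>
  define Y where "Y = (V w * gl \<eta>) * (V v * gl p0)"
  have YA: "Y \<in> A" unfolding Y_def using A_Vgl[OF \<eta>(1)] A_Vgl[OF u0] by (rule A_mult)
  have tm: "Y * (sc (k p) * (el p * V v)) * (el \<eta> * V w) = sc (k p) * (V w * (gl \<eta> * (z p * (el \<eta> *
    V w))))" for p
    unfolding Y_def z_def
    by (simp add: mult.assoc, simp add: sc_gl[OF arcs(1)] sc_gl[OF arcs(2)] sc_V[OF w] sc_V[OF vv]
      flip: mult.assoc)

  have z0: "V w * (gl \<eta> * (z p0 * (el \<eta> * V w))) = V w"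
    using gl_el_V(1)[OF u0] gl_el_V(2)[OF \<eta>(1), of 1] V_el'[OF \<eta>(1), of "V w"]
    by (simp add: z_def V_idem vv w)
  have "Y * b * (el \<eta> * V w) = (\<Sum>p\<in>S. sc (k p) * (V w * (gl \<eta> * (z p * (el \<eta> * V w)))))"
    unfolding S(4) sum_distrib_left sum_distrib_right tm ..
  also have "\<dots> = sc (k p0) * V w"
    using S(1) p0(1) \<eta>(2) z0 by (simp add: sum.remove)
  finally have "sc (1 / k p0) * Y * b * (el \<eta> * V w) = sc (1 / k p0) * (sc (k p0) * V w)"
    by (simp add: mult.assoc)
  also have "\<dots> = V w" using S(3) p0(1) w by (simp add: sc_one flip: mult.assoc sc_mult)
  finally show ?thesis using w A_sc[OF YA] A_elV[OF \<eta>(1)] by (intro bexI[of _ w] bexI[of _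
    "sc (1 / k p0) * Y"] bexI[of _ "el \<eta> * V w"])
qed

text \<open>At a vertex outside \<open>Pc\<close> a real multiple of \<open>a\<close> can be cut
  down to a vertex. At a vertex of an exitless cycle it may be a non-invertible polynomial in the
  cycle; there only its being non-zero is recorded.\<close>

lemma reduction:
  assumes "a \<in> A" "a \<noteq> 0"
  shows "(\<exists>w\<in>verts G. \<exists>y\<in>A. \<exists>z\<in>A. y * a * z = V w) \<or> (\<exists>v\<in>Pc. \<exists>y\<in>A. a * y * V v \<noteq> 0)"
proof -
  obtain y v where y: "v \<in> verts G" "y \<in> A" "a * y \<in> real_span v" "a * y \<noteq> 0"
    using A_nonzero_real[OF assms] .
  show ?thesis
  proof (cases "v \<in> Pc")
    case True
    have "a * y * V v = a * y" using y(3) real_span_sub[of v 0] ghost_span_V by blast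
    then show ?thesis using True y by fastforce
  next
    case False
    then obtain w x z where "w \<in> verts G" "x \<in> A" "z \<in> A" "x * (a * y) * z = V w"
      using real_reduction[OF y(3,4)] by blast
    then show ?thesis using A_mult[OF y(2), of z] by (metis mult.assoc)
  qed
qed

section \<open>The corner at a vertex of an exitless cycle\<close>

lemma Pc_out:
  assumes "v \<in> Pc"
  obtains e where "out_arcs G v = {e}" "head G e \<in> Pc"
proof -
  obtain c where c: "exitless_cycle v c" using Pc_exitless_cycle[OF assms] .
  then obtain e c' where e: "c = e # c'" by (cases c) (auto simp: exitless_cycle_def)
  then have v: "v = tail G e" "e \<in> arcs G" "awalk (head G e) c' v"
    using c by (auto simp: exitless_cycle_def awalk_Cons_iff)
  have w: "awalk (head G e) (c' @ [e]) (head G e)"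
    using awalk_appendI[OF v(3)] v(1,2) arc_implies_awalk[of e] by simp
  have "exitless_cycle (head G e) (c' @ [e])"
    using w c unfolding exitless_cycle_def e by auto
  then have "head G e \<in> Pc" by (rule exitless_cycle_Pc)
  moreover have "out_arcs G v = {e}" using c v(1) by (simp add: exitless_cycle_def e)
  ultimately show ?thesis using that by blast
qed

lemma hereditary_Pc: "hereditary Pc"
  unfolding hereditary_def using Pc_verts Pc_out by (metis in_out_arcs_conv singletonD)

lemma Pc_walk: "awalk u p w \<Longrightarrow> u \<in> Pc \<Longrightarrow> w \<in> Pc"
  using hereditary_Pc by (induction p arbitrary: u) (auto simp: awalk_simps hereditary_def)

lemma Pc_V:
  assumes "v \<in> Pc" "e \<in> arcs G" "tail G e = v"
  shows "D e * H e = V v"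
proof -
  obtain f where f: "out_arcs G v = {f}" using Pc_out[OF assms(1)] by blast
  then have "f = e" using assms by auto
  moreover have "regular_vertex G v" using f assms Pc_verts by (auto simp: regular_vertex_def)
  ultimately show ?thesis using V_sum[of v] f by simp
qed

text \<open>With a single outgoing edge the relation at a regular vertex reads
  \<open>D e * H e = V v\<close>. Together with the cancellation in \<open>gl_el\<close> this makes
  paths inside \<open>Pc\<close> invertible.\<close>

lemma Pc_el_gl: "awalk u p w \<Longrightarrow> u \<in> Pc \<Longrightarrow> el p * (V w * gl p) = V u"
proof (induction p arbitrary: u)
  case Nil
  then show ?case by (auto simp: awalk_Nil_iff)
next
  case (Cons e p)
  then have e: "e \<in> arcs G" "tail G e = u" "awalk (head G e) p w" by (auto simp: awalk_Cons_iff)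
  then have h: "head G e \<in> Pc" using hereditary_Pc Cons.prems by (auto simp: hereditary_def)
  have "el (e # p) * (V w * gl (e # p)) = D e * (el p * (V w * gl p)) * H e"
    by (simp add: mult.assoc)
  also have "\<dots> = D e * H e" using Cons.IH[OF e(3) h] D_V[OF e(1)] by simp
  finally show ?case using Pc_V[OF Cons.prems(2) e(1,2)] by simp
qed

lemma Pc_el_gl': "awalk u p w \<Longrightarrow> u \<in> Pc \<Longrightarrow> el p * (V w * (gl p * x)) = V u * x"
  using Pc_el_gl by (simp flip: mult.assoc)

lemma Pc_comparable:
  "awalk u p w \<Longrightarrow> awalk u q x \<Longrightarrow> u \<in> Pc \<Longrightarrow> (\<exists>s. q = p @ s) \<or> (\<exists>s. p = q @ s)"
proof (induction p arbitrary: u q)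
  case (Cons e p)
  show ?case
  proof (cases q)
    case q: (Cons f q')
    obtain g where g: "out_arcs G u = {g}" using Pc_out[OF Cons.prems(3)] by blast
    have e: "e \<in> out_arcs G u" "awalk (head G e) p w" "f \<in> out_arcs G u" "awalk (head G f) q' x"
      using Cons.prems q by (auto simp: awalk_Cons_iff)
    then have "e = f" using g by auto
    moreover have "head G e \<in> Pc" using e Cons.prems(3) hereditary_Pc by (auto simp: hereditary_def)
    ultimately show ?thesis using Cons.IH[OF e(2), of q'] e q by auto
  qed simp
qed simp

text \<open>From \<open>u\<close> on there is no choice of edges, so \<open>q\<close> is a beginning
  of a power of the cycle that has more edges than \<open>q\<close>; the remainder of that power
  leads back.\<close>

lemma Pc_return:
  assumes "awalk u q w" "u \<in> Pc"
  obtains r where "awalk w r u"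
proof -
  obtain c where c: "exitless_cycle u c" using Pc_exitless_cycle[OF assms(2)] .
  then have cw: "awalk u c u" "c \<noteq> []" by (auto simp: exitless_cycle_def)
  have pw: "awalk u (pow (Suc (length q)) c) u" by (rule awalk_pow[OF cw(1)])
  have "length q < length (pow (Suc (length q)) c)" using cw(2) by (cases c) auto
  then have "\<not> (\<exists>s. q = pow (Suc (length q)) c @ s)" by (metis le_add1 length_append not_le)
  then obtain s where "pow (Suc (length q)) c = q @ s"
    using Pc_comparable[OF assms(1) pw assms(2)] by blast
  then have "awalk (awlast u q) s u" using pw by (simp del: pow_simps)
  then show ?thesis using that assms(1) by simp
qed

text \<open>By comparability either \<open>c\<close> splits off from \<open>t\<close>, or
  \<open>t\<close> is a beginning of \<open>c\<close>. In the second case a proper beginning that is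
  closed would make \<open>v\<close> the tail of two edges of \<open>c\<close>.\<close>

lemma exitless_cycle_closed_walk:
  assumes c: "exitless_cycle v c" and "awalk v t v"
  shows "\<exists>j. t = pow j c"
  using assms(2)
proof (induction "length t" arbitrary: t rule: less_induct)
  case less
  have cw: "awalk v c v" "c \<noteq> []" "distinct (map (tail G) c)" "v \<in> Pc"
    using c exitless_cycle_Pc by (auto simp: exitless_cycle_def)
  show ?case
  proof (cases "t = []")
    case True
    then show ?thesis by (intro exI[of _ 0]) simp
  next
    case False
    from Pc_comparable[OF cw(1) less.prems cw(4)] show ?thesis
    proof (elim disjE exE)
      fix s assume s: "t = c @ s"
      then have "awalk v s v" "length s < length t" using less.prems cw by auto
      then obtain j where "s = pow j c" using less.hyps by blast
      then show ?thesis using s by (intro exI[of _ "Suc j"]) simp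
    next
      fix s assume s: "c = t @ s"
      have sw: "awalk v s v" using cw(1) less.prems s by simp
      have "s = []"
      proof (rule ccontr)
        assume "s \<noteq> []"
        then have "v \<in> tail G ` set s" using sw by (cases s) (auto simp: awalk_Cons_iff)
        moreover have "v \<in> tail G ` set t" using False less.prems
          by (cases t) (auto simp: awalk_Cons_iff)
        ultimately show False using cw(3) s by auto
      qed
      then show ?thesis using s by (intro exI[of _ 1]) simp
    qed
  qed
qed

text \<open>Some monomial runs from \<open>w\<close> to a vertex \<open>y\<close> and has a ghost
  path from \<open>v\<close> to \<open>y\<close>. The latter is reversed by
  \<open>Pc_return\<close>.\<close>

lemma connected_Pc:
  assumes "w \<in> Pc" "v \<in> Pc" "a \<in> A" "V w * (a * V v) \<noteq> 0"
  obtains r where "awalk w r v"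
proof -
  have vw: "v \<in> verts G" "w \<in> verts G" using assms Pc_verts by auto
  have "V w * (a * V v) \<noteq> 0 \<longrightarrow> (\<exists>r. awalk w r v)"
    using assms(3) unfolding A_def span_def
  proof (induction rule: aspan.induct)
    case (add s x)
    from add.hyps(1) obtain k p y q u u' where s: "s = sc k * mon p y q" "awalk u p y"
      "awalk u' q y" by blast
    have eq: "V w * (s * V v) = sc k * (if w = u \<and> v = u' then mon p y q else 0)"
    proof -
      have "V w * (s * V v) = sc k * (V w * (mon p y q * V v))" using sc_V[OF vw(2)]
        by (simp add: s(1)) (simp flip: mult.assoc)
      then show ?thesis using s vw by (auto simp: mon_V V_mon)
    qed
    show ?case
    proof (cases "w = u \<and> v = u'")
      case True
      then obtain r where "awalk y r v" using Pc_return s(3) assms(2) by blast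
      then show ?thesis using awalk_appendI s(2) True by blast
    next
      case False
      then show ?thesis using add.IH eq by (simp only: distrib_left distrib_right) auto
    qed
  qed simp
  then show ?thesis using that assms(4) by blast
qed

definition corner_at :: "'v \<Rightarrow> 'r set" where
  "corner_at v = {x \<in> A. V v * x = x \<and> x * V v = x}"

lemma corner_atI: "v \<in> verts G \<Longrightarrow> a \<in> A \<Longrightarrow> V v * (a * V v) \<in> corner_at v"
  using A_mult A_V by (auto simp: corner_at_def V_idem' mult.assoc V_idem)

lemma corner_at_mult: "x \<in> corner_at v \<Longrightarrow> y \<in> corner_at v \<Longrightarrow> x * y \<in> corner_at v"
  unfolding corner_at_def by (auto simp: A_mult mult.assoc) (metis mult.assoc)

text \<open>Evaluation of a polynomial at the cycle by Horner's rule, with \<open>V v\<close> in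
  place of the unit.\<close>

definition cpoly :: "'v \<Rightarrow> 'e list \<Rightarrow> 'k poly \<Rightarrow> 'r" where
  "cpoly v c = (\<lambda>p. fold_coeffs (\<lambda>a x. sc a * V v + el c * x) p 0)"

end

locale exitless_cycle_family = leavitt_family G V D H sc
  for G :: "('v, 'e) pre_digraph" and V :: "'v \<Rightarrow> 'r::ring_1" and D H :: "'e \<Rightarrow> 'r"
    and sc :: "'k::field \<Rightarrow> 'r" +
  fixes v :: 'v and c :: "'e list"
  assumes c: "exitless_cycle v c"
begin

abbreviation \<phi> :: "'k poly \<Rightarrow> 'r" where "\<phi> \<equiv> cpoly v c"

lemma cw: "awalk v c v" and c_ne: "c \<noteq> []" and v_Pc: "v \<in> Pc" and vv: "v \<in> verts G"
  and c_arcs: "set c \<subseteq> arcs G"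
  using c exitless_cycle_Pc by (auto simp: exitless_cycle_def)

section \<open>Polynomials in the cycle\<close>

lemma phi_0 [simp]: "\<phi> 0 = 0"
  by (simp add: cpoly_def)

lemma phi_pCons: "\<phi> (pCons a p) = sc a * V v + el c * \<phi> p"
  by (cases "p = 0"; cases "a = 0") (simp_all add: cpoly_def)

lemma phi_add: "\<phi> (p + q) = \<phi> p + \<phi> q"
proof (induction p arbitrary: q)
  case (pCons a p)
  show ?case
  proof (cases q)
    case (pCons b r)
    then show ?thesis by (simp add: phi_pCons pCons.IH sc_add distrib_left distrib_right)
  qed
qed simp

lemma phi_minus: "\<phi> (- p) = - \<phi> p"
  using phi_add[of p "- p"] by (simp add: eq_neg_iff_add_eq_0 add.commute)

lemma phi_diff: "\<phi> (p - q) = \<phi> p - \<phi> q"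
  using phi_add[of p "- q"] by (simp add: phi_minus)

lemma phi_smult: "\<phi> (smult a p) = sc a * \<phi> p"
proof (induction p)
  case (pCons b p)
  then show ?case by (simp add: phi_pCons distrib_left sc_mult mult.assoc)
      (simp add: sc_el[OF c_arcs] flip: mult.assoc)
qed simp

lemma phi_V: "V v * \<phi> p = \<phi> p" "\<phi> p * V v = \<phi> p"
proof -
  show "V v * \<phi> p = \<phi> p"
    by (induction p) (auto simp: phi_pCons distrib_left V_el'[OF cw] sc_V[OF vv] V_idem[OF vv]
      mult.assoc simp flip: mult.assoc[of "V v" "sc _"])
  show "\<phi> p * V v = \<phi> p"
    by (induction p) (auto simp: phi_pCons distrib_right V_idem[OF vv] mult.assoc)
qed

lemma phi_el: "\<phi> p * el c = el c * \<phi> p"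
proof (induction p)
  case (pCons a p)
  have "sc a * V v * el c = el c * (sc a * V v)"
    by (simp add: mult.assoc V_el[OF cw]) (simp add: sc_el[OF c_arcs] flip: mult.assoc)
  then show ?case by (simp add: phi_pCons distrib_left distrib_right pCons mult.assoc)
qed simp

lemma phi_mult: "\<phi> (p * q) = \<phi> p * \<phi> q"
proof (induction p)
  case (pCons a p)
  have "\<phi> (pCons a p * q) = sc a * \<phi> q + el c * (\<phi> p * \<phi> q)"
    by (simp add: phi_add phi_smult phi_pCons pCons)
  then show ?case by (simp add: phi_pCons distrib_right mult.assoc phi_V)
qed simp

lemma phi_el_pow: "\<phi> p * el c ^ n = el c ^ n * \<phi> p"
  by (induction n) (auto simp: mult.assoc phi_el simp flip: mult.assoc[of "\<phi> p"])

lemma phi_monom: "\<phi> (monom a n) = sc a * (el c ^ n * V v)"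
proof (induction n)
  case 0
  then show ?case by (simp add: monom_0 phi_pCons)
next
  case (Suc n)
  then show ?case
    by (simp add: monom_Suc phi_pCons mult.assoc) (simp add: sc_el[OF c_arcs] flip: mult.assoc)
qed

lemma phi_A: "\<phi> p \<in> A"
proof (induction p)
  case 0
  then show ?case by (simp add: A_def)
next
  case (pCons a p)
  have "sc a * V v \<in> A" using A_sc A_V vv by blast
  moreover have "el c * \<phi> p \<in> A" using pCons span_el[OF hereditary_verts c_arcs]
    by (simp add: A_def)
  ultimately show ?case using A_addsub by (simp add: phi_pCons addsub_def)
qed

lemma phi_corner: "\<phi> p \<in> corner_at v"
  by (simp add: corner_at_def phi_A phi_V)

lemma phi_sum: "\<phi> p = (\<Sum>i\<le>degree p. sc (coeff p i) * (el (pow i c) * V v))"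
proof -
  have "\<phi> p = \<phi> (\<Sum>i\<le>degree p. monom (coeff p i) i)" by (simp add: poly_as_sum_of_monoms)
  also have "\<dots> = (\<Sum>i\<le>degree p. \<phi> (monom (coeff p i) i))"
    by (rule sum_comp_morphism[symmetric, unfolded o_def]) (simp_all add: phi_add)
  finally show ?thesis by (simp add: phi_monom el_pow)
qed

text \<open>Powers of \<open>c\<close> are distinct paths ending at \<open>v\<close>, hence
  independent. As \<open>c\<close> is not empty, dividing lengths recovers the exponent, which turns
  the coefficients into a function of the path.\<close>

lemma phi_inj: "\<phi> p = 0 \<longleftrightarrow> p = 0"
proof
  assume z: "\<phi> p = 0"
  have lc: "0 < length c" using c_ne by simp
  have inj: "inj_on (\<lambda>i. pow i c) {..degree p}"
  proof
    fix i j assume "pow i c = pow j c"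
    then have "length (pow i c) = length (pow j c)" by simp
    then show "i = j" using lc by simp
  qed
  have "(\<Sum>q\<in>(\<lambda>i. pow i c) ` {..degree p}. sc (coeff p (length q div length c)) * (prod_list (map D
    q) * V v)) = 0"
    using z lc unfolding phi_sum by (simp add: sum.reindex[OF inj] el_def)
  then have "coeff p (length (pow (degree p) c) div length c) = 0"
    using awalk_pow[OF cw]
    by (intro independent[of "(\<lambda>i. pow i c) ` {..degree p}" v
      "\<lambda>q. coeff p (length q div length c)"]) auto
  then show "p = 0" using lc by simp
qed simp

lemma real_corner: "x \<in> real_span v \<Longrightarrow> \<exists>q. V v * x = \<phi> q"
  unfolding real_span_def
proof (induction rule: aspan.induct)
  case zero
  then show ?case by (intro exI[of _ 0]) simp
next
  case (add s x)
  from add.hyps(1) obtain k p u where s: "s = sc k * (el p * V v)" "awalk u p v" by blast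
  from add.IH obtain q where q: "V v * x = \<phi> q" by blast
  have "\<exists>r. V v * s = \<phi> r"
  proof (cases "u = v")
    case True
    then obtain j where "p = pow j c" using exitless_cycle_closed_walk[OF c] s(2) by blast
    then have "s = \<phi> (monom k j)" by (simp add: s(1) phi_monom el_pow)
    then show ?thesis using phi_V by metis
  next
    case False
    have "V v * s = sc k * (V v * (el p * V v))" unfolding s(1) using sc_V[OF vv]
      by (simp flip: mult.assoc)
    also have "\<dots> = sc k * (V v * V u * el p)" using s(2) by (simp add: V_el mult.assoc)
    also have "\<dots> = 0" using False s(2) vv by (simp add: V_ne awalk_hd_in_verts)
    finally show ?thesis by (intro exI[of _ 0]) simp
  qed
  then obtain r where "V v * s = \<phi> r" ..
  then show ?case using q by (intro exI[of _ "r + q"]) (simp add: phi_add distrib_left)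
qed

section \<open>The corner as the ring of Laurent polynomials\<close>

lemma real_span_el: "x \<in> real_span v \<Longrightarrow> x * el c \<in> real_span v"
proof -
  have "sc k * (el p * V v) * el c \<in> real_span v" if p: "awalk u p v" for k p u
    using real_spanI[OF awalk_appendI[OF p cw], of k] by (simp add: mult.assoc V_el[OF cw])
  then show "x \<in> real_span v \<Longrightarrow> x * el c \<in> real_span v"
    unfolding real_span_def[of v] by (elim aspan_map) (auto simp: distrib_right real_span_def)
qed

lemma real_span_el_pow: "x \<in> real_span v \<Longrightarrow> x * el c ^ n \<in> real_span v"
  by (induction n arbitrary: x) (auto simp: real_span_el simp flip: mult.assoc)

text \<open>Clearing of denominators: a ghost path \<open>q\<close> starting at \<open>v\<close> can
  be completed by some \<open>r\<close> to \<open>pow j c\<close>, and \<open>gl q\<close> cancels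
  the factor \<open>el q\<close> of it. Larger powers keep the element real, which gives a common
  exponent for sums.\<close>

lemma A_V_real: "a \<in> A \<Longrightarrow> \<exists>N. \<forall>n\<ge>N. a * V v * el c ^ n \<in> real_span v"
  unfolding A_def span_def
proof (induction rule: aspan.induct)
  case zero
  then show ?case by (simp add: real_span_def aspan.zero)
next
  case (add s x)
  from add.hyps(1) obtain k p w q u u' where s: "s = sc k * mon p w q" "awalk u p w" "awalk u' q w"
    by blast
  from add.IH obtain N where N: "\<And>n. n \<ge> N \<Longrightarrow> x * V v * el c ^ n \<in> real_span v" by blast
  have "\<exists>M. \<forall>n\<ge>M. s * V v * el c ^ n \<in> real_span v"
  proof (cases "u' = v")
    case False
    then have "s * V v = 0" using s vv by (simp add: mult.assoc mon_V)
    then show ?thesis by (simp add: real_span_def aspan.zero)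
  next
    case True
    then obtain r where r: "awalk w r v" using Pc_return s(3) v_Pc by blast
    then obtain j where j: "q @ r = pow j c"
      using exitless_cycle_closed_walk[OF c awalk_appendI] s(3) True by blast
    have ww: "w \<in> verts G" using r by (rule awalk_hd_in_verts)
    have "s * V v * el c ^ j = sc k * (el p * (V w * (gl q * (el q * el r))))"
      using s(3) True vv by (simp add: s(1) mult.assoc mon_V flip: el_pow j)
        (simp add: mon_def mult.assoc gl_V' V_idem' ww)
    also have "\<dots> = sc k * (el (p @ r) * V v)"
      using gl_el'[OF s(3)] by (simp add: V_el[OF r] mult.assoc)
    finally have "s * V v * el c ^ j \<in> real_span v"
      using real_spanI[OF awalk_appendI[OF s(2) r]] by simp
    then have "s * V v * el c ^ n \<in> real_span v" if "n \<ge> j" for n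
      using real_span_el_pow[of "s * V v * el c ^ j" "n - j"] that
        by (simp add: mult.assoc flip: power_add)
    then show ?thesis by blast
  qed
  then obtain M where M: "\<And>n. n \<ge> M \<Longrightarrow> s * V v * el c ^ n \<in> real_span v" by blast
  have "(s + x) * V v * el c ^ n \<in> real_span v" if "n \<ge> max M N" for n
    using M[of n] N[of n] that by (simp add: distrib_right real_span_def aspan_add)
  then show ?case by blast
qed

lemma el_gl_pow: "V v * (el c ^ n * gl c ^ n) = V v"
  using Pc_el_gl[OF awalk_pow[OF cw, of n] v_Pc]
  by (simp add: el_pow gl_pow V_el'[OF awalk_pow[OF cw], unfolded el_pow])

lemma cancel_el_pow: "x * V v = x \<Longrightarrow> x * el c ^ n * gl c ^ n = x"
  using el_gl_pow[of n] by (metis mult.assoc)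

lemma V_el_pow: "V v * el c ^ n = el c ^ n * V v"
  using V_el[OF awalk_pow[OF cw, of n]] by (simp add: el_pow)

lemma corner_poly:
  assumes "x \<in> corner_at v"
  obtains N q where "x * el c ^ N = \<phi> q"
proof -
  obtain N where "x * V v * el c ^ N \<in> real_span v" using A_V_real[of x] assms
    by (auto simp: corner_at_def)
  then obtain q where "V v * (x * V v * el c ^ N) = \<phi> q" using real_corner by blast
  then show ?thesis using that assms by (simp add: corner_at_def flip: mult.assoc)
qed

lemma corner_mult_poly:
  assumes "x * el c ^ N = \<phi> p" "y * el c ^ M = \<phi> q" "y \<in> corner_at v"
  shows "x * y * el c ^ (M + N) = \<phi> (p * q)"
proof -
  have "x * y * el c ^ (M + N) = x * \<phi> q * el c ^ N"
    by (simp add: power_add mult.assoc flip: assms(2))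
  also have "\<dots> = x * el c ^ N * \<phi> q" by (simp add: mult.assoc phi_el_pow)
  finally show ?thesis by (simp add: assms(1) phi_mult)
qed

text \<open>After clearing denominators both products become the value of the same product of
  polynomials; the power of \<open>el c\<close> is then cancelled by that of
  \<open>gl c\<close>.\<close>

lemma corner_commute:
  assumes x: "x \<in> corner_at v" and y: "y \<in> corner_at v"
  shows "x * y = y * x"
proof -
  obtain N p where p: "x * el c ^ N = \<phi> p" using corner_poly[OF x] .
  obtain M q where q: "y * el c ^ M = \<phi> q" using corner_poly[OF y] .
  have "x * y * el c ^ (M + N) = y * x * el c ^ (M + N)"
    using corner_mult_poly[OF p q y] corner_mult_poly[OF q p x]
      by (simp add: mult.commute add.commute)
  then show ?thesis using cancel_el_pow[of "x * y" "M + N"] cancel_el_pow[of "y * x" "M + N"] x y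
    by (simp add: corner_at_def mult.assoc)
qed

lemma corner_domain:
  assumes x: "x \<in> corner_at v" and y: "y \<in> corner_at v" and xy: "x * y = 0"
  shows "x = 0 \<or> y = 0"
proof -
  obtain N p where p: "x * el c ^ N = \<phi> p" using corner_poly[OF x] .
  obtain M q where q: "y * el c ^ M = \<phi> q" using corner_poly[OF y] .
  have "\<phi> (p * q) = 0" using corner_mult_poly[OF p q y] xy by simp
  then have "\<phi> p = 0 \<or> \<phi> q = 0" by (simp add: phi_inj)
  then show ?thesis using p q cancel_el_pow[of x N] cancel_el_pow[of y M] x y
    by (auto simp: corner_at_def)
qed

lemma phi_monom_1: "\<phi> (monom 1 n) = V v * el c ^ n"
  by (simp add: phi_monom sc_one vv flip: V_el_pow mult.assoc)

lemma corner_el_pow: "V v * el c ^ n \<in> corner_at v"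
  using phi_corner[of "monom 1 n"] by (simp add: phi_monom_1)

lemma corner_gl_pow: "V v * gl c ^ n \<in> corner_at v"
  using A_Vgl[OF awalk_pow[OF cw, of n]] gl_V[OF awalk_pow[OF cw, of n]]
  by (simp add: corner_at_def gl_pow V_idem V_idem' vv mult.assoc)

text \<open>The argument for Laurent polynomials: powers of the cycle bring the members of
  \<open>J\<close> to polynomials in \<open>J\<close>, among which one of least degree divides all
  others. Afterwards the power, a unit, is divided out again.\<close>

lemma corner_principal:
  assumes J: "submod (*) (corner_at v) (corner_at v) J"
  obtains g where "g \<in> J" "\<And>x. x \<in> J \<Longrightarrow> \<exists>d\<in>corner_at v. x = d * g"
proof -
  have Jc: "J \<subseteq> corner_at v" and Jadd: "addsub J" and Jm: "\<And>d x. d \<in> corner_at v \<Longrightarrow> x \<in> J \<Longrightarrow>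
    d * x \<in> J"
    using J by (auto simp: submod_def)
  have clear: "\<exists>N q. x * el c ^ N = \<phi> q \<and> \<phi> q \<in> J" if x: "x \<in> J" for x
  proof -
    obtain N q where q: "x * el c ^ N = \<phi> q" using corner_poly Jc x by blast
    \<comment> \<open>\<open>J\<close> absorbs factors from the left, whereas denominators are
      cleared from the right; commutativity of the corner reconciles the two.\<close>
    have "(V v * el c ^ N) * x = x * (V v * el c ^ N)" using corner_commute corner_el_pow Jc x
      by blast
    also have "\<dots> = \<phi> q" using Jc x q by (auto simp: corner_at_def simp flip: mult.assoc)
    finally have "\<phi> q \<in> J" using Jm[OF corner_el_pow x, of N] by simp
    then show ?thesis using q by blast
  qed
  show ?thesis
  proof (cases "\<exists>p. p \<noteq> 0 \<and> \<phi> p \<in> J")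
    case False
    have "x = 0" if x: "x \<in> J" for x
    proof -
      obtain N q where q: "x * el c ^ N = \<phi> q" "\<phi> q \<in> J" using clear[OF x] by blast
      then have "q = 0" using False by blast
      then show "x = 0" using q cancel_el_pow[of x N] Jc x by (auto simp: corner_at_def)
    qed
    then show ?thesis using Jadd Jc by (intro that[of 0]) (auto simp: addsub_def)
  next
    case True
    define P where "P n \<longleftrightarrow> (\<exists>p. p \<noteq> 0 \<and> \<phi> p \<in> J \<and> degree p = n)" for n
    have "\<exists>n. P n" using True by (auto simp: P_def)
    then have "P (LEAST n. P n)" by (rule LeastI_ex)
    then obtain p where p: "p \<noteq> 0" "\<phi> p \<in> J" "degree p = (LEAST n. P n)" by (auto simp: P_def)
    have least: "degree p \<le> degree q" if "q \<noteq> 0" "\<phi> q \<in> J" for q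
      unfolding p(3) by (rule Least_le) (use that in \<open>auto simp: P_def\<close>)
    have dvd: "p dvd q" if q: "\<phi> q \<in> J" for q
    proof -
      have "q mod p = q - q div p * p" by (simp add: minus_div_mult_eq_mod)
      then have "\<phi> (q mod p) = \<phi> q - \<phi> (q div p) * \<phi> p" by (simp add: phi_diff phi_mult)
      also have "\<dots> \<in> J" using q p Jm phi_corner by (intro addsub_diff Jadd) auto
      finally have "q mod p = 0" using least[of "q mod p"] degree_mod_less'[of p q] p(1)
        by fastforce
      then show ?thesis by (rule mod_0_imp_dvd)
    qed
    have "\<exists>d\<in>corner_at v. x = d * \<phi> p" if x: "x \<in> J" for x
    proof -
      obtain N q where q: "x * el c ^ N = \<phi> q" "\<phi> q \<in> J" using clear[OF x] by blast
      then obtain r where "q = p * r" using dvd by blast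
      then have "\<phi> q = \<phi> r * \<phi> p" by (simp add: mult.commute flip: phi_mult)
      then have "x = \<phi> r * \<phi> p * gl c ^ N" using q(1) cancel_el_pow[of x N] Jc x
        by (auto simp: corner_at_def)
      also have "\<dots> = \<phi> r * (\<phi> p * (V v * gl c ^ N))"
        by (simp add: mult.assoc phi_V flip: mult.assoc[of "\<phi> p" "V v"])
      also have "\<dots> = (\<phi> r * (V v * gl c ^ N)) * \<phi> p"
        using corner_commute[OF phi_corner corner_gl_pow, of p N] by (simp add: mult.assoc)
      finally show ?thesis using corner_at_mult[OF phi_corner corner_gl_pow] by blast
    qed
    then show ?thesis using that p(2) by blast
  qed
qed

lemma acc_corner: "acc (*) (corner_at v) (corner_at v)"
  unfolding acc_def
proof (intro allI impI)
  fix J :: "nat \<Rightarrow> 'r set"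
  assume J: "(\<forall>n. submod (*) (corner_at v) (corner_at v) (J n)) \<and> (\<forall>n. J n \<subseteq> J (Suc n))"
  have mono: "J i \<subseteq> J j" if "i \<le> j" for i j
    using that J lift_Suc_mono_le[of J] by blast
  have add: "x + y \<in> (\<Union>n. J n)" if xy: "x \<in> J i" "y \<in> J j" for x y i j
  proof -
    have "x \<in> J (max i j)" "y \<in> J (max i j)" using xy mono[of i "max i j"] mono[of j "max i j"]
      by auto
    then have "x + y \<in> J (max i j)" using J by (simp add: submod_def addsub_def)
    then show ?thesis by blast
  qed
  have "submod (*) (corner_at v) (corner_at v) (\<Union>n. J n)"
    unfolding submod_def
  proof (intro conjI ballI)
    show "(\<Union>n. J n) \<subseteq> corner_at v" using J by (auto simp: submod_def)
    have "0 \<in> J 0" "\<And>n x. x \<in> J n \<Longrightarrow> - x \<in> J n" using J by (auto simp: submod_def addsub_def)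
    then show "addsub (\<Union>n. J n)"
      unfolding addsub_def
    proof (intro conjI ballI)
      fix x y assume "x \<in> (\<Union>n. J n)" "y \<in> (\<Union>n. J n)"
      then obtain i j where "x \<in> J i" "y \<in> J j" by blast
      then show "x + y \<in> (\<Union>n. J n)" by (rule add)
    qed auto
    fix b x assume "b \<in> corner_at v" "x \<in> (\<Union>n. J n)"
    then show "b * x \<in> (\<Union>n. J n)" using J by (auto simp: submod_def)
  qed
  then obtain g where g: "g \<in> (\<Union>n. J n)" "\<And>x. x \<in> (\<Union>n. J n) \<Longrightarrow> \<exists>d\<in>corner_at v. x = d * g"
    using corner_principal by blast
  then obtain N where N: "g \<in> J N" by blast
  have "J n = J N" if "n \<ge> N" for n
  proof
    show "J N \<subseteq> J n" using mono[OF that] .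
    show "J n \<subseteq> J N"
    proof
      fix x assume "x \<in> J n"
      then obtain d where "d \<in> corner_at v" "x = d * g" using g(2) by blast
      then show "x \<in> J N" using N J by (simp add: submod_def)
    qed
  qed
  then show "\<exists>N. \<forall>n\<ge>N. J n = J N" by blast
qed

lemma submod_opp:
  "submod (\<lambda>x y. y * x) (corner_at v) (corner_at v) J \<longleftrightarrow> submod (*) (corner_at v) (corner_at v) J"
proof (cases "J \<subseteq> corner_at v")
  case True
  then have "x * b = b * x" if "b \<in> corner_at v" "x \<in> J" for b x using corner_commute that by blast
  then show ?thesis by (simp add: submod_def)
qed (simp add: submod_def)

lemma acc_corner_opp: "acc (\<lambda>x y. y * x) (corner_at v) (corner_at v)"
  using acc_corner unfolding acc_def submod_opp .

text \<open>Clearing the denominator of \<open>d\<close>, an inverse would yield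
  \<open>q * [:1, 1:] = monom 1 N\<close>, but the left side vanishes at -1 and the right side does
  not. One plus the cycle is chosen because this works over every field.\<close>

lemma corner_nonunit:
  assumes "d \<in> corner_at v"
  shows "d * (V v + el c * V v) \<noteq> V v"
proof
  assume d: "d * (V v + el c * V v) = V v"
  obtain N q where q: "d * el c ^ N = \<phi> q" using corner_poly[OF assms] .
  have one: "\<phi> [:1, 1:] = V v + el c * V v" by (simp add: phi_pCons sc_one vv)
  have "\<phi> (q * [:1, 1:]) = d * (el c ^ N * \<phi> [:1, 1:])"
    unfolding phi_mult q[symmetric] by (simp only: mult.assoc)
  also have "\<dots> = V v * el c ^ N" unfolding phi_el_pow[symmetric]
    unfolding one mult.assoc[symmetric] d ..
  also have "\<dots> = \<phi> (monom 1 N)" by (simp only: phi_monom_1)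
  finally have "\<phi> (q * [:1, 1:] - monom 1 N) = 0" by (simp only: phi_diff diff_self)
  then have "q * [:1, 1:] = monom 1 N" unfolding phi_inj by simp
  then have "poly (q * [:1, 1:]) (- 1) = poly (monom 1 N) (- 1)" by (simp only:)
  then show False by (simp add: poly_monom)
qed

lemma corner_nonzero: "V v + el c * V v \<noteq> 0"
  using phi_inj[of "[:1, 1:]"] by (simp add: phi_pCons sc_one vv)

end

section \<open>The ideal of the exitless cycles\<close>

context leavitt_family begin

lemma exitless_cycle_family_at:
  assumes "v \<in> Pc"
  obtains c where "exitless_cycle_family G V D H sc v c"
proof -
  obtain c where "exitless_cycle v c" using Pc_exitless_cycle[OF assms] .
  then have "exitless_cycle_family G V D H sc v c" by unfold_locales
  then show ?thesis by (rule that)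
qed

definition Ic :: "'r set" where "Ic = span Pc"

lemma Ic_A: "Ic \<subseteq> A"
  unfolding Ic_def by (rule A_sub[OF Pc_verts])

lemma Ic_ideal: "x \<in> Ic \<Longrightarrow> a \<in> A \<Longrightarrow> a * x \<in> Ic" "x \<in> Ic \<Longrightarrow> a \<in> A \<Longrightarrow> x * a \<in> Ic"
  unfolding Ic_def using span_ideal[OF hereditary_Pc] by auto

lemma Ic_addsub: "addsub Ic"
  unfolding Ic_def by (rule span_addsub)

lemma Ic_V: "v \<in> Pc \<Longrightarrow> V v \<in> Ic"
  using span_monI[of v Pc v "[]" v "[]"] Pc_verts by (auto simp: Ic_def mon_def awalk_Nil_iff)

text \<open>Paths that arrive in \<open>Pc\<close> with their last edge, or start there and are
  empty. The end vertex is listed since it cannot be read off the empty path.\<close>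

definition entering :: "('e list \<times> 'v) set" where
  "entering = {(m, w). w \<in> Pc \<and> (\<exists>u. awalk u m w) \<and> (m = [] \<or> tail G (last m) \<notin> Pc)}"

definition unit_of :: "('e list \<times> 'v) set \<Rightarrow> 'r" where
  "unit_of M = (\<Sum>(m, w)\<in>M. mon m w m)"

text \<open>A path that has reached the hereditary set \<open>Pc\<close> stays there, so the last
  edge of a proper extension starts in \<open>Pc\<close>. Hence different entering paths from one
  vertex are incomparable and their projections orthogonal.\<close>

lemma entering_append:
  assumes "(m, w) \<in> entering" "(m @ s, w') \<in> entering" "awalk u m w" "awalk u (m @ s) w'"
  shows "s = [] \<and> w = w'"
proof -
  have "awalk w s w'" using assms(3,4) by simp
  moreover have "w \<in> Pc" using assms(1) by (auto simp: entering_def)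
  moreover have "tail G (last s) \<in> Pc" if s_ne: "awalk w s w'" "w \<in> Pc" "s \<noteq> []"
  proof -
    obtain s' e where s: "s = s' @ [e]" using s_ne(3) by (cases s rule: rev_cases) auto
    have "awlast w s' = tail G e" using s_ne(1) by (simp add: s awalk_Cons_iff)
    then have "awalk w s' (tail G e)" using s_ne(1) by (simp add: s)
    then have "tail G e \<in> Pc" using Pc_walk s_ne(2) by blast
    then show ?thesis by (simp add: s)
  qed
  ultimately show ?thesis
    using assms(2) by (cases "s = []") (auto simp: entering_def awalk_Nil_iff)
qed

lemma entering_orthogonal:
  assumes "(m, w) \<in> entering" "(m', w') \<in> entering" "(m, w) \<noteq> (m', w')"
  shows "V w * (gl m * (el m' * V w')) = 0"
proof -
  obtain u u' where u: "awalk u m w" "awalk u' m' w'" using assms by (auto simp: entering_def)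
  show ?thesis
  proof (cases "u = u'")
    case False
    then show ?thesis using gl_el_different u by blast
  next
    case True
    have "\<nexists>s. m' = m @ s" using entering_append[OF assms(1) _ u(1)] assms(2,3) u(2) True by auto
    moreover have "\<nexists>s. m = m' @ s" using entering_append[OF assms(2) _ u(2)] assms(1,3) u(1) True
      by auto
    ultimately have "gl m * el m' = 0" using gl_el_incomparable[OF u(1) u(2)[folded True]] by blast
    then show ?thesis by (simp flip: mult.assoc)
  qed
qed

lemma entering_orthogonal':
  assumes "(m, w) \<in> entering" "(m', w') \<in> entering" "(m, w) \<noteq> (m', w')"
  shows "V w * (gl m * (el m' * (V w' * x))) = 0"
  using arg_cong[OF entering_orthogonal[OF assms], of "\<lambda>z. z * x"] by (simp add: mult.assoc)

lemma entering_self: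
  assumes "(m, w) \<in> entering"
  shows "V w * (gl m * (el m * V w)) = V w" "V w * (gl m * (el m * (V w * x))) = V w * x"
proof -
  have "w \<in> verts G" "\<exists>u. awalk u m w" using assms Pc_verts by (auto simp: entering_def)
  then show "V w * (gl m * (el m * V w)) = V w" "V w * (gl m * (el m * (V w * x))) = V w * x"
    using gl_el' V_idem V_idem' by auto
qed

lemma entering_mon_mult:
  assumes "(m, w) \<in> entering" "(m', w') \<in> entering"
  shows "mon m w m * mon m' w' m' = (if (m, w) = (m', w') then mon m w m else 0)"
proof (cases "(m, w) = (m', w')")
  case True
  then show ?thesis using entering_self(2)[OF assms(1)] by (auto simp: mon_def mult.assoc)
next
  case False
  have "mon m w m * mon m' w' m' = el m * (V w * (gl m * (el m' * V w'))) * gl m'"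
    by (simp add: mon_def mult.assoc)
  then show ?thesis using entering_orthogonal[OF assms False] False by auto
qed

text \<open>Edges are removed from the end as long as they start in \<open>Pc\<close>; what remains
  is the part up to the first arrival.\<close>

lemma entering_decomp:
  "awalk u p w \<Longrightarrow> w \<in> Pc \<Longrightarrow> \<exists>m w0 s. p = m @ s \<and> (m, w0) \<in> entering \<and> awalk u m w0 \<and> awalk w0 s w"
proof (induction p arbitrary: w rule: rev_induct)
  case Nil
  then show ?case by (auto simp: entering_def awalk_Nil_iff intro!: exI[of _ "[]"])
next
  case (snoc e p)
  then have e: "awalk u p (tail G e)" "e \<in> arcs G" "head G e = w"
    by (auto simp: awalk_simps awlast_of_awalk)
  show ?case
  proof (cases "tail G e \<in> Pc")
    case True
    then obtain m w0 s where m: "p = m @ s" "(m, w0) \<in> entering" "awalk u m w0"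
      "awalk w0 s (tail G e)"
      using snoc.IH e by blast
    then have "awalk w0 (s @ [e]) w" using e awalk_appendI arc_implies_awalk by blast
    then show ?thesis using m by (intro exI[of _ m] exI[of _ w0] exI[of _ "s @ [e]"]) auto
  next
    case False
    have "awalk w [] w" using snoc.prems
      by (simp add: awalk_Nil_iff awalk_last_in_verts del: awalk_append_iff)
    then show ?thesis using False snoc.prems
      by (intro exI[of _ "p @ [e]"] exI[of _ w] exI[of _
        "[]"]) (auto simp: entering_def simp del: awalk_append_iff)
  qed
qed

lemma unit_of_el:
  assumes M: "finite M" "M \<subseteq> entering" "(m, w) \<in> M"
  shows "unit_of M * (el m * (V w * x)) = el m * (V w * x)" "x * (V w * gl m) * unit_of M =
    x * (V w * gl m)"
proof -
  have mE: "(m, w) \<in> entering" using M by blast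
  have "unit_of M * (el m * (V w * x)) = (\<Sum>(m', w')\<in>M. mon m' w' m' * (el m * (V w * x)))"
    by (simp add: unit_of_def sum_distrib_right case_prod_unfold)
  also have "\<dots> = (\<Sum>i\<in>M. if i = (m, w) then el m * (V w * x) else 0)"
  proof (intro sum.cong refl, clarify)
    fix m' w' assume i: "(m', w') \<in> M"
    then have iE: "(m', w') \<in> entering" using M by blast
    show "mon m' w' m' * (el m * (V w * x)) = (if (m', w') = (m, w) then el m * (V w * x) else 0)"
      using entering_orthogonal'[OF iE mE] entering_self(2)[OF mE]
        by (auto simp: mon_def mult.assoc)
  qed
  also have "\<dots> = el m * (V w * x)" using M by simp
  finally show "unit_of M * (el m * (V w * x)) = el m * (V w * x)" .
  have "x * (V w * gl m) * unit_of M = (\<Sum>(m', w')\<in>M. x * (V w * gl m) * mon m' w' m')"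
    by (simp add: unit_of_def sum_distrib_left case_prod_unfold)
  also have "\<dots> = (\<Sum>i\<in>M. if i = (m, w) then x * (V w * gl m) else 0)"
  proof (intro sum.cong refl, clarify)
    fix m' w' assume i: "(m', w') \<in> M"
    then have iE: "(m', w') \<in> entering" using M by blast
    show "x * (V w * gl m) * mon m' w' m' = (if (m', w') = (m, w) then x * (V w * gl m) else 0)"
      using entering_orthogonal'[OF mE iE] entering_self(2)[OF mE]
        by (auto simp: mon_def mult.assoc)
  qed
  also have "\<dots> = x * (V w * gl m)" using M by simp
  finally show "x * (V w * gl m) * unit_of M = x * (V w * gl m)" .
qed

text \<open>Two projections suffice for a monomial: the one at the entering part of \<open>p\<close>
  is a unit from the left, the one at the entering part of \<open>q\<close> from the right. Larger
  sets \<open>M\<close> do no harm by orthogonality.\<close>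

lemma unit_of_mon:
  assumes p: "awalk u p w" "w \<in> Pc" and q: "awalk u' q w"
  shows "\<exists>M0. finite M0 \<and> M0 \<subseteq> entering \<and> (\<forall>M. finite M \<and> M0 \<subseteq> M \<and> M \<subseteq> entering \<longrightarrow>
    unit_of M * (sc k * mon p w q) = sc k * mon p w q \<and> sc k * mon p w q * unit_of M =
      sc k * mon p w q)"
proof -
  obtain m w0 s where m: "p = m @ s" "(m, w0) \<in> entering" "awalk u m w0" "awalk w0 s w"
    using entering_decomp[OF p] by blast
  obtain m' w0' s' where m': "q = m' @ s'" "(m', w0') \<in> entering" "awalk u' m' w0'" "awalk w0' s' w"
    using entering_decomp[OF q p(2)] by blast
  have pa: "set p \<subseteq> arcs G" and ma: "set m \<subseteq> arcs G" "w0 \<in> verts G" using p(1) m(1,3) by auto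
  have e1: "sc k * mon p w q = el m * (V w0 * (sc k * (el s * gl q)))"
  proof -
    have "mon p w q = el m * (V w0 * (el s * gl q))"
      by (simp add: mon_def m(1) mult.assoc V_el'[OF m(4)])
    then show ?thesis by (simp add: sc_el[OF ma(1)] sc_V[OF ma(2)] flip: mult.assoc)
  qed
  have e2: "sc k * mon p w q = (sc k * (el p * gl s')) * (V w0' * gl m')"
  proof -
    have "mon p w q = el p * (V w * gl s' * gl m')" by (simp add: mon_def m'(1) mult.assoc)
    also have "\<dots> = el p * gl s' * (V w0' * gl m')" by (simp add: mult.assoc flip: gl_V[OF m'(4)])
    finally show ?thesis by (simp add: mult.assoc)
  qed
  have "unit_of M * (sc k * mon p w q) = sc k * mon p w q \<and> sc k * mon p w q * unit_of M =
    sc k * mon p w q"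
    if "finite M" "{(m, w0), (m', w0')} \<subseteq> M" "M \<subseteq> entering" for M
  proof
    show "unit_of M * (sc k * mon p w q) = sc k * mon p w q"
      unfolding e1 using that by (intro unit_of_el) auto
    show "sc k * mon p w q * unit_of M = sc k * mon p w q"
      unfolding e2 using that by (intro unit_of_el) auto
  qed
  then show ?thesis using m(2) m'(2) by (intro exI[of _ "{(m, w0), (m', w0')}"]) auto
qed

lemma Ic_unit:
  "x \<in> Ic \<Longrightarrow> \<exists>M0. finite M0 \<and> M0 \<subseteq> entering \<and>
    (\<forall>M. finite M \<and> M0 \<subseteq> M \<and> M \<subseteq> entering \<longrightarrow> unit_of M * x = x \<and> x * unit_of M = x)"
  unfolding Ic_def span_def
proof (induction rule: aspan.induct)
  case zero
  show ?case by (rule exI[of _ "{}"]) simp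
next
  case (add s x)
  from add.hyps(1) obtain k p w q u u' where s: "s = sc k * mon p w q" "w \<in> Pc" "awalk u p w"
    "awalk u' q w" by blast
  from add.IH obtain M0 where M0: "finite M0" "M0 \<subseteq> entering"
    "\<forall>M. finite M \<and> M0 \<subseteq> M \<and> M \<subseteq> entering \<longrightarrow> unit_of M * x = x \<and> x * unit_of M = x"
    by (elim exE conjE)
  from unit_of_mon[OF s(3,2,4), of k] obtain M1 where M1: "finite M1" "M1 \<subseteq> entering"
    "\<forall>M. finite M \<and> M1 \<subseteq> M \<and> M \<subseteq> entering \<longrightarrow> unit_of M * s = s \<and> s * unit_of M = s"
    unfolding s(1) by (elim exE conjE)
  show ?case using M0 M1 by (intro exI[of _ "M0 \<union> M1"]) (auto simp: distrib_left distrib_right)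
qed

lemma Ic_single_unit:
  assumes "x \<in> Ic"
  obtains M where "finite M" "M \<subseteq> entering" "unit_of M * x = x" "x * unit_of M = x"
proof -
  obtain M where "finite M" "M \<subseteq> entering"
    "\<forall>M'. finite M' \<and> M \<subseteq> M' \<and> M' \<subseteq> entering \<longrightarrow> unit_of M' * x = x \<and> x * unit_of M' = x"
    using Ic_unit[OF assms] by (elim exE conjE)
  then show ?thesis by (intro that[of M]) simp_all
qed

lemma Ic_common_unit:
  assumes "finite X" "X \<subseteq> Ic"
  obtains M where "finite M" "M \<subseteq> entering" "\<And>x. x \<in> X \<Longrightarrow> unit_of M * x = x \<and> x * unit_of M = x"
proof -
  have "\<forall>x\<in>X. \<exists>M0. finite M0 \<and> M0 \<subseteq> entering \<and>
    (\<forall>M. finite M \<and> M0 \<subseteq> M \<and> M \<subseteq> entering \<longrightarrow> unit_of M * x = x \<and> x * unit_of M = x)"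
    using assms Ic_unit by blast
  then obtain F where F: "\<forall>x\<in>X. finite (F x) \<and> F x \<subseteq> entering \<and>
    (\<forall>M. finite M \<and> F x \<subseteq> M \<and> M \<subseteq> entering \<longrightarrow> unit_of M * x = x \<and> x * unit_of M = x)"
    by (auto simp: bchoice_iff)
  show ?thesis
  proof (rule that[of "\<Union>x\<in>X. F x"])
    show "finite (\<Union>x\<in>X. F x)" "(\<Union>x\<in>X. F x) \<subseteq> entering" using F assms(1) by auto
    then show "\<And>x. x \<in> X \<Longrightarrow> unit_of (\<Union>x\<in>X. F x) * x = x \<and> x * unit_of (\<Union>x\<in>X. F x) = x"
      using F by blast
  qed
qed

text \<open>Every spanning monomial has a vertex of \<open>Pc\<close> as a factor in its
  middle.\<close>

lemma Ic_least:
  assumes "addsub J" "\<And>v. v \<in> Pc \<Longrightarrow> V v \<in> J"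
    and "\<And>a x. a \<in> A \<Longrightarrow> x \<in> J \<Longrightarrow> a * x \<in> J" "\<And>a x. a \<in> A \<Longrightarrow> x \<in> J \<Longrightarrow> x * a \<in> J"
  shows "Ic \<subseteq> J"
proof
  fix x assume "x \<in> Ic"
  then show "x \<in> J"
    unfolding Ic_def span_def
  proof (rule aspan_least[OF _ assms(1)], intro subsetI, elim CollectE exE conjE)
    fix s k p w q u u' assume s: "s = sc k * mon p w q" "w \<in> Pc" "awalk u p w" "awalk u' q w"
    then have w: "w \<in> verts G" using Pc_verts by blast
    have "s = sc k * (el p * V w) * (V w * (V w * gl q))"
      by (simp add: s(1) mon_def mult.assoc V_idem' w)
    then show "s \<in> J"
      using assms(2)[OF s(2)] assms(3,4) A_sc[OF A_elV[OF s(3)]] A_Vgl[OF s(4)] by blast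
  qed
qed

lemma entering_mon_Ic: "(m, w) \<in> entering \<Longrightarrow> mon m w m \<in> Ic"
  unfolding entering_def Ic_def by (auto intro: span_monI)

lemma unit_of_Ic: "M \<subseteq> entering \<Longrightarrow> unit_of M \<in> Ic"
  unfolding unit_of_def by (intro addsub_sum Ic_addsub) (auto intro: entering_mon_Ic)

lemma unit_of_idem:
  assumes "finite M" "M \<subseteq> entering"
  shows "unit_of M * unit_of M = unit_of M"
proof -
  have "unit_of M * mon m w m = mon m w m" if "(m, w) \<in> M" for m w
    using unit_of_el(1)[OF assms that] by (simp add: mon_def)
  then show ?thesis
    by (subst (2 3) unit_of_def) (auto simp: sum_distrib_left case_prod_unfold intro!: sum.cong)
qed

text \<open>
  Since \<open>V w = el r * V v * gl r\<close> for a path \<open>r\<close> from \<open>w\<close> to \<open>v\<close> inside a cycle without exits,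
  all local units needed at \<open>v\<close> factor through \<open>V v\<close>.
\<close>

lemma factor_through:
  assumes v: "v \<in> Pc" and x: "x \<in> A" "x * V v = x"
  obtains M :: "('e list \<times> 'v) set" and X Y where "finite M"
    "\<forall>i\<in>M. X i \<in> A \<and> X i * V v = X i \<and> Y i \<in> A" "x = (\<Sum>i\<in>M. X i * (V v * (Y i * x)))"
proof -
  have vv: "v \<in> verts G" using v Pc_verts by blast
  have "x \<in> Ic" using Ic_ideal(1)[OF Ic_V[OF v] x(1)] x(2) by simp
  then obtain M where M: "finite M" "M \<subseteq> entering" "unit_of M * x = x"
    by (rule Ic_single_unit)
  have "\<exists>X Y. X \<in> A \<and> X * V v = X \<and> Y \<in> A \<and> mon m w m * x = X * (V v * (Y * x))" if mw: "(m, w) \<in> M"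
    for m w
  proof -
    have w: "w \<in> Pc" using mw M(2) by (auto simp: entering_def)
    then have wv: "w \<in> verts G" using Pc_verts by blast
    obtain u where m: "awalk u m w" using mw M(2) by (auto simp: entering_def)
    show ?thesis
    \<comment> \<open>A path from \<open>w\<close> to \<open>v\<close> is available only if the
      component of \<open>x\<close> is non-zero; otherwise zero factors do.\<close>
    proof (cases "mon m w m * x = 0")
      case True
      then show ?thesis using A_addsub by (intro exI[of _ 0]) (auto simp: addsub_def)
    next
      case False
      have gx: "V w * gl m * x \<in> A" using A_mult[OF A_Vgl[OF m] x(1)] .
      have "V w * (V w * gl m * x * V v) \<noteq> 0"
      proof
        assume "V w * (V w * gl m * x * V v) = 0"
        then have "V w * (gl m * x) = 0" by (simp add: mult.assoc V_idem' wv x(2))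
        then show False using False by (simp add: mon_def mult.assoc)
      qed
      then obtain r where r: "awalk w r v" using connected_Pc[OF w v gx] by blast
      have "mon m w m = el m * (el r * (V v * (gl r * gl m)))"
        using Pc_el_gl'[OF r w, of "gl m"] by (simp add: mon_def)
      also have "\<dots> = (el (m @ r) * V v) * (V v * (V v * gl (m @ r)))"
        by (simp add: mult.assoc V_idem' vv)
      finally have "mon m w m * x = (el (m @ r) * V v) * (V v * ((V v * gl (m @ r)) * x))"
        by (simp add: mult.assoc)
      moreover have "el (m @ r) * V v \<in> A" "V v * gl (m @ r) \<in> A"
        using A_elV A_Vgl awalk_appendI[OF m r] by blast+
      moreover have "el (m @ r) * V v * V v = el (m @ r) * V v" by (simp add: mult.assoc V_idem vv)
      ultimately show ?thesis by blast
    qed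
  qed
  then have "\<forall>i\<in>M. \<exists>X Y. X \<in> A \<and> X * V v = X \<and> Y \<in> A \<and> mon (fst i) (snd i) (fst i) * x =
    X * (V v * (Y * x))" by auto
  then obtain X Y where XY: "\<forall>i\<in>M. X i \<in> A \<and> X i * V v = X i \<and> Y i \<in> A \<and>
      mon (fst i) (snd i) (fst i) * x = X i * (V v * (Y i * x))" unfolding bchoice_iff by blast
  have "x = (\<Sum>i\<in>M. mon (fst i) (snd i) (fst i) * x)"
    using M(3) by (simp add: unit_of_def case_prod_unfold sum_distrib_right)
  also have "\<dots> = (\<Sum>i\<in>M. X i * (V v * (Y i * x)))" using XY by (intro sum.cong) auto
  finally show ?thesis using that[of M X Y] M(1) XY by blast
qed

text \<open>Each \<open>V v * (Y i * x)\<close> from \<open>factor_through\<close> lies in the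
  corner, a domain, and is annihilated by \<open>g\<close>; so all of them vanish, and with them
  \<open>x\<close>.\<close>

lemma corner_torsion_free:
  assumes v: "v \<in> Pc" and x: "x \<in> A" "x * V v = x" and g: "g \<in> corner_at v" "g \<noteq> 0" and xg:
    "x * g = 0"
  shows "x = 0"
proof -
  obtain c where "exitless_cycle_family G V D H sc v c" using exitless_cycle_family_at[OF v] .
  then interpret exitless_cycle_family G V D H sc v c .
  obtain M :: "('e list \<times> 'v) set" and X Y where XY: "finite M"
    "\<forall>i\<in>M. X i \<in> A \<and> X i * V v = X i \<and> Y i \<in> A" "x = (\<Sum>i\<in>M. X i * (V v * (Y i * x)))"
    using factor_through[OF v x] .
  have "V v * (Y i * x) = 0" if i: "i \<in> M" for i
  proof -
    have "V v * ((Y i * x) * V v) \<in> corner_at v" using XY(2)[rule_format, OF i] x(1) A_mult vv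
      by (intro corner_atI) auto
    then have "V v * (Y i * x) \<in> corner_at v" by (simp add: mult.assoc x(2))
    moreover have "V v * (Y i * x) * g = 0" by (simp add: mult.assoc xg)
    ultimately show ?thesis using corner_domain g by blast
  qed
  then have "(\<Sum>i\<in>M. X i * (V v * (Y i * x))) = 0" by simp
  then show ?thesis using XY(3) by simp
qed

text \<open>
  The elements \<open>V v * (a * b0)\<close> form an ideal of the corner at \<open>v\<close>, which is a principal ideal
  domain. Dividing \<open>b0\<close> by a generator yields an element \<open>b\<close> with left inverse.
\<close>

lemma vertex_below_idempotent_Pc:
  assumes v: "v \<in> Pc" and e: "e \<in> A" "e * e = e" and y: "y \<in> A" "e * y * V v \<noteq> 0"
  obtains a b where "a \<in> A" "b \<in> A" "V v * a = a" "a * e = a" "e * b = b" "b * V v = b"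
    "a * b = V v"
proof -
  obtain c where "exitless_cycle_family G V D H sc v c" using exitless_cycle_family_at[OF v] .
  then interpret exitless_cycle_family G V D H sc v c .
  define b0 where "b0 = e * y * V v"
  have b0: "b0 \<in> A" "b0 * V v = b0" "e * b0 = b0" "b0 \<noteq> 0"
    using A_mult A_V vv e y by (auto simp: b0_def mult.assoc V_idem simp flip: mult.assoc[of e e])
  define J where "J = (\<lambda>a. V v * (a * b0)) ` A"
  have JI: "V v * (a * b0) \<in> corner_at v" if "a \<in> A" for a
    using corner_atI[OF vv, of "a * b0"] A_mult[OF that b0(1)] b0(2) by (simp add: mult.assoc)
  have "submod (*) (corner_at v) (corner_at v) J"
    unfolding submod_def
  proof (intro conjI ballI)
    show "J \<subseteq> corner_at v" using JI by (auto simp: J_def)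
    show "addsub J" unfolding J_def
      by (rule addsub_image[OF A_addsub]) (simp add: distrib_left distrib_right)
    fix d x assume d: "d \<in> corner_at v" and "x \<in> J"
    then obtain a where a: "a \<in> A" "x = V v * (a * b0)" by (auto simp: J_def)
    have "d * x = V v * ((d * a) * b0)" using d
      by (auto simp: a corner_at_def simp flip: mult.assoc)
    moreover have "d * a \<in> A" using d a A_mult by (auto simp: corner_at_def)
    ultimately show "d * x \<in> J" by (auto simp: J_def)
  qed
  then obtain g where g: "g \<in> J" "\<And>x. x \<in> J \<Longrightarrow> \<exists>d\<in>corner_at v. x = d * g" using corner_principal
    by metis
  then obtain a0 where a0: "a0 \<in> A" "g = V v * (a0 * b0)" by (auto simp: J_def)
  have gc: "g \<in> corner_at v" using a0 JI by simp
  obtain M :: "('e list \<times> 'v) set" and X Y where XY: "finite M"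
    "\<forall>i\<in>M. X i \<in> A \<and> X i * V v = X i \<and> Y i \<in> A" "b0 = (\<Sum>i\<in>M. X i * (V v * (Y i * b0)))"
    using factor_through[OF v b0(1,2)] .
  have "\<forall>i\<in>M. \<exists>d. d \<in> corner_at v \<and> V v * (Y i * b0) = d * g" using g(2) XY(2) by (auto simp: J_def)
  then obtain d where d: "\<forall>i\<in>M. d i \<in> corner_at v \<and> V v * (Y i * b0) = d i * g"
    unfolding bchoice_iff by blast
  \<comment> \<open>\<open>b\<close> is the quotient of \<open>b0\<close> by \<open>g\<close>: the
    summands of \<open>b0\<close> contain the members \<open>V v * (Y i * b0)\<close> of
    \<open>J\<close>, and \<open>g\<close> is divided out of each.\<close>
  define b where "b = (\<Sum>i\<in>M. X i * d i)"
  have "b * g = (\<Sum>i\<in>M. X i * (V v * (Y i * b0)))"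
    unfolding b_def sum_distrib_right using d by (intro sum.cong refl) (auto simp: mult.assoc)
  then have bg: "b * g = b0" using XY(3) by (rule trans[OF _ sym])
  have bA: "b \<in> A" "b * V v = b"
  proof -
    show "b \<in> A" unfolding b_def using XY(2) d
      by (intro addsub_sum A_addsub A_mult) (auto simp: corner_at_def)
    have "X i * d i * V v = X i * d i" if "i \<in> M" for i using d that
      by (auto simp: corner_at_def mult.assoc)
    then show "b * V v = b" unfolding b_def sum_distrib_right by (intro sum.cong) auto
  qed
  have g0: "g \<noteq> 0" using bg b0(4) by auto
  \<comment> \<open>Both this and \<open>ab\<close> are clear after multiplication by
    \<open>g\<close> from the right; torsion-freeness cancels \<open>g\<close>.\<close>
  have eb: "e * b = b"
  proof -
    have "(e * b - b) * g = 0" using bg b0(3) by (simp add: left_diff_distrib mult.assoc)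
    moreover have "e * b - b \<in> A" using A_mult e(1) bA(1) A_addsub addsub_diff by blast
    moreover have "(e * b - b) * V v = e * b - b" using bA(2)
      by (simp add: left_diff_distrib mult.assoc)
    ultimately have "e * b - b = 0" using corner_torsion_free[OF v _ _ gc g0] by blast
    then show ?thesis by simp
  qed
  have ab: "V v * (a0 * b) = V v"
  proof -
    have gv: "V v * g = g" using gc by (simp add: corner_at_def)
    have "V v * (a0 * b) * g = g" using a0(2) bg by (simp add: mult.assoc)
    then have "(V v * (a0 * b) - V v) * g = 0" by (simp add: left_diff_distrib gv)
    moreover have "V v * (a0 * b) - V v \<in> A" using A_mult A_V vv a0(1) bA(1) A_addsub addsub_diff
      by meson
    moreover have "(V v * (a0 * b) - V v) * V v = V v * (a0 * b) - V v"
      using bA(2) by (simp add: left_diff_distrib mult.assoc V_idem vv)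
    ultimately have "V v * (a0 * b) - V v = 0" using corner_torsion_free[OF v _ _ gc g0] by blast
    then show ?thesis by simp
  qed
  show ?thesis
  proof (rule that[of "V v * a0 * e" b])
    show "V v * a0 * e \<in> A" using A_mult A_V vv a0(1) e(1) by blast
    show "V v * (V v * a0 * e) = V v * a0 * e" by (simp add: mult.assoc V_idem' vv)
    show "V v * a0 * e * e = V v * a0 * e" by (simp add: mult.assoc e(2))
    show "V v * a0 * e * b = V v" using ab eb by (simp add: mult.assoc)
  qed (use bA eb in auto)
qed

text \<open>The outcome \<open>a * b = V v\<close> makes \<open>b * a\<close> an idempotent below
  \<open>e\<close> that is equivalent to a vertex. In the first case of \<open>reduction\<close> it
  is enough to pad the two factors with \<open>e\<close> and the vertex.\<close>

lemma vertex_below_idempotent: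
  assumes e: "e \<in> A" "e * e = e" "e \<noteq> 0"
  obtains a b v where "v \<in> verts G" "a \<in> A" "b \<in> A" "V v * a = a" "a * e = a" "e * b = b"
    "b * V v = b" "a * b = V v"
  using reduction[OF e(1,3)]
proof (elim disjE bexE)
  fix w y z assume w: "w \<in> verts G" "y \<in> A" "z \<in> A" "y * e * z = V w"
  show thesis
  proof (rule that[of w "V w * y * e" "e * z * V w"])
    show "V w * y * e \<in> A" "e * z * V w \<in> A" using A_mult A_V w e by blast+
    have "V w * y * e * (e * z * V w) = V w * (y * (e * e) * z) * V w" by (simp only: mult.assoc)
    then show "V w * y * e * (e * z * V w) = V w" using w e by (simp add: V_idem)
    show "V w * (V w * y * e) = V w * y * e" using w by (simp add: mult.assoc V_idem')
    show "V w * y * e * e = V w * y * e" by (simp add: mult.assoc e)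
    show "e * (e * z * V w) = e * z * V w" by (simp add: e flip: mult.assoc)
    show "e * z * V w * V w = e * z * V w" using w by (simp add: mult.assoc V_idem)
  qed (rule w)
next
  fix v y assume v: "v \<in> Pc" "y \<in> A" "e * y * V v \<noteq> 0"
  show thesis
    by (rule vertex_below_idempotent_Pc[OF v(1) e(1,2) v(2,3)], rule that) (use v Pc_verts in auto)
qed

text \<open>The corner at \<open>e\<close> contains a copy of the corner at some vertex of
  \<open>Pc\<close>, embedded by \<open>a\<close> and \<open>b\<close>. One plus the cycle is
  transported there, and an inverse \<open>y\<close> would come back as
  \<open>a * y * b\<close>.\<close>

lemma Ic_no_division:
  assumes e: "e \<in> Ic" "e * e = e" "e \<noteq> 0"
  obtains z where "z \<in> A" "e * z = z" "z * e = z" "z \<noteq> 0" "\<And>y. y \<in> A \<Longrightarrow> y * z \<noteq> e"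
proof -
  have eA: "e \<in> A" using e Ic_A by blast
  obtain M where M: "finite M" "M \<subseteq> entering" "e * unit_of M = e"
    using e(1) by (rule Ic_single_unit)
  have "(\<Sum>(m, w)\<in>M. e * mon m w m) \<noteq> 0" using M(3) e(3)
    by (simp add: unit_of_def sum_distrib_left case_prod_unfold)
  then obtain m w where mw: "(m, w) \<in> M" "e * mon m w m \<noteq> 0"
    by (metis (no_types, lifting) case_prod_conv old.prod.exhaust sum.neutral)
  then have "(m, w) \<in> entering" using M by blast
  then obtain u where w: "w \<in> Pc" "awalk u m w" by (auto simp: entering_def)
  have "e * (el m * V w) * V w \<noteq> 0"
  proof
    assume z: "e * (el m * V w) * V w = 0"
    have "e * mon m w m = e * (el m * V w) * V w * gl m"
      using w Pc_verts by (simp add: mon_def mult.assoc V_idem' subset_iff)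
    then show False using z mw(2) by simp
  qed
  then obtain a b where ab: "a \<in> A" "b \<in> A" "V w * a = a" "a * e = a" "e * b = b" "b * V w = b"
    "a * b = V w"
    using vertex_below_idempotent_Pc[OF w(1) eA e(2) A_elV[OF w(2)]] by metis
  obtain c where "exitless_cycle_family G V D H sc w c" using exitless_cycle_family_at[OF w(1)] .
  then interpret exitless_cycle_family G V D H sc w c .
  define d where "d = V w + el c * V w"
  have d: "d \<in> A" "V w * d = d" "d * V w = d"
    using phi_corner[of "[:1, 1:]"] by (auto simp: phi_pCons d_def corner_at_def sc_one vv)
  show ?thesis
  proof (rule that[of "b * d * a"])
    show "b * d * a \<in> A" using A_mult ab d by blast
    show "e * (b * d * a) = b * d * a" by (simp add: ab flip: mult.assoc)
    show "b * d * a * e = b * d * a" by (simp add: ab mult.assoc)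
    have adb: "a * (b * d * a) * b = d"
    proof -
      have "a * (b * d * a) * b = (a * b) * d * (a * b)" by (simp only: mult.assoc)
      then show ?thesis by (simp add: ab d)
    qed
    then show "b * d * a \<noteq> 0" using corner_nonzero by (auto simp: d_def)
    fix y assume y: "y \<in> A"
    show "y * (b * d * a) \<noteq> e"
    proof
      assume ye: "y * (b * d * a) = e"
      have "a * y * b * d = a * (y * (b * d * a)) * b"
        by (simp only: mult.assoc ab(7) d(3))
      also have "\<dots> = V w" unfolding ye using ab by simp
      finally have "a * y * b * d = V w" .
      moreover have "V w * (a * y * b) = a * y * b" "a * y * b * V w = a * y * b" using ab
        by (auto simp: mult.assoc simp flip: mult.assoc[of "V w"])
      then have "a * y * b \<in> corner_at w" using ab y A_mult by (simp add: corner_at_def)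
      ultimately show False using corner_nonunit unfolding d_def by blast
    qed
  qed
qed

section \<open>Chain conditions in the corners at local units\<close>

lemma acc_null: "U \<subseteq> {0} \<Longrightarrow> acc m B U"
proof -
  assume U: "U \<subseteq> {0}"
  have "J = {0}" if "submod m B U J" for J :: "'a set"
    using that U by (auto simp: submod_def addsub_def)
  then show ?thesis unfolding acc_def by metis
qed

lemma entering_connected:
  assumes i: "(m, w) \<in> entering" and j: "(m', w') \<in> entering"
    and x: "x \<in> A" "mon m w m * x = x" "x * mon m' w' m' = x" "x \<noteq> 0"
  obtains r where "awalk w r w'"
proof -
  obtain u u' where w: "w \<in> Pc" "awalk u m w" and w': "w' \<in> Pc" "awalk u' m' w'"
    using i j by (auto simp: entering_def)
  have ww: "w \<in> verts G" "w' \<in> verts G" using w w' Pc_verts by auto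
  have xA: "V w * gl m * x * (el m' * V w') \<in> A" using A_mult A_Vgl[OF w(2)] A_elV[OF w'(2)] x(1)
    by blast
  have "el m * (V w * (V w * gl m * x * (el m' * V w') * V w')) * gl m' =
    mon m w m * x * mon m' w' m'"
    by (simp add: mon_def mult.assoc V_idem' ww)
  also have "\<dots> \<noteq> 0" using x by simp
  finally have "V w * (V w * gl m * x * (el m' * V w') * V w') \<noteq> 0" by auto
  then show ?thesis using connected_Pc[OF w(1) w'(1) xA] that by blast
qed

text \<open>
  The Peirce components of the corner at a local unit embed into the corner at a vertex,
  by transport along the entering paths and a connecting path inside the cycle.
\<close>

lemma acc_component:
  assumes i: "(m, w) \<in> entering" and j: "(m', w') \<in> entering" and B: "B \<subseteq> A"
    "\<And>b. b \<in> corner_at w \<Longrightarrow> el m * (b * gl m) \<in> B"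
  shows "acc (*) {x \<in> B. mon m w m * x = x \<and> x * mon m w m = x} {x \<in> B. mon m w m * x = x \<and>
    x * mon m' w' m' = x}"
    (is "acc _ ?B ?U")
    and "acc (\<lambda>x y. y * x) {x \<in> B. mon m w m * x = x \<and> x * mon m w m = x} {x \<in> B. x * mon m w m =
      x \<and> mon m' w' m' * x = x}"
    (is "acc _ _ ?U'")
proof -
  obtain u u' where w: "w \<in> Pc" "awalk u m w" and w': "w' \<in> Pc" "awalk u' m' w'"
    using i j by (auto simp: entering_def)
  have ww: "w \<in> verts G" "w' \<in> verts G" using w w' Pc_verts by auto
  obtain c where "exitless_cycle_family G V D H sc w c" using exitless_cycle_family_at[OF w(1)] .
  then interpret exitless_cycle_family G V D H sc w c .
  have b: "el m * (b * gl m) \<in> ?B" if "b \<in> corner_at w" for b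
  proof -
    have bb: "V w * b = b" "b * V w = b" using that by (auto simp: corner_at_def)
    have "mon m w m * (el m * ((V w * b) * gl m)) = el m * (V w * (gl m * (el m * (V w * (b * gl
      m)))))"
      by (simp only: mon_def mult.assoc)
    also have "\<dots> = el m * ((V w * b) * gl m)" unfolding entering_self(2)[OF i]
      by (simp only: mult.assoc)
    finally have "mon m w m * (el m * (b * gl m)) = el m * (b * gl m)" unfolding bb .
    moreover have "el m * ((b * V w) * gl m) * mon m w m = el m * (b * (V w * (gl m * (el m * (V w *
      gl m)))))"
      by (simp only: mon_def mult.assoc)
    then have "el m * ((b * V w) * gl m) * mon m w m = el m * ((b * V w) * gl m)"
      unfolding entering_self(2)[OF i] by (simp only: mult.assoc)
    then have "el m * (b * gl m) * mon m w m = el m * (b * gl m)" unfolding bb .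
    ultimately show ?thesis using B(2)[OF that] by simp
  qed
  show "acc (*) ?B ?U"
  \<comment> \<open>If no path joins the vertices the component is zero: a non-zero element yields a
    path from \<open>w\<close> to \<open>w'\<close>, which can be reversed inside the cycle.\<close>
  proof (cases "\<exists>r. awalk w' r w")
    case False
    have "x = 0" if xU: "x \<in> ?U" for x
    proof (rule ccontr)
      assume "x \<noteq> 0"
      then obtain r where "awalk w r w'" using entering_connected[OF i j, of x] xU B(1) by auto
      then show False using False Pc_return w(1) by blast
    qed
    then show ?thesis by (intro acc_null) blast
  next
    case True
    then obtain r where r: "awalk w' r w" by blast
    \<comment> \<open>\<open>f\<close> removes the entering path \<open>m\<close> on the left and
      appends \<open>m'\<close> and the connecting path \<open>r\<close> on the right;
      \<open>f'\<close> undoes this, which shows injectivity on the component.\<close>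
    define f where "f x = V w * (gl m * (x * (el m' * (el r * V w))))" for x
    define f' where "f' y = el m * (y * (V w * (gl r * gl m')))" for y
    have f'f: "f' (f x) = mon m w m * x * mon m' w' m'" for x
      unfolding f_def f'_def mon_def using Pc_el_gl'[OF r w'(1)]
      by (simp add: mult.assoc V_idem' ww)
    show ?thesis
    proof (rule acc_embed[OF acc_corner])
      fix x assume x: "x \<in> ?U"
      have "V w * gl m * x * (el (m' @ r) * V w) \<in> A"
        using x B(1) A_mult A_Vgl[OF w(2)] A_elV[OF awalk_appendI[OF w'(2) r]] by blast
      then show "f x \<in> corner_at w" by (simp add: f_def corner_at_def mult.assoc V_idem V_idem' ww)
    next
      show "inj_on f ?U"
      proof
        fix x y assume xy: "x \<in> ?U" "y \<in> ?U" "f x = f y"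
        then have "mon m w m * x * mon m' w' m' = mon m w m * y * mon m' w' m'" using f'f by metis
        then show "x = y" using xy by simp
      qed
    next
      show "f (x + y) = f x + f y" for x y by (simp add: f_def distrib_left distrib_right)
    next
      fix d assume d: "d \<in> corner_at w"
      have "f ((el m * (d * gl m)) * x) = d * f x" for x
      proof -
        have dd: "V w * d = d" "d * V w = d" using d by (auto simp: corner_at_def)
        have "f ((el m * ((V w * d) * gl m)) * x) = V w * (gl m * (el m * (V w * (d * (gl m * (x *
          (el m' * (el r * V w))))))))"
          by (simp only: f_def mult.assoc)
        also have "\<dots> = V w * d * (gl m * (x * (el m' * (el r * V w))))"
          unfolding entering_self(2)[OF i] by (simp only: mult.assoc)
        also have "\<dots> = d * V w * (gl m * (x * (el m' * (el r * V w))))" unfolding dd ..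
        finally show ?thesis unfolding dd by (simp add: f_def dd(2) flip: mult.assoc[of d "V w"])
      qed
      then show "\<exists>b\<in>?B. \<forall>x\<in>?U. f (b * x) = d * f x" using b[OF d] by blast
    qed
  qed
  show "acc (\<lambda>x y. y * x) ?B ?U'"
  proof (cases "\<exists>r. awalk w r w'")
    case False
    have "x = 0" if xU: "x \<in> ?U'" for x
    proof (rule ccontr)
      assume "x \<noteq> 0"
      then obtain r where "awalk w' r w" using entering_connected[OF j i, of x] xU B(1) by auto
      then show False using False Pc_return w'(1) by blast
    qed
    then show ?thesis by (intro acc_null) blast
  next
    case True
    then obtain s where s: "awalk w s w'" by blast
    \<comment> \<open>For the opposite multiplication the component has \<open>m'\<close> on the
      left. There \<open>gl r\<close> turns the vertex \<open>w'\<close> into \<open>w\<close>, so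
      that the target is again the corner at \<open>w\<close>.\<close>
    obtain r where r: "awalk w' r w" using Pc_return[OF s w(1)] .
    define f where "f x = V w * (gl r * (gl m' * (x * (el m * V w))))" for x
    define f' where "f' y = el m' * (el r * (V w * (y * (V w * gl m))))" for y
    have f'f: "f' (f x) = mon m' w' m' * x * mon m w m" for x
      unfolding f_def f'_def mon_def using Pc_el_gl'[OF r w'(1)]
      by (simp add: mult.assoc V_idem' ww)
    show ?thesis
    proof (rule acc_embed[OF acc_corner_opp])
      fix x assume x: "x \<in> ?U'"
      have "V w * gl (m' @ r) * x * (el m * V w) \<in> A"
        using x B(1) A_mult A_elV[OF w(2)] A_Vgl[OF awalk_appendI[OF w'(2) r]] by blast
      then show "f x \<in> corner_at w" by (simp add: f_def corner_at_def mult.assoc V_idem V_idem' ww)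
    next
      show "inj_on f ?U'"
      proof
        fix x y assume xy: "x \<in> ?U'" "y \<in> ?U'" "f x = f y"
        then have "mon m' w' m' * x * mon m w m = mon m' w' m' * y * mon m w m" using f'f by metis
        then show "x = y" using xy by simp
      qed
    next
      show "f (x + y) = f x + f y" for x y by (simp add: f_def distrib_left distrib_right)
    next
      fix d assume d: "d \<in> corner_at w"
      have "f (x * (el m * (d * gl m))) = f x * d" for x
      proof -
        have dd: "V w * d = d" "d * V w = d" using d by (auto simp: corner_at_def)
        have "f (x * (el m * ((d * V w) * gl m))) = V w * (gl r * (gl m' * (x * (el m * (d * (V w *
          (gl m * (el m * V w))))))))"
          by (simp only: f_def mult.assoc)
        also have "\<dots> = V w * (gl r * (gl m' * (x * (el m * (d * V w)))))"
          unfolding entering_self(1)[OF i] ..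
        also have "\<dots> = V w * (gl r * (gl m' * (x * (el m * (V w * d)))))" unfolding dd ..
        finally show ?thesis unfolding dd(2) by (simp only: f_def mult.assoc)
      qed
      then show "\<exists>b\<in>?B. \<forall>x\<in>?U'. f (x * b) = f x * d" using b[OF d] by blast
    qed
  qed
qed

lemma Ic_locally_noetherian:
  assumes X: "finite X" "X \<subseteq> Ic"
  obtains e where "e \<in> Ic" "e * e = e" "X \<subseteq> {x \<in> Ic. e * x = x \<and> x * e = x}"
    "acc (*) {x \<in> Ic. e * x = x \<and> x * e = x} {x \<in> Ic. e * x = x \<and> x * e = x}"
    "acc (\<lambda>x y. y * x) {x \<in> Ic. e * x = x \<and> x * e = x} {x \<in> Ic. e * x = x \<and> x * e = x}"
proof -
  obtain M where M: "finite M" "M \<subseteq> entering" "\<And>x. x \<in> X \<Longrightarrow> unit_of M * x = x \<and> x * unit_of M = x"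
    using Ic_common_unit[OF X] by metis
  define e where "e = unit_of M"
  define B where "B = {x \<in> Ic. e * x = x \<and> x * e = x}"
  have ee: "e * e = e" unfolding e_def by (rule unit_of_idem[OF M(1,2)])
  have eI: "e \<in> Ic" unfolding e_def by (rule unit_of_Ic[OF M(2)])
  define E where "E i = mon (fst i) (snd i) (fst i)" for i
  have Esum: "sum E M = e" by (simp add: e_def unit_of_def E_def case_prod_unfold)
  have iE: "(fst i, snd i) \<in> entering" if "i \<in> M" for i using that M(2) by auto
  have EB: "E i \<in> B" if i: "i \<in> M" for i
  proof -
    have "(fst i, snd i) \<in> M" using i by simp
    from unit_of_el(1)[OF M(1,2) this, of "gl (fst i)"] unit_of_el(2)[OF M(1,2) this, of
      "el (fst i)"]
    show ?thesis using entering_mon_Ic[OF iE[OF i]] by (simp add: B_def e_def E_def mon_def)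
  qed
  have Emult: "E i * E j = (if i = j then E i else 0)" if "i \<in> M" "j \<in> M" for i j
    using entering_mon_mult[OF iE[OF that(1)] iE[OF that(2)]] by (auto simp: E_def prod_eq_iff)
  have Badd: "addsub B" using Ic_addsub by (auto simp: B_def addsub_def distrib_left distrib_right)
  have BA: "B \<subseteq> A" using Ic_A by (auto simp: B_def)
  have Bmult: "x * y \<in> B" if "x \<in> B" "y \<in> B" for x y
  proof -
    have "x \<in> A" using that BA by blast
    then have "x * y \<in> Ic" using that Ic_ideal(1) by (auto simp: B_def)
    then show ?thesis using that by (simp add: B_def mult.assoc) (simp add: flip: mult.assoc)
  qed
  \<comment> \<open>This is the copy of the corner at the vertex inside the diagonal component, by
    which \<open>acc_component\<close> imitates the action.\<close>
  have comp: "el (fst i) * (b * gl (fst i)) \<in> B" if i: "i \<in> M" and b: "b \<in> corner_at (snd i)"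
    for i b
  proof -
    obtain u where w: "snd i \<in> Pc" "awalk u (fst i) (snd i)" using iE[OF i]
      by (auto simp: entering_def)
    have bb: "b \<in> A" "V (snd i) * b = b" "b * V (snd i) = b" using b by (auto simp: corner_at_def)
    have "b \<in> Ic" using Ic_ideal(1)[OF Ic_V[OF w(1)] bb(1)] bb(3) by simp
    then have "el (fst i) * V (snd i) * b * (V (snd i) * gl (fst i)) \<in> Ic"
      using A_elV[OF w(2)] A_Vgl[OF w(2)] Ic_ideal by blast
    also have "el (fst i) * V (snd i) * b * (V (snd i) * gl (fst i)) =
        el (fst i) * ((V (snd i) * b * V (snd i)) * gl (fst i))" by (simp only: mult.assoc)
    finally have "el (fst i) * (b * gl (fst i)) \<in> Ic" by (simp add: bb)
    moreover have iM: "(fst i, snd i) \<in> M" using i by simp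
    have "e * (el (fst i) * (b * gl (fst i))) = el (fst i) * (b * gl (fst i))"
      using unit_of_el(1)[OF M(1,2) iM, of "b * gl (fst i)"]
      unfolding e_def[symmetric] mult.assoc[of "V (snd i)", symmetric] bb .
    moreover have "el (fst i) * (b * gl (fst i)) * e = el (fst i) * (b * gl (fst i))"
    proof -
      have "el (fst i) * b * (V (snd i) * gl (fst i)) = el (fst i) * (b * V (snd i) * gl (fst i))"
        by (simp only: mult.assoc)
      then have "el (fst i) * b * (V (snd i) * gl (fst i)) = el (fst i) * (b * gl (fst i))"
        by (simp only: bb)
      then show ?thesis using unit_of_el(2)[OF M(1,2) iM, of "el (fst i) * b"] unfolding e_def
        by simp
    qed
    ultimately show ?thesis by (simp add: B_def)
  qed
  have "acc (*) B B"
  proof (rule mult.acc_Peirce[OF M(1) Badd Bmult, of E])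
    fix i j assume ij: "i \<in> M" "j \<in> M"
    show "acc (*) {x \<in> B. E i * x = x \<and> x * E i = x} {x \<in> B. E i * x = x \<and> x * E j = x}"
      unfolding E_def using acc_component(1)[OF iE[OF ij(1)] iE[OF ij(2)] BA] comp[OF ij(1)]
        by blast
  qed (use EB in \<open>auto simp: Emult Esum B_def\<close>)
  moreover have "acc (\<lambda>x y. y * x) B B"
  proof (rule opp_mult.acc_Peirce[OF M(1) Badd Bmult, of E])
    fix i j assume ij: "i \<in> M" "j \<in> M"
    have "acc (\<lambda>x y. y * x) {x \<in> B. E i * x = x \<and> x * E i = x} {x \<in> B. x * E i = x \<and> E j * x = x}"
      unfolding E_def using acc_component(2)[OF iE[OF ij(1)] iE[OF ij(2)] BA] comp[OF ij(1)]
        by blast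
    then show "acc (\<lambda>x y. y * x) {x \<in> B. x * E i = x \<and> E i * x = x} {x \<in> B. x * E i = x \<and> E j * x =
      x}"
      by (simp add: conj_commute)
  qed (use EB in \<open>auto simp: Emult Esum B_def\<close>)
  ultimately show ?thesis using that[of e] ee eI M(3) X(2) unfolding B_def e_def[symmetric] by blast
qed

section \<open>Maximality\<close>

definition orthogonal_below :: "'r \<Rightarrow> (nat \<Rightarrow> 'r) \<Rightarrow> bool" where
  "orthogonal_below e f \<longleftrightarrow>
    (\<forall>n. f n \<in> A \<and> e * f n = f n \<and> f n * e = f n \<and> f n * f n = f n \<and> f n \<noteq> 0) \<and>
    (\<forall>i j. i \<noteq> j \<longrightarrow> f i * f j = 0)"

lemma mon_below: "awalk w p x \<Longrightarrow> V w * mon p x p = mon p x p \<and> mon p x p * V w = mon p x p"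
  by (simp add: V_mon mon_V awalk_hd_in_verts)

lemma mon_idem: "awalk w p x \<Longrightarrow> mon p x p * mon p x p = mon p x p"
proof -
  assume p: "awalk w p x"
  then have "x \<in> verts G" by (rule awalk_last_in_verts)
  then show ?thesis using gl_el'[OF p, of "V x * gl p"] by (simp add: mon_def mult.assoc V_idem')
qed

lemma mon_nonzero: "awalk w p x \<Longrightarrow> mon p x p \<noteq> 0"
proof
  assume p: "awalk w p x" and z: "mon p x p = 0"
  have x: "x \<in> verts G" using p by (rule awalk_last_in_verts)
  have "V x * (gl p * (mon p x p * (el p * V x))) = V x"
    using gl_el'[OF p, of "V x * (gl p * (el p * V x))"] gl_el'[OF p, of "V x"] x
    by (simp add: mon_def mult.assoc V_idem')  (simp add: V_idem)
  then show False using z x V_nonzero by simp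
qed

lemma mon_orthogonal:
  assumes "awalk w p x" "awalk w q y" "\<nexists>s. q = p @ s" "\<nexists>s. p = q @ s"
  shows "mon p x p * mon q y q = 0"
proof -
  have "mon p x p * mon q y q = el p * V x * (gl p * el q) * (V y * gl q)"
    by (simp add: mon_def mult.assoc)
  then show ?thesis using gl_el_incomparable[OF assms] by simp
qed

text \<open>Pairwise incomparable paths with a common start have orthogonal projections; the
  sequences drawn from the graph all have this form.\<close>

lemma orthogonal_below_paths:
  assumes w: "\<And>n. awalk w (Q n) (x n)" and Q: "\<And>i j s. i \<noteq> j \<Longrightarrow> Q j \<noteq> Q i @ s"
  shows "orthogonal_below (V w) (\<lambda>n. mon (Q n) (x n) (Q n))"
  unfolding orthogonal_below_def
proof (intro conjI allI impI)
  fix n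
  show "mon (Q n) (x n) (Q n) \<in> A"
    unfolding A_def using w[of n] by (intro span_monI) (auto intro: awalk_last_in_verts)
  show "V w * mon (Q n) (x n) (Q n) = mon (Q n) (x n) (Q n)"
    "mon (Q n) (x n) (Q n) * V w = mon (Q n) (x n) (Q n)" using mon_below[OF w] by auto
  show "mon (Q n) (x n) (Q n) * mon (Q n) (x n) (Q n) = mon (Q n) (x n) (Q n)"
    by (rule mon_idem[OF w])
  show "mon (Q n) (x n) (Q n) \<noteq> 0" by (rule mon_nonzero[OF w])
next
  fix i j :: nat assume "i \<noteq> j"
  then show "mon (Q i) (x i) (Q i) * mon (Q j) (x j) (Q j) = 0"
    using Q[of i j] Q[of j i] by (intro mon_orthogonal[OF w w]) auto
qed

text \<open>\<open>J_local\<close> keeps of the noetherian condition what the left and the right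
  version share: a local unit below which no infinite orthogonal sequence exists.
  \<open>J_division\<close> is the absence of minimal idempotents, spelled out as a non-zero element
  without inverse in each corner.\<close>

context
  fixes J :: "'r set"
  assumes JA: "J \<subseteq> A" and J_add: "addsub J"
    and J_left: "\<And>a x. a \<in> A \<Longrightarrow> x \<in> J \<Longrightarrow> a * x \<in> J" and J_right: "\<And>a x. a \<in> A \<Longrightarrow> x \<in> J \<Longrightarrow> x * a \<in> J"
    and J_local: "\<And>x. x \<in> J \<Longrightarrow>
      \<exists>e\<in>J. e * e = e \<and> e * x = x \<and> x * e = x \<and> (\<nexists>f. orthogonal_below e f)"
    and J_division: "\<And>e. e \<in> J \<Longrightarrow> e * e = e \<Longrightarrow> e \<noteq> 0 \<Longrightarrow>
      \<exists>x\<in>A. e * x = x \<and> x * e = x \<and> x \<noteq> 0 \<and> (\<forall>y\<in>A. e * y = y \<longrightarrow> y * e = y \<longrightarrow> x * y = e \<longrightarrow> y * x \<noteq> e)"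
begin

text \<open>What lies below \<open>x\<close> also lies below a local unit of
  \<open>x\<close>.\<close>

lemma J_no_orthogonal:
  assumes "x \<in> J"
  shows "\<not> orthogonal_below x f"
proof
  assume f: "orthogonal_below x f"
  obtain e where e: "e \<in> J" "e * x = x" "x * e = x" "\<nexists>f. orthogonal_below e f"
    using J_local[OF assms] by blast
  have "e * f n = f n \<and> f n * e = f n" for n
  proof -
    have "x * f n = f n" "f n * x = f n" using f by (auto simp: orthogonal_below_def)
    then have "e * f n = (e * x) * f n" "f n * e = f n * (x * e)"
      by (simp_all add: mult.assoc) (simp flip: mult.assoc)
    then show ?thesis using \<open>x * f n = f n\<close> \<open>f n * x = f n\<close> e by simp
  qed
  then have "orthogonal_below e f" using f by (simp add: orthogonal_below_def)
  then show False using e by blast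
qed

lemma J_walk: "V w \<in> J \<Longrightarrow> awalk w p x \<Longrightarrow> V x \<in> J"
proof -
  assume w: "V w \<in> J" and p: "awalk w p x"
  have x: "x \<in> verts G" using p by (rule awalk_last_in_verts)
  have "V x * gl p * V w * (el p * V x) \<in> J"
    using w A_Vgl[OF p] A_elV[OF p] J_left J_right by blast
  moreover have "V x * gl p * V w * (el p * V x) = V x"
    using gl_el'[OF p, of "V x"] x by (simp add: mult.assoc gl_V'[OF p] V_idem' V_idem)
  ultimately show ?thesis by simp
qed

text \<open>The edges at an infinite emitter would be infinitely many incomparable paths of length
  1.\<close>

lemma J_finite_out:
  assumes "V w \<in> J"
  shows "finite (out_arcs G w)"
proof (rule ccontr)
  assume "infinite (out_arcs G w)"
  then obtain g :: "nat \<Rightarrow> 'e" where g: "inj g" "range g \<subseteq> out_arcs G w"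
    by (metis infinite_countable_subset)
  have gn: "awalk w [g n] (head G (g n))" for n
  proof -
    have "g n \<in> out_arcs G w" using g(2) by blast
    then show ?thesis by (auto simp: awalk_simps)
  qed
  have "orthogonal_below (V w) (\<lambda>n. mon [g n] (head G (g n)) [g n])"
    using g(1) by (intro orthogonal_below_paths gn) (auto simp: inj_def)
  then show False using J_no_orthogonal[OF assms] by blast
qed

lemma V_Ic_of_out:
  assumes "finite (out_arcs G w)" "out_arcs G w \<noteq> {}" "w \<in> verts G" "\<And>e. e \<in> out_arcs G w \<Longrightarrow>
    V (head G e) \<in> Ic"
  shows "V w \<in> Ic"
proof -
  have "D e * H e \<in> Ic" if e: "e \<in> out_arcs G w" for e
  proof -
    have ea: "e \<in> arcs G" using e by auto
    have "V (head G e) * H e \<in> A" using A_Vgl[of "tail G e" "[e]" "head G e"] ea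
      by (simp add: awalk_simps)
    then have "D e * V (head G e) * (V (head G e) * H e) \<in> Ic"
      using Ic_ideal assms(4)[OF e] A_D[OF ea] by blast
    then show ?thesis using D_V[OF ea] V_H[OF ea] by simp
  qed
  then have "(\<Sum>e\<in>out_arcs G w. D e * H e) \<in> Ic" by (intro addsub_sum Ic_addsub)
  moreover have "regular_vertex G w" using assms by (auto simp: regular_vertex_def)
  ultimately show ?thesis using V_sum by simp
qed

text \<open>
  If no path from \<open>w\<close> branches off to another vertex outside \<open>Ic\<close>, then the paths from \<open>w\<close> form a
  line without exits, finite or infinite, and \<open>V w\<close> is a minimal idempotent.
\<close>

lemma J_branch:
  assumes wJ: "V w \<in> J" and wI: "V w \<notin> Ic" and w: "w \<in> verts G"
  shows "\<exists>\<alpha> x \<beta> y. awalk w \<alpha> x \<and> awalk w \<beta> y \<and> (\<nexists>s. \<beta> = \<alpha> @ s) \<and> (\<nexists>s. \<alpha> = \<beta> @ s) \<and> V y \<notin> Ic"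
proof (rule ccontr)
  assume no: "\<not> ?thesis"
  have out: "V y \<notin> Ic \<and> (\<forall>e\<in>out_arcs G y. out_arcs G y = {e} \<and> V (head G e) \<notin> Ic)"
    if b: "awalk w \<beta> y" "V y \<notin> Ic" for \<beta> y
  proof (rule conjI[OF b(2)], rule ballI)
    fix e assume e: "e \<in> out_arcs G y"
    have yv: "y \<in> verts G" using b by blast
    have fin: "finite (out_arcs G y)" using J_finite_out J_walk[OF wJ b(1)] by blast
    have walk: "awalk w (\<beta> @ [f]) (head G f)" if "f \<in> out_arcs G y" for f
      using awalk_appendI[OF b(1), of "[f]"] that
        by (auto simp: awalk_simps simp del: awalk_append_iff)
    \<comment> \<open>With two edges at \<open>y\<close>, each edge branches off from another one,
      so by \<open>no\<close> the vertex at its head lies in the ideal; the finite sum over the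
      edges then puts \<open>V y\<close> there, too.\<close>
    have single: "out_arcs G y = {e}"
    proof (rule ccontr)
      assume ne: "out_arcs G y \<noteq> {e}"
      have "V (head G f) \<in> Ic" if f: "f \<in> out_arcs G y" for f
      proof -
        obtain g where g: "g \<in> out_arcs G y" "g \<noteq> f" using ne e by blast
        have "(\<nexists>s. \<beta> @ [f] = (\<beta> @ [g]) @ s) \<and> (\<nexists>s. \<beta> @ [g] = (\<beta> @ [f]) @ s)" using g(2) by auto
        then show ?thesis using no walk[OF f] walk[OF g(1)] by blast
      qed
      then show False using V_Ic_of_out[OF fin _ yv] e b(2) by blast
    qed
    then have "V (head G e) \<notin> Ic" using V_Ic_of_out[OF fin _ yv] b(2) by auto
    with single show "out_arcs G y = {e} \<and> V (head G e) \<notin> Ic" ..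
  qed
  have notI: "awalk w \<beta> y \<Longrightarrow> V y \<notin> Ic" for \<beta> y
  proof (induction \<beta> arbitrary: y rule: rev_induct)
    case Nil
    then show ?case using wI by (simp add: awalk_Nil_iff)
  next
    case (snoc e \<beta>)
    then have e: "awalk w \<beta> (tail G e)" "e \<in> arcs G" "head G e = y"
      by (auto simp: awalk_simps awlast_of_awalk)
    then have "e \<in> out_arcs G (tail G e)" by simp
    then show ?case using out[OF e(1) snoc.IH[OF e(1)]] e(3) by blast
  qed
  have single: "out_arcs G y = {e}" if "awalk w \<beta> y" "e \<in> out_arcs G y" for \<beta> y e
    using out[OF that(1) notI[OF that(1)]] that(2) by blast
  \<comment> \<open>Every edge met is the only one at its tail, where the vertex is therefore
    \<open>D e * H e\<close>; so the projection along any path telescopes to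
    \<open>V w\<close>.\<close>
  have full: "awalk w \<beta> y \<Longrightarrow> mon \<beta> y \<beta> = V w" for \<beta> y
  proof (induction \<beta> arbitrary: y rule: rev_induct)
    case Nil
    then show ?case by (simp add: awalk_Nil_iff mon_def)
  next
    case (snoc e \<beta>)
    then have e: "awalk w \<beta> (tail G e)" "e \<in> arcs G" "head G e = y"
      by (auto simp: awalk_simps awlast_of_awalk)
    have te: "out_arcs G (tail G e) = {e}" using single[OF e(1)] e(2) by simp
    then have "V (tail G e) = D e * H e" using V_sum[of "tail G e"] e(2)
      by (simp add: regular_vertex_def)
    then have "mon (\<beta> @ [e]) y (\<beta> @ [e]) = mon \<beta> (tail G e) \<beta>"
      using D_V[OF e(2)] e(3) by (simp add: mon_def mult.assoc) (simp flip: mult.assoc)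
    then show ?case using snoc.IH[OF e(1)] by simp
  qed
  have comparable: "(\<exists>s. \<beta> = \<alpha> @ s) \<or> (\<exists>s. \<alpha> = \<beta> @ s)" if "awalk w \<alpha> x" "awalk w \<beta> y" for \<alpha> \<beta> x y
    using no that notI by blast
  \<comment> \<open>A closed path would yield an exitless cycle, whose vertices lie in
    \<open>Ic\<close>. Without loops a path from \<open>w\<close> is determined by its end.\<close>
  have no_loop: "s = []" if wl: "awalk w \<alpha> y" "awalk y s y" for \<alpha> y s
  proof (rule ccontr)
    assume "s \<noteq> []"
    then obtain c where c: "awalk y c y" "c \<noteq> []" "distinct (map (tail G) c)"
      using cycle_through wl(2) by blast
    have "out_arcs G (tail G e) = {e}" if e: "e \<in> set c" for e
    proof -
      obtain c1 c2 where c12: "c = c1 @ e # c2" using e by (meson split_list)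
      then have "awalk y c1 (tail G e)" "e \<in> arcs G" using c(1) by (auto simp: awalk_Cons_iff)
      then show ?thesis using single[OF awalk_appendI[OF wl(1)]] by simp
    qed
    then have "exitless_cycle y c" using c by (auto simp: exitless_cycle_def)
    then have "V y \<in> Ic" using Ic_V exitless_cycle_Pc by blast
    then show False using notI wl(1) by blast
  qed
  have unique: "\<alpha> = \<beta>" if ab: "awalk w \<alpha> y" "awalk w \<beta> y" for \<alpha> \<beta> y
    using comparable[OF ab]
  proof (elim disjE exE)
    fix s assume s: "\<beta> = \<alpha> @ s"
    then have "awalk y s y" using ab by simp
    then show ?thesis using no_loop[OF ab(1)] s by simp
  next
    fix s assume s: "\<alpha> = \<beta> @ s"
    then have "awalk y s y" using ab by simp
    then show ?thesis using no_loop[OF ab(2)] s by simp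
  qed
  \<comment> \<open>By \<open>unique\<close> the two paths of a monomial in the corner agree, and by
    \<open>full\<close> it is then \<open>V w\<close>. So the corner is a copy of the field, which
    contradicts \<open>J_division\<close>.\<close>
  have scalar: "\<exists>k. V w * (x * V w) = sc k * V w" if "x \<in> A" for x
    using that unfolding A_def span_def
  proof (induction rule: aspan.induct)
    case zero
    show ?case by (rule exI[of _ 0]) simp
  next
    case (add s x)
    from add.hyps(1) obtain k p y q u u' where s: "s = sc k * mon p y q" "awalk u p y"
      "awalk u' q y" by blast
    from add.IH obtain l where l: "V w * (x * V w) = sc l * V w" by blast
    have "V w * (s * V w) = sc k * (V w * (mon p y q * V w))" using sc_V[OF w]
      by (simp add: s(1)) (simp flip: mult.assoc)
    also have "\<dots> = sc k * (if w = u \<and> w = u' then V w else 0)"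
      using s w unique[of p y q] full[of p y] by (auto simp: mon_V V_mon V_idem)
    finally have "V w * (s * V w) = sc (if w = u \<and> w = u' then k else 0) * V w"
      by (cases "w = u"; cases "w = u'") simp_all
    then show ?case using l
      by (intro exI[of _ "(if w = u \<and> w = u' then k else 0) + l"])
        (simp only: distrib_left distrib_right sc_add)
  qed
  obtain x where x: "x \<in> A" "V w * x = x" "x * V w = x" "x \<noteq> 0"
    "\<forall>y\<in>A. V w * y = y \<longrightarrow> y * V w = y \<longrightarrow> x * y = V w \<longrightarrow> y * x \<noteq> V w"
    using J_division[OF wJ] V_idem[OF w] V_nonzero[OF w] by blast
  obtain k where k: "x = sc k * V w" using scalar[OF x(1)] x(2,3) by auto
  then have "k \<noteq> 0" using x(4) by auto
  define y where "y = sc (1 / k) * V w"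
  have mul: "sc a * V w * (sc b * V w) = sc (a * b) * V w" for a b
  proof -
    have "sc a * V w * (sc b * V w) = sc a * (V w * sc b) * V w" by (simp only: mult.assoc)
    also have "\<dots> = sc a * sc b * (V w * V w)" unfolding sc_V[OF w] by (simp only: mult.assoc)
    finally show ?thesis using V_idem[OF w] by (simp add: sc_mult)
  qed
  have "y \<in> A" unfolding y_def using A_sc A_V w by blast
  moreover have "V w * y = y" "y * V w = y"
    using mul[of 1 "1 / k"] mul[of "1 / k" 1] sc_one[OF w] by (auto simp: y_def)
  moreover have "x * y = V w" "y * x = V w" unfolding k y_def mul using \<open>k \<noteq> 0\<close> sc_one[OF w] by auto
  ultimately show False using x(5) by blast
qed

lemma J_vertex:
  assumes wJ: "V w \<in> J" and w: "w \<in> verts G"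
  shows "V w \<in> Ic"
proof (rule ccontr)
  assume wI: "V w \<notin> Ic"
  define bad where "bad y \<longleftrightarrow> y \<in> verts G \<and> V y \<in> J \<and> V y \<notin> Ic" for y
  \<comment> \<open>The tuple \<open>t\<close> bundles the two paths and their ends for a
    simultaneous choice; its last component is a bad vertex from which to continue.\<close>
  have "\<forall>z. \<exists>t. bad z \<longrightarrow> awalk z (fst t) (fst (snd t)) \<and>
    awalk z (fst (snd (snd t))) (snd (snd (snd t))) \<and>
    (\<nexists>s. fst (snd (snd t)) = fst t @ s) \<and> (\<nexists>s. fst t = fst (snd (snd t)) @ s) \<and>
      bad (snd (snd (snd t)))"
  proof
    fix z
    show "\<exists>t. bad z \<longrightarrow> awalk z (fst t) (fst (snd t)) \<and>
      awalk z (fst (snd (snd t))) (snd (snd (snd t))) \<and>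
    (\<nexists>s. fst (snd (snd t)) = fst t @ s) \<and> (\<nexists>s. fst t = fst (snd (snd t)) @ s) \<and>
      bad (snd (snd (snd t)))"
    proof (cases "bad z")
      case True
      then obtain \<alpha> x \<beta> y where t: "awalk z \<alpha> x" "awalk z \<beta> y" "\<nexists>s. \<beta> = \<alpha> @ s" "\<nexists>s. \<alpha> = \<beta> @ s"
        "V y \<notin> Ic"
        using J_branch unfolding bad_def by blast
      then have "bad y" using True J_walk by (auto simp: bad_def)
      then show ?thesis using t by (intro exI[of _ "(\<alpha>, x, \<beta>, y)"]) auto
    qed simp
  qed
  then obtain T where T: "\<forall>z. bad z \<longrightarrow> awalk z (fst (T z)) (fst (snd (T z))) \<and>
    awalk z (fst (snd (snd (T z)))) (snd (snd (snd (T z)))) \<and>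
    (\<nexists>s. fst (snd (snd (T z))) = fst (T z) @ s) \<and> (\<nexists>s. fst (T z) = fst (snd (snd (T z))) @ s) \<and>
    bad (snd (snd (snd (T z))))" by metis
  define a x b y where "a = (\<lambda>z. fst (T z))" and "x = (\<lambda>z. fst (snd (T z)))"
    and "b = (\<lambda>z. fst (snd (snd (T z))))" and "y = (\<lambda>z. snd (snd (snd (T z))))"
  have step: "awalk z (a z) (x z)" "awalk z (b z) (y z)" "\<nexists>s. b z = a z @ s" "\<nexists>s. a z = b z @ s"
    "bad (y z)"
    if "bad z" for z using T that by (auto simp: a_def x_def b_def y_def)
  define W where "W n = (y ^^ n) w" for n
  define P where "P = rec_nat [] (\<lambda>n p. p @ b (W n))"
  have P: "P 0 = []" "\<And>n. P (Suc n) = P n @ b (W n)" by (simp_all add: P_def)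
  have Wbad: "bad (W n)" for n
    by (induction n) (use wI wJ w step(5) in \<open>auto simp: W_def bad_def\<close>)
  have Pw: "awalk w (P n) (W n)" for n
  proof (induction n)
    case 0
    then show ?case using w by (simp add: P W_def awalk_Nil_iff)
  next
    case (Suc n)
    then show ?case using awalk_appendI[OF Suc step(2)[OF Wbad[of n]]]
      by (simp add: P W_def del: awalk_append_iff)
  qed
  have Pm: "\<exists>s. P m = P n @ b (W n) @ s" if "n < m" for n m
    using that by (induction m) (auto simp: P less_Suc_eq)
  \<comment> \<open>\<open>P n\<close> follows the branches \<open>b\<close> for \<open>n\<close>
    steps and \<open>Q n\<close> then leaves along \<open>a\<close>. A later \<open>Q m\<close>
    continues with \<open>b\<close> where \<open>Q n\<close> took the incomparable
    \<open>a\<close>.\<close>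
  define Q where "Q n = P n @ a (W n)" for n
  have Qw: "awalk w (Q n) (x (W n))" for n
    unfolding Q_def using awalk_appendI[OF Pw step(1)[OF Wbad]] .
  have inc: "(\<nexists>s. Q m = Q n @ s) \<and> (\<nexists>s. Q n = Q m @ s)" if nm: "n < m" for n m
  proof -
    obtain s where s: "P m = P n @ b (W n) @ s" using Pm[OF nm] by blast
    have not: "\<nexists>s. b (W n) = a (W n) @ s" "\<nexists>s. a (W n) = b (W n) @ s" using step(3,4)[OF Wbad]
      by auto
    have "\<nexists>t. b (W n) @ s @ a (W m) = a (W n) @ t" using not
      by (auto simp: append_eq_append_conv2 eq_commute[of "a (W n)"])
    moreover have "\<nexists>t. a (W n) = (b (W n) @ s @ a (W m)) @ t" using not(2) by auto
    ultimately show ?thesis by (simp add: Q_def s)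
  qed
  have "Q j \<noteq> Q i @ s" if "i \<noteq> j" for i j s using that inc[of i j] inc[of j i]
    by (auto simp: neq_iff)
  then have "orthogonal_below (V w) (\<lambda>n. mon (Q n) (x (W n)) (Q n))"
    by (intro orthogonal_below_paths Qw)
  then show False using J_no_orthogonal[OF wJ] by blast
qed

text \<open>The vertex found below \<open>e\<close> lies in \<open>J\<close>, hence in
  \<open>Ic\<close> by \<open>J_vertex\<close>, and the idempotent \<open>b * a\<close> is a
  multiple of it.\<close>

lemma J_peel:
  assumes e: "e \<in> J" "e * e = e" "e \<noteq> 0"
  shows "\<exists>f. f \<in> Ic \<and> f \<in> J \<and> f \<noteq> 0 \<and> f * f = f \<and> e * f = f \<and> f * e = f"
proof -
  have eA: "e \<in> A" using e JA by blast
  obtain a b v where v: "v \<in> verts G" and ab: "a \<in> A" "b \<in> A" "V v * a = a" "a * e = a" "e * b = b"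
    "b * V v = b" "a * b = V v"
    using vertex_below_idempotent[OF eA e(2,3)] .
  have "a * e * b \<in> J" using J_left J_right e(1) ab by blast
  then have "V v \<in> J" using ab by simp
  then have vI: "V v \<in> Ic" by (rule J_vertex[OF _ v])
  have f: "b * V v * a = b * a" using ab by simp
  have "b * V v * a \<in> Ic" using Ic_ideal vI ab by blast
  moreover have "b * V v * a \<in> J" using J_left J_right \<open>V v \<in> J\<close> ab by blast
  moreover have "b * a \<noteq> 0"
  proof
    assume "b * a = 0"
    then have "a * (b * a) * b = 0" by simp
    moreover have "a * (b * a) * b = (a * b) * (a * b)" by (simp only: mult.assoc)
    ultimately show False using ab V_idem[OF v] V_nonzero[OF v] by simp
  qed
  moreover have "b * a * (b * a) = b * (a * b) * a" by (simp only: mult.assoc)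
  then have "b * a * (b * a) = b * a" using ab by simp
  moreover have "e * (b * a) = b * a" using ab by (simp flip: mult.assoc)
  moreover have "b * a * e = b * a" using ab by (simp add: mult.assoc)
  ultimately show ?thesis unfolding f by blast
qed

lemma J_subset: "J \<subseteq> Ic"
proof
  fix x assume x: "x \<in> J"
  obtain e where e: "e \<in> J" "e * e = e" "e * x = x" "\<nexists>f. orthogonal_below e f" using J_local[OF x]
    by blast
  show "x \<in> Ic"
  proof (rule ccontr)
    assume xI: "x \<notin> Ic"
    have "e \<notin> Ic"
    proof
      assume "e \<in> Ic"
      then have "e * x \<in> Ic" using Ic_ideal(2) x JA by blast
      then show False using xI e(3) by simp
    qed
    have "\<forall>e. \<exists>f. e \<in> J \<and> e * e = e \<and> e \<noteq> 0 \<longrightarrow> f \<in> Ic \<and> f \<in> J \<and> f \<noteq> 0 \<and> f * f = f \<and> e * f = f \<and>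
      f * e = f"
      using J_peel by blast
    then obtain g where g0: "\<forall>e. e \<in> J \<and> e * e = e \<and> e \<noteq> 0 \<longrightarrow> g e \<in> Ic \<and> g e \<in> J \<and> g e \<noteq> 0 \<and>
      g e * g e = g e \<and> e * g e = g e \<and> g e * e = g e"
      unfolding choice_iff by blast
    \<comment> \<open>\<open>E n\<close> is what remains of \<open>e\<close> after splitting off
      \<open>n\<close> idempotents of \<open>Ic\<close>. As \<open>e\<close> is outside
      \<open>Ic\<close>, so is every remainder, which is therefore never 0 and can be split
      again.\<close>
    define E where "E n = ((\<lambda>e. e - g e) ^^ n) e" for n
    have E: "E 0 = e" "\<And>n. E (Suc n) = E n - g (E n)" by (simp_all add: E_def)
    have good: "E n \<in> J \<and> E n * E n = E n \<and> E n \<notin> Ic \<and> e * E n = E n \<and> E n * e = E n" for n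
    proof (induction n)
      case 0
      then show ?case using e \<open>e \<notin> Ic\<close> by (simp add: E)
    next
      case (Suc n)
      then have "E n \<noteq> 0" using Ic_addsub by (auto simp: addsub_def)
      then have g: "g (E n) \<in> Ic" "g (E n) \<in> J" "g (E n) * g (E n) = g (E n)"
        "E n * g (E n) = g (E n)" "g (E n) * E n = g (E n)"
        using g0 Suc by blast+
      have "E (Suc n) \<in> J" using Suc g J_add addsub_diff by (auto simp: E)
      moreover have "E (Suc n) * E (Suc n) = E (Suc n)" using Suc g
        by (simp add: E left_diff_distrib right_diff_distrib)
      moreover have "E (Suc n) \<notin> Ic"
      proof
        assume "E (Suc n) \<in> Ic"
        then have "E (Suc n) + g (E n) \<in> Ic" using g Ic_addsub by (simp add: addsub_def)
        then show False using Suc by (simp add: E)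
      qed
      moreover have "e * g (E n) = g (E n)"
      proof -
        have "e * g (E n) = e * (E n * g (E n))" using g by simp
        also have "\<dots> = (e * E n) * g (E n)" by (simp only: mult.assoc)
        also have "\<dots> = g (E n)" using Suc g by simp
        finally show ?thesis .
      qed
      moreover have "g (E n) * e = g (E n)"
      proof -
        have "g (E n) * e = g (E n) * E n * e" using g by simp
        also have "\<dots> = g (E n) * (E n * e)" by (simp only: mult.assoc)
        also have "\<dots> = g (E n)" using Suc g by simp
        finally show ?thesis .
      qed
      ultimately show ?case using Suc by (simp add: E left_diff_distrib right_diff_distrib)
    qed
    have En0: "E n \<noteq> 0" for n using good[of n] Ic_addsub by (auto simp: addsub_def)
    define f where "f n = g (E n)" for n
    have f: "f n \<in> J" "f n \<noteq> 0" "f n * f n = f n" "E n * f n = f n" "f n * E n = f n" for n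
      using g0 good[of n] En0[of n] by (auto simp: f_def)
    have Ef: "E (Suc n) = E n - f n" for n by (simp add: E f_def)
    \<comment> \<open>A piece is orthogonal to all later remainders, and later pieces lie below
      these; hence the pieces are mutually orthogonal.\<close>
    have below: "E m * f n = 0 \<and> f n * E m = 0" if "n < m" for n m
      using that
    proof (induction m)
      case (Suc m)
      show ?case
      proof (cases "n = m")
        case True
        then show ?thesis by (simp add: Ef f left_diff_distrib right_diff_distrib)
      next
        case False
        then have IH: "E m * f n = 0" "f n * E m = 0" using Suc by auto
        have "f m * f n = f m * (E m * f n)" by (simp add: f flip: mult.assoc)
        moreover have "f n * f m = (f n * E m) * f m" by (simp add: f mult.assoc)
        ultimately show ?thesis using IH by (simp add: Ef left_diff_distrib right_diff_distrib)
      qed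
    qed simp
    have orth: "f i * f j = 0" if "i \<noteq> j" for i j
    proof (cases "i < j")
      case True
      have "f i * f j = (f i * E j) * f j" by (simp add: f mult.assoc)
      then show ?thesis using below[OF True] by simp
    next
      case False
      then have "j < i" using that by simp
      have "f i * f j = f i * (E i * f j)" by (simp add: f flip: mult.assoc)
      then show ?thesis using below[OF \<open>j < i\<close>] by simp
    qed
    have "orthogonal_below e f"
      unfolding orthogonal_below_def
    proof (intro conjI allI impI)
      fix n
      have "e * f n = (e * E n) * f n" "f n * e = f n * (E n * e)"
        by (simp_all add: f mult.assoc) (simp add: f flip: mult.assoc)
      then show "e * f n = f n" "f n * e = f n" using good[of n] f by auto
      show "f n \<in> A" using f JA by blast
    qed (use f orth in auto)
    then show False using e(4) by blast
  qed
qed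

end

end

section \<open>Partial actions of the free algebra\<close>

lemma poly_mapping_additive_induct [case_names zero add]:
  fixes p :: "'a \<Rightarrow>\<^sub>0 'b::comm_monoid_add"
  assumes "P 0" "\<And>w k p. P p \<Longrightarrow> P (Poly_Mapping.single w k + p)"
  shows "P p"
proof -
  have "P (\<Sum>w\<in>S. Poly_Mapping.single w (Poly_Mapping.lookup p w))" if "finite S" for S
    using that by induction (auto intro: assms)
  moreover have "(\<Sum>w\<in>Poly_Mapping.keys p. Poly_Mapping.single w (Poly_Mapping.lookup p w)) = p"
    by (rule poly_mapping_eqI) (simp add: lookup_sum lookup_single when_def in_keys_iff)
  ultimately show ?thesis using finite_keys by metis
qed

primrec word_act :: "('a \<Rightarrow> 'x \<Rightarrow> 'x option) \<Rightarrow> 'a list \<Rightarrow> 'x \<Rightarrow> 'x option" where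
  "word_act t [] x = Some x"
| "word_act t (g # gs) x = Option.bind (t g x) (word_act t gs)"

lemma word_act_append: "word_act t (gs @ hs) x = Option.bind (word_act t gs x) (word_act t hs)"
  by (induction gs arbitrary: x) (auto split: Option.bind_splits)

text \<open>Functions are pulled back along the partial maps, with 0 where these are undefined.
  Words move points from left to right, so that on functions a product acts as the composition in
  the same order.\<close>

definition act :: "('a \<Rightarrow> 'x \<Rightarrow> 'x option) \<Rightarrow> ('a word \<Rightarrow>\<^sub>0 'k::field) \<Rightarrow> ('x \<Rightarrow> 'k) \<Rightarrow> 'x \<Rightarrow> 'k" where
  "act t p f x = (\<Sum>w\<in>Poly_Mapping.keys p.
     Poly_Mapping.lookup p w * case_option 0 f (word_act t (letters w) x))"

lemma act_superset:
  assumes "finite S" "Poly_Mapping.keys p \<subseteq> S"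
  shows "act t p f x = (\<Sum>w\<in>S. Poly_Mapping.lookup p w * case_option 0 f (word_act t (letters w) x))"
  unfolding act_def using assms by (intro sum.mono_neutral_left) (auto simp: in_keys_iff)

lemma act_0 [simp]: "act t 0 f x = 0"
  by (simp add: act_def)

lemma act_add: "act t (p + q) f x = act t p f x + act t q f x"
proof -
  let ?S = "Poly_Mapping.keys p \<union> Poly_Mapping.keys q"
  have "Poly_Mapping.keys (p + q) \<subseteq> ?S" by (rule keys_add)
  then show ?thesis
    by (simp add: act_superset[of ?S] lookup_add distrib_right sum.distrib)
qed

lemma act_uminus: "act t (- p) f x = - act t p f x"
  using act_add[of t p "- p" f x] by (simp add: eq_neg_iff_add_eq_0 add.commute)

lemma act_diff: "act t (p - q) f x = act t p f x - act t q f x"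
  using act_add[of t p "- q" f x] by (simp add: act_uminus)

lemma act_sum: "act t (sum g S) f x = (\<Sum>i\<in>S. act t (g i) f x)"
  by (induction S rule: infinite_finite_induct) (auto simp: act_add)

lemma act_single: "act t (Poly_Mapping.single w k) f x = k * case_option 0 f (word_act t (letters w)
  x)"
  by (subst act_superset[of "{w}"]) auto

lemma act_fun_zero: "act t p (\<lambda>_. 0) x = 0"
  unfolding act_def by (intro sum.neutral) (auto split: option.splits)

lemma act_fun_add: "act t p (\<lambda>x. f x + g x) x = act t p f x + act t p g x"
  unfolding act_def sum.distrib[symmetric]
    by (intro sum.cong) (auto simp: distrib_left split: option.splits)

lemma act_single_mult: "act t (Poly_Mapping.single w k * q) f x =
  act t (Poly_Mapping.single w k) (act t q f) x"
proof (induction q rule: poly_mapping_additive_induct)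
  case zero
  have "act t 0 f = (\<lambda>_. 0)" by (simp add: fun_eq_iff)
  then show ?case by (simp add: act_fun_zero)
next
  case (add w' k' q)
  have "act t (Poly_Mapping.single w' k' + q) f = (\<lambda>x. act t (Poly_Mapping.single w' k') f x + act t
    q f x)"
    by (simp add: fun_eq_iff act_add)
  moreover have "act t (Poly_Mapping.single w k * Poly_Mapping.single w' k') f x =
      act t (Poly_Mapping.single w k) (act t (Poly_Mapping.single w' k') f) x"
    by (auto simp: mult_single act_single plus_word_def word_act_append split: option.splits)
  ultimately show ?case by (simp add: distrib_left act_add act_fun_add add.IH)
qed

lemma act_mult: "act t (p * q) f x = act t p (act t q f) x"
  by (induction p rule: poly_mapping_additive_induct) (simp_all add: distrib_right act_add
    act_single_mult)

lemma linear_projection: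
  fixes s :: "'k::field \<Rightarrow> 'b::ab_group_add \<Rightarrow> 'b"
  assumes "vector_space s" "module.subspace s U"
  obtains g where "\<forall>x y. g (x + y) = g x + g y" "\<forall>x. g x \<in> U" "\<forall>x\<in>U. g x = x"
proof -
  interpret vector_space s by fact
  interpret vector_space_pair s s by unfold_locales
  have "Vector_Spaces.linear s s id" by (rule linear_id)
  then obtain g where g: "range g \<subseteq> U" "Vector_Spaces.linear s s g" "\<forall>v\<in>U. g (id v) = v"
    using linear_exists_left_inverse_on[of id U] assms(2) by auto
  interpret g: Vector_Spaces.linear s s g by fact
  show ?thesis using that[of g] g g.add by auto
qed

section \<open>The Leavitt path algebra as a Leavitt family\<close>

locale lpa_construction = wf_digraph E for E :: "('v, 'e) pre_digraph" +
  fixes K :: "'k::field itself"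
begin

abbreviation FU :: "(('v, 'e) lpa_gen word \<Rightarrow>\<^sub>0 'k) ring" where
  "FU \<equiv> free_unital_algebra (lpa_gens E)"
abbreviation FA :: "(('v, 'e) lpa_gen word \<Rightarrow>\<^sub>0 'k) ring" where "FA \<equiv> free_algebra (lpa_gens E)"
abbreviation N :: "(('v, 'e) lpa_gen word \<Rightarrow>\<^sub>0 'k) set" where "N \<equiv> lpa_ideal E"
abbreviation scalar :: "'k \<Rightarrow> ('v, 'e) lpa_gen word \<Rightarrow>\<^sub>0 'k" where
  "scalar k \<equiv> Poly_Mapping.single 0 k"

lemma FU_simps [simp]: "x \<otimes>\<^bsub>FU\<^esub> y = x * y" "x \<oplus>\<^bsub>FU\<^esub> y = x + y" "\<zero>\<^bsub>FU\<^esub> = 0" "\<one>\<^bsub>FU\<^esub> = 1"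
  by (auto simp: free_unital_algebra_def)

lemma FA_simps [simp]: "x \<otimes>\<^bsub>FA\<^esub> y = x * y" "x \<oplus>\<^bsub>FA\<^esub> y = x + y" "\<zero>\<^bsub>FA\<^esub> = 0"
  by (auto simp: free_algebra_def free_unital_algebra_def)

lemma FA_carrier: "p \<in> carrier FA \<longleftrightarrow> p \<in> carrier FU \<and> Poly_Mapping.lookup p 0 = 0"
  by (simp add: free_algebra_def)

lemma FU_carrier: "p \<in> carrier FU \<longleftrightarrow> (\<forall>w\<in>Poly_Mapping.keys p. set (letters w) \<subseteq> lpa_gens E)"
  by (simp add: free_unital_algebra_def)

interpretation FU: ring FU by (rule ring_free_unital_algebra)

lemma FU_add: "p \<in> carrier FU \<Longrightarrow> q \<in> carrier FU \<Longrightarrow> p + q \<in> carrier FU"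
  using FU.a_closed by simp

lemma FU_mult: "p \<in> carrier FU \<Longrightarrow> q \<in> carrier FU \<Longrightarrow> p * q \<in> carrier FU"
  using FU.m_closed by simp

lemma FU_zero: "0 \<in> carrier FU"
  using FU.zero_closed by simp

lemma FU_sum: "(\<And>i. i \<in> S \<Longrightarrow> f i \<in> carrier FU) \<Longrightarrow> sum f S \<in> carrier FU"
  by (induction S rule: infinite_finite_induct) (auto simp: FU_zero FU_add)

lemma FU_uminus: "p \<in> carrier FU \<Longrightarrow> - p \<in> carrier FU"
  by (simp add: FU_carrier in_keys_iff)

lemma FU_single: "set (letters w) \<subseteq> lpa_gens E \<Longrightarrow> Poly_Mapping.single w k \<in> carrier FU"
  by (auto simp: FU_carrier)

lemma FU_scalar: "scalar k \<in> carrier FU"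
  by (rule FU_single) (simp add: zero_word_def)

lemma FU_gen: "a \<in> lpa_gens E \<Longrightarrow> gen a \<in> carrier FU"
  unfolding gen_def by (rule FU_single) simp

lemma a_inv_FU: "p \<in> carrier FU \<Longrightarrow> \<ominus>\<^bsub>FU\<^esub> p = - p"
  using FU.minus_equality[of "- p" p] FU_uminus by simp

lemma relators_FU: "lpa_relators E \<subseteq> carrier FU"
  using lpa_relators_subset[OF wf_digraph_axioms] FA_carrier by blast

lemma ideal_N: "ideal N FU"
  unfolding lpa_ideal_def by (rule FU.genideal_ideal[OF relators_FU])

lemma relators_N: "lpa_relators E \<subseteq> N"
  unfolding lpa_ideal_def by (rule FU.genideal_self[OF relators_FU])

interpretation N: ideal N FU by (rule ideal_N)

lemma N_FU: "N \<subseteq> carrier FU"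
  by (rule N.a_subset)

lemma N_add: "p \<in> N \<Longrightarrow> q \<in> N \<Longrightarrow> p + q \<in> N"
  using N.a_closed by simp

lemma N_zero: "0 \<in> N"
  using N.zero_closed by simp

lemma N_uminus: "p \<in> N \<Longrightarrow> - p \<in> N"
  using N.a_inv_closed[of p] a_inv_FU N_FU by auto

lemma N_diff: "p \<in> N \<Longrightarrow> q \<in> N \<Longrightarrow> p - q \<in> N"
  using N_add[of p "- q"] N_uminus by simp

lemma N_left: "p \<in> N \<Longrightarrow> q \<in> carrier FU \<Longrightarrow> q * p \<in> N"
  using N.I_l_closed by simp

lemma N_right: "p \<in> N \<Longrightarrow> q \<in> carrier FU \<Longrightarrow> p * q \<in> N"
  using N.I_r_closed by simp

section \<open>A linear complement of the relations and the model built on it\<close>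

lemma scalar_vector_space: "vector_space (\<lambda>k p. scalar k * p)"
  by unfold_locales
    (simp_all add: distrib_left distrib_right single_add mult_single flip: mult.assoc)

lemma subspace_scalar:
  assumes "0 \<in> U" "\<And>p q. p \<in> U \<Longrightarrow> q \<in> U \<Longrightarrow> p + q \<in> U" "\<And>k p. p \<in> U \<Longrightarrow> scalar k * p \<in> U"
  shows "module.subspace (\<lambda>k p. scalar k * p) U"
proof -
  interpret vector_space "\<lambda>k p. scalar k * p" by (rule scalar_vector_space)
  show ?thesis unfolding subspace_def using assms by simp
qed

text \<open>Choosing representatives linearly makes reduction modulo \<open>N\<close> an additive
  map; a complement exists because \<open>N\<close> is a subspace over the field.\<close>

definition \<pi> :: "(('v, 'e) lpa_gen word \<Rightarrow>\<^sub>0 'k) \<Rightarrow> (('v, 'e) lpa_gen word \<Rightarrow>\<^sub>0 'k)" where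
  "\<pi> = (SOME \<pi>. (\<forall>x y. \<pi> (x + y) = \<pi> x + \<pi> y) \<and> (\<forall>x. x - \<pi> x \<in> N) \<and> (\<forall>x. \<pi> x = 0 \<longleftrightarrow> x \<in> N))"

text \<open>\<open>N\<close> absorbs factors from \<open>carrier FU\<close> only, while an
  endomorphism has to be defined on polynomials in arbitrary letters; \<open>\<sigma>\<close> first
  projects these to \<open>carrier FU\<close>.\<close>

definition \<sigma> :: "(('v, 'e) lpa_gen word \<Rightarrow>\<^sub>0 'k) \<Rightarrow> (('v, 'e) lpa_gen word \<Rightarrow>\<^sub>0 'k)" where
  "\<sigma> = (SOME \<sigma>. (\<forall>x y. \<sigma> (x + y) = \<sigma> x + \<sigma> y) \<and> (\<forall>x. \<sigma> x \<in> carrier FU) \<and> (\<forall>x\<in>carrier FU. \<sigma> x = x))"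

lemma
  shows pi_add: "\<pi> (x + y) = \<pi> x + \<pi> y" and pi_diff_N: "x - \<pi> x \<in> N" and pi_zero_iff:
    "\<pi> x = 0 \<longleftrightarrow> x \<in> N"
proof -
  have "module.subspace (\<lambda>k p. scalar k * p) N"
    using N_zero N_add N_left FU_scalar by (intro subspace_scalar) auto
  then obtain g :: "(('v, 'e) lpa_gen word \<Rightarrow>\<^sub>0 'k) \<Rightarrow> (('v, 'e) lpa_gen word \<Rightarrow>\<^sub>0 'k)"
    where g: "\<forall>x y. g (x + y) = g x + g y" "\<forall>x. g x \<in> N" "\<forall>x\<in>N. g x = x"
    by (rule linear_projection[OF scalar_vector_space])
  have "(\<forall>x y. \<pi> (x + y) = \<pi> x + \<pi> y) \<and> (\<forall>x. x - \<pi> x \<in> N) \<and> (\<forall>x. \<pi> x = 0 \<longleftrightarrow> x \<in> N)"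
    unfolding \<pi>_def
  proof (rule someI[of _ "\<lambda>x. x - g x"], intro conjI allI)
    show "(x - g x = 0) = (x \<in> N)" for x using g(2,3) by (metis diff_self eq_iff_diff_eq_0)
  qed (use g in auto)
  then show "\<pi> (x + y) = \<pi> x + \<pi> y" "x - \<pi> x \<in> N" "\<pi> x = 0 \<longleftrightarrow> x \<in> N" by blast+
qed

lemma
  shows sigma_add: "\<sigma> (x + y) = \<sigma> x + \<sigma> y" and sigma_FU: "\<sigma> x \<in> carrier FU"
    and sigma_id: "x \<in> carrier FU \<Longrightarrow> \<sigma> x = x"
proof -
  have "module.subspace (\<lambda>k p. scalar k * p) (carrier FU)"
    using FU_zero FU_add FU_mult FU_scalar by (intro subspace_scalar) auto
  then obtain g :: "(('v, 'e) lpa_gen word \<Rightarrow>\<^sub>0 'k) \<Rightarrow> (('v, 'e) lpa_gen word \<Rightarrow>\<^sub>0 'k)"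
    where g: "\<forall>x y. g (x + y) = g x + g y" "\<forall>x. g x \<in> carrier FU" "\<forall>x\<in>carrier FU. g x = x"
    by (rule linear_projection[OF scalar_vector_space])
  have "(\<forall>x y. \<sigma> (x + y) = \<sigma> x + \<sigma> y) \<and> (\<forall>x. \<sigma> x \<in> carrier FU) \<and> (\<forall>x\<in>carrier FU. \<sigma> x = x)"
    unfolding \<sigma>_def by (rule someI[of _ g]) (use g in blast)
  then show "\<sigma> (x + y) = \<sigma> x + \<sigma> y" "\<sigma> x \<in> carrier FU" "x \<in> carrier FU \<Longrightarrow> \<sigma> x = x" by blast+
qed

lemma pi_uminus: "\<pi> (- x) = - \<pi> x"
  using pi_add[of x "- x"] pi_add[of 0 0] by (simp add: eq_neg_iff_add_eq_0 add.commute)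

lemma pi_cong: "x - y \<in> N \<Longrightarrow> \<pi> x = \<pi> y"
  using pi_zero_iff[of "x - y"] pi_add[of x "- y"] by (simp add: pi_uminus)

lemma pi_FU: "x \<in> carrier FU \<Longrightarrow> \<pi> x \<in> carrier FU"
  using FU_add[OF _ FU_uminus, of x "x - \<pi> x"] pi_diff_N N_FU by auto

text \<open>
  Left multiplication on the vector space complement of the relations selected by \<open>\<pi>\<close>: a model
  of the quotient in a type of class \<^class>\<open>ring_1\<close>, faithful modulo the relations.
\<close>

definition \<rho> :: "(('v, 'e) lpa_gen word \<Rightarrow>\<^sub>0 'k) \<Rightarrow> (('v, 'e) lpa_gen word \<Rightarrow>\<^sub>0 'k) endo" where
  "\<rho> p = Endo (\<lambda>x. \<pi> (p * \<sigma> x))"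

lemma app_rho: "app (\<rho> p) x = \<pi> (p * \<sigma> x)"
  unfolding \<rho>_def by (subst Endo_inverse) (auto simp: pi_add sigma_add distrib_left)

lemma rho_add: "\<rho> (p + q) = \<rho> p + \<rho> q"
  by (rule endo_eqI) (simp add: app_rho pi_add distrib_right)

lemma rho_mult: "p \<in> carrier FU \<Longrightarrow> q \<in> carrier FU \<Longrightarrow> \<rho> (p * q) = \<rho> p * \<rho> q"
proof (rule endo_eqI)
  fix x assume p: "p \<in> carrier FU" and q: "q \<in> carrier FU"
  have qx: "q * \<sigma> x \<in> carrier FU" using FU_mult[OF q sigma_FU] .
  have "p * (q * \<sigma> x - \<pi> (q * \<sigma> x)) \<in> N" using N_left[OF pi_diff_N p] .
  then have "\<pi> (p * (q * \<sigma> x)) = \<pi> (p * \<pi> (q * \<sigma> x))"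
    by (intro pi_cong) (simp add: right_diff_distrib)
  then show "app (\<rho> (p * q)) x = app (\<rho> p * \<rho> q) x"
    using sigma_id[OF pi_FU[OF qx]] by (simp add: app_rho mult.assoc)
qed

text \<open>The value at 1 is \<open>p\<close> reduced modulo the relations, which makes the
  representation faithful.\<close>

lemma rho_zero_iff: "p \<in> carrier FU \<Longrightarrow> \<rho> p = 0 \<longleftrightarrow> p \<in> N"
proof
  assume "p \<in> carrier FU" "\<rho> p = 0"
  then have "app (\<rho> p) 1 = app 0 1" by simp
  moreover have "(1 :: ('v, 'e) lpa_gen word \<Rightarrow>\<^sub>0 'k) \<in> carrier FU" using FU.one_closed by simp
  ultimately show "p \<in> N" using pi_zero_iff[of p] by (simp add: app_rho sigma_id)
next
  assume "p \<in> N"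
  then show "\<rho> p = 0" using N_right[OF _ sigma_FU]
    by (intro endo_eqI) (simp add: app_rho pi_zero_iff)
qed

lemma rho_zero: "\<rho> 0 = 0"
  using rho_zero_iff[OF FU_zero] N_zero by simp

lemma rho_uminus: "\<rho> (- p) = - \<rho> p"
  using rho_add[of p "- p"] by (simp add: rho_zero eq_neg_iff_add_eq_0 add.commute)

lemma rho_diff: "\<rho> (p - q) = \<rho> p - \<rho> q"
  using rho_add[of p "- q"] by (simp add: rho_uminus)

lemma rho_sum: "\<rho> (sum f S) = (\<Sum>i\<in>S. \<rho> (f i))"
  by (induction S rule: infinite_finite_induct) (auto simp: rho_zero rho_add)

lemma rho_relator: "p - q \<in> lpa_relators E \<Longrightarrow> \<rho> p = \<rho> q"
proof -
  assume "p - q \<in> lpa_relators E"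
  then have "p - q \<in> N" "p - q \<in> carrier FU" using relators_N N_FU by auto
  then have "\<rho> (p - q) = 0" using rho_zero_iff by blast
  then show ?thesis by (simp add: rho_diff)
qed

lemma arc_relators:
  assumes "e \<in> arcs E"
  shows "vtx (tail E e) * edge e - edge e \<in> lpa_relators E" "edge e * vtx (head E e) - edge e \<in>
    lpa_relators E"
    "vtx (head E e) * ghost e - ghost e \<in> lpa_relators E" "ghost e * vtx (tail E e) - ghost e \<in>
      lpa_relators E"
  using assms unfolding lpa_relators_def by blast+

lemma gens [simp]: "v \<in> verts E \<Longrightarrow> Vertex v \<in> lpa_gens E" "e \<in> arcs E \<Longrightarrow> Edge e \<in> lpa_gens E"
    "e \<in> arcs E \<Longrightarrow> Ghost e \<in> lpa_gens E"
  by (auto simp: lpa_gens_def)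

text \<open>The set of addresses has to absorb as many copies as a vertex has edges, possibly
  uncountably many. Lists of edges are infinite and at least as numerous as edges, so the product
  has the same cardinality.\<close>

lemma branching:
  "\<exists>b. \<forall>v. out_arcs E v \<noteq> {} \<longrightarrow>
    bij_betw (b v) (out_arcs E v \<times> (UNIV :: 'e list set)) (UNIV :: 'e list set)"
proof (rule choice, rule allI)
  fix v
  show "\<exists>b. out_arcs E v \<noteq> {} \<longrightarrow> bij_betw b (out_arcs E v \<times> (UNIV :: 'e list set)) (UNIV :: 'e list
    set)"
  proof (cases "out_arcs E v = {}")
    case False
    have le: "(card_of (out_arcs E v), card_of (UNIV :: 'e list set)) \<in> ordLeq"
      unfolding card_of_ordLeq[symmetric] by (rule exI[of _ "\<lambda>e. [e]"]) (auto simp: inj_on_def)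
    have "infinite (UNIV :: 'e list set)" by (rule infinite_UNIV_listI)
    from card_of_Times_infinite[OF this False le]
    have "(card_of (out_arcs E v \<times> (UNIV :: 'e list set)), card_of (UNIV :: 'e list set)) \<in>
      ordIso" ..
    then have "\<exists>b. bij_betw b (out_arcs E v \<times> (UNIV :: 'e list set)) (UNIV :: 'e list set)"
      unfolding card_of_ordIso .
    then show ?thesis by blast
  qed simp
qed

text \<open>
  The action behind the linear independence of paths. The generators act by partial maps on
  triples of an address, a vertex and a degree; a vertex restricts to its fibre, and the fibre
  over a vertex is the disjoint union of copies of the fibres over the heads of its edges, which
  raise the degree by one.
\<close>

definition branch :: "'v \<Rightarrow> 'e \<times> 'e list \<Rightarrow> 'e list" where
  "branch = (SOME b. \<forall>v. out_arcs E v \<noteq> {} \<longrightarrow> bij_betw (b v) (out_arcs E v \<times> UNIV) UNIV)"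

lemma branch_bij: "out_arcs E v \<noteq> {} \<Longrightarrow> bij_betw (branch v) (out_arcs E v \<times> UNIV) UNIV"
  using someI_ex[OF branching] unfolding branch_def by blast

definition unbranch :: "'v \<Rightarrow> 'e list \<Rightarrow> 'e \<times> 'e list" where
  "unbranch v = inv_into (out_arcs E v \<times> UNIV) (branch v)"

lemma unbranch_branch: "e \<in> out_arcs E v \<Longrightarrow> unbranch v (branch v (e, s)) = (e, s)"
proof -
  assume e: "e \<in> out_arcs E v"
  then have "bij_betw (branch v) (out_arcs E v \<times> UNIV) UNIV" by (intro branch_bij) blast
  then show ?thesis unfolding unbranch_def using e by (intro inv_into_f_f) (auto simp: bij_betw_def)
qed

lemma branch_unbranch: "out_arcs E v \<noteq> {} \<Longrightarrow> branch v (unbranch v s) = s"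
  unfolding unbranch_def using branch_bij[of v] by (intro f_inv_into_f) (auto simp: bij_betw_def)

lemma fst_unbranch: "out_arcs E v \<noteq> {} \<Longrightarrow> fst (unbranch v s) \<in> out_arcs E v"
  unfolding unbranch_def using branch_bij[of v] inv_into_into[of s "branch v" "out_arcs E v \<times> UNIV"]
  by (auto simp: bij_betw_def mem_Times_iff)

text \<open>On points an edge strips its own mark from the address and lowers the degree, and its
  ghost restores both; the pullback to functions reverses these directions.\<close>

fun gen_act :: "('v, 'e) lpa_gen \<Rightarrow> 'e list \<times> 'v \<times> int \<Rightarrow> ('e list \<times> 'v \<times> int) option" where
  "gen_act (Vertex v) (s, w, n) = (if w = v then Some (s, w, n) else None)"
| "gen_act (Edge e) (s, w, n) =
    (if w = tail E e \<and> fst (unbranch w s) = e then Some (snd (unbranch w s), head E e, n - 1) else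
      None)"
| "gen_act (Ghost e) (s, w, n) =
    (if w = head E e then Some (branch (tail E e) (e, s), tail E e, n + 1) else None)"

definition action_kernel :: "(('v, 'e) lpa_gen word \<Rightarrow>\<^sub>0 'k) set" where
  "action_kernel = {p \<in> carrier FU. \<forall>f x. act gen_act p f x = 0}"

lemma ideal_action_kernel: "ideal action_kernel FU"
proof (rule idealI)
  show "ring FU" by (rule FU.ring_axioms)
  show "subgroup action_kernel (add_monoid FU)"
  proof (rule FU.add.subgroupI)
    show "action_kernel \<subseteq> carrier FU" by (auto simp: action_kernel_def)
    have "0 \<in> action_kernel" by (simp add: action_kernel_def FU_zero)
    then show "action_kernel \<noteq> {}" by blast
    show "\<ominus>\<^bsub>FU\<^esub> p \<in> action_kernel" if "p \<in> action_kernel" for p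
      using that by (auto simp: action_kernel_def a_inv_FU FU_uminus act_uminus)
    show "p \<oplus>\<^bsub>FU\<^esub> q \<in> action_kernel" if "p \<in> action_kernel" "q \<in> action_kernel" for p q
      using that by (auto simp: action_kernel_def FU_add act_add)
  qed
  fix a x assume a: "a \<in> action_kernel" and x: "x \<in> carrier FU"
  have "act gen_act a f = (\<lambda>_. 0)" for f using a by (auto simp: action_kernel_def)
  then show "x \<otimes>\<^bsub>FU\<^esub> a \<in> action_kernel"
    using a x by (auto simp: action_kernel_def FU_mult act_mult act_fun_zero)
  show "a \<otimes>\<^bsub>FU\<^esub> x \<in> action_kernel"
    using a x by (auto simp: action_kernel_def FU_mult act_mult)
qed

lemma act_gen: "act t (gen a :: 'a word \<Rightarrow>\<^sub>0 'k) f x = case_option 0 f (t a x)"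
  by (auto simp: gen_def act_single split: Option.bind_splits option.splits)

lemma act_vtx: "act gen_act (vtx v :: ('v, 'e) lpa_gen word \<Rightarrow>\<^sub>0 'k) f (s, w, n) = (if w =
  v then f (s, w, n) else 0)"
  by (simp add: act_gen)

lemma act_edge: "act gen_act (edge e :: ('v, 'e) lpa_gen word \<Rightarrow>\<^sub>0 'k) f (s, w, n) =
    (if w = tail E e \<and> fst (unbranch w s) = e then f (snd (unbranch w s), head E e, n - 1) else 0)"
  by (auto simp: act_gen)

lemma act_ghost: "act gen_act (ghost e :: ('v, 'e) lpa_gen word \<Rightarrow>\<^sub>0 'k) f (s, w, n) =
    (if w = head E e then f (branch (tail E e) (e, s), tail E e, n + 1) else 0)"
  by (simp add: act_gen)

lemma relators_action_kernel: "lpa_relators E \<subseteq> action_kernel"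
proof
  fix p :: "('v, 'e) lpa_gen word \<Rightarrow>\<^sub>0 'k" assume p: "p \<in> lpa_relators E"
  have "act gen_act p f (s, w, n) = 0" for f s w n
    using p unfolding lpa_relators_def
  proof (elim UnE CollectE exE conjE)
    fix e f' assume e: "p = ghost e * edge f' - (if e = f' then vtx (head E e) else 0)" "e \<in> arcs E"
      "f' \<in> arcs E"
    have "unbranch (tail E e) (branch (tail E e) (e, s)) = (e, s)" using e(2)
      by (intro unbranch_branch) simp
    then show ?thesis by (auto simp: e(1) act_diff act_mult act_ghost act_edge act_vtx)
  next
    fix v assume v: "p = vtx v - (\<Sum>e\<in>out_arcs E v. edge e * ghost e)" "regular_vertex E v"
    then have fin: "finite (out_arcs E v)" and ne: "out_arcs E v \<noteq> {}"
      by (auto simp: regular_vertex_def)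
    \<comment> \<open>An address in the fibre of \<open>v\<close> belongs to exactly one outgoing
      edge, so one summand survives.\<close>
    have "(\<Sum>e\<in>out_arcs E v. act gen_act (edge e * ghost e) f (s, w, n)) =
      (\<Sum>e\<in>out_arcs E v. if e = fst (unbranch v s) then (if w = v then f (s, w, n) else 0) else 0)"
    proof (rule sum.cong)
      fix e assume e: "e \<in> out_arcs E v"
      have "branch v (fst (unbranch v s), snd (unbranch v s)) = s" using branch_unbranch[OF ne]
        by simp
      then show "act gen_act (edge e * ghost e) f (s, w, n) =
        (if e = fst (unbranch v s) then (if w = v then f (s, w, n) else 0) else 0)"
        using e by (auto simp: act_mult act_edge act_ghost)
    qed simp
    also have "\<dots> = (if w = v then f (s, w, n) else 0)"
      using fin fst_unbranch[OF ne, of s] by simp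
    finally show ?thesis by (simp add: v(1) act_diff act_sum act_vtx)
  qed (auto simp: act_diff act_mult act_vtx act_edge act_ghost)
  then show "p \<in> action_kernel" using p relators_FU by (auto simp: action_kernel_def)
qed

lemma N_action: "p \<in> N \<Longrightarrow> act gen_act p f x = 0"
proof -
  have "N \<subseteq> action_kernel"
    unfolding lpa_ideal_def
      by (rule FU.genideal_minimal[OF ideal_action_kernel relators_action_kernel])
  then show "p \<in> N \<Longrightarrow> act gen_act p f x = 0" unfolding action_kernel_def by blast
qed

section \<open>Linear independence of paths in the quotient\<close>

primrec lift :: "'e list \<Rightarrow> 'e list \<times> 'v \<times> int \<Rightarrow> 'e list \<times> 'v \<times> int" where
  "lift [] y = y"
| "lift (e # p) y = (case lift p y of (s, w, n) \<Rightarrow> (branch (tail E e) (e, s), tail E e, n + 1))"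

text \<open>Following \<open>p\<close> backwards from \<open>y\<close> produces the point that the
  edges of \<open>p\<close>, read forwards, carry to \<open>y\<close>.\<close>

lemma lift_act:
  assumes "awalk u p (fst (snd y))"
  shows "word_act gen_act (map Edge p) (lift p y) = Some y \<and> fst (snd (lift p y)) = u"
  using assms
proof (induction p arbitrary: u)
  case (Cons e p)
  then have e: "e \<in> arcs E" "u = tail E e" "awalk (head E e) p (fst (snd y))"
    by (auto simp: awalk_Cons_iff)
  obtain s w n where l: "lift p y = (s, w, n)" by (cases "lift p y")
  have "w = head E e" "word_act gen_act (map Edge p) (s, w, n) = Some y" using Cons.IH[OF e(3)] l
    by auto
  moreover have "unbranch (tail E e) (branch (tail E e) (e, s)) = (e, s)" using e(1)
    by (intro unbranch_branch) simp
  ultimately show ?case using l e by simp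
qed (auto simp: awalk_Nil_iff)

text \<open>The integer coordinate is there for this count, which keeps paths of different length
  apart, for example the powers of a cycle.\<close>

lemma edges_act_degree:
  "word_act gen_act (map Edge p) x = Some y \<Longrightarrow> snd (snd y) = snd (snd x) - int (length p)"
proof (induction p arbitrary: x)
  case (Cons e p)
  obtain s w n where x: "x = (s, w, n)" by (cases x)
  show ?case using Cons.prems Cons.IH by (fastforce simp: x split: if_splits)
qed simp

text \<open>The address of a point prescribes the one edge that is defined on it, so two paths of
  equal length defined there agree letter by letter.\<close>

lemma edges_act_unique:
  "word_act gen_act (map Edge p) x = Some y \<Longrightarrow> word_act gen_act (map Edge q) x = Some z \<Longrightarrow>
    length p = length q \<Longrightarrow> p = q"
proof (induction p arbitrary: q x)
  case (Cons e p)
  obtain f q' where q: "q = f # q'" using Cons.prems(3) by (cases q) auto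
  obtain s w n where x: "x = (s, w, n)" by (cases x)
  show ?case using Cons.prems Cons.IH[of _ q'] by (auto simp: x q split: if_splits)
qed simp

lemma prod_edges: "prod_list (map edge p) * vtx v = (Poly_Mapping.single (Word (map Edge p @ [Vertex
  v])) 1 :: ('v, 'e) lpa_gen word \<Rightarrow>\<^sub>0 'k)"
  by (induction p) (simp_all add: gen_def mult_single plus_word_def mult.assoc)

lemma paths_independent:
  assumes S: "finite S" "\<And>q. q \<in> S \<Longrightarrow> \<exists>u. awalk u q v"
    and N: "(\<Sum>q\<in>S. scalar (k q) * (prod_list (map edge q) * vtx v)) \<in> N" and p: "p \<in> S"
  shows "k p = 0"
proof -
  define y :: "'e list \<times> 'v \<times> int" where "y = ([], v, 0)"
  \<comment> \<open>The indicator function of \<open>y\<close>, pulled back and evaluated at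
    \<open>lift p y\<close>, extracts the coefficient of \<open>p\<close>: along any other path the
    point does not arrive at \<open>y\<close>.\<close>
  define f :: "'e list \<times> 'v \<times> int \<Rightarrow> 'k" where "f x = (if x = y then 1 else 0)" for x
  obtain u where u: "awalk u p v" using S(2)[OF p] by blast
  have py: "word_act gen_act (map Edge p) (lift p y) = Some y" using lift_act[of u p y] u
    by (simp add: y_def)
  have "act gen_act (scalar (k q) * (prod_list (map edge q) * vtx v)) f (lift p y) = (if q =
    p then k p else 0)"
    if "q \<in> S" for q
  proof -
    have "scalar (k q) * (prod_list (map edge q) * vtx v) =
        Poly_Mapping.single (Word (map Edge q @ [Vertex v])) (k q)"
      by (simp add: prod_edges mult_single)
    then have eq: "act gen_act (scalar (k q) * (prod_list (map edge q) * vtx v)) f (lift p y) =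
        k q * case_option 0 f (Option.bind (word_act gen_act (map Edge q) (lift p y)) (gen_act
          (Vertex v)))"
      by (simp add: act_single word_act_append cong: Option.bind_cong)
    show ?thesis
    proof (cases "q = p")
      case True
      then show ?thesis unfolding eq using py by (simp add: y_def f_def)
    next
      case False
      have "word_act gen_act (map Edge q) (lift p y) \<noteq> Some y"
      proof
        assume qy: "word_act gen_act (map Edge q) (lift p y) = Some y"
        then have "length q = length p" using edges_act_degree[OF qy] edges_act_degree[OF py]
          by simp
        then show False using edges_act_unique[OF qy py] False by simp
      qed
      then show ?thesis unfolding eq using False
        by (cases "word_act gen_act (map Edge q) (lift p y)") (auto simp: f_def split: option.splits
          if_splits)
    qed
  qed
  then have "act gen_act (\<Sum>q\<in>S. scalar (k q) * (prod_list (map edge q) * vtx v)) f (lift p y) = k p"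
    using S(1) p by (simp add: act_sum)
  then show ?thesis using N_action[OF N] by simp
qed

lemma rho_path: "set p \<subseteq> arcs E \<Longrightarrow> v \<in> verts E \<Longrightarrow>
    prod_list (map (\<lambda>e. \<rho> (edge e)) p) * \<rho> (vtx v) = \<rho> (prod_list (map edge p) * vtx v)
    \<and> prod_list (map edge p) * (vtx v :: ('v, 'e) lpa_gen word \<Rightarrow>\<^sub>0 'k) \<in> carrier FU"
  by (induction p) (simp_all add: FU_gen FU_mult rho_mult mult.assoc)

sublocale leavitt_family E "\<lambda>v. \<rho> (vtx v)" "\<lambda>e. \<rho> (edge e)" "\<lambda>e. \<rho> (ghost e)" "\<lambda>k. \<rho> (scalar k)"
proof
  show "\<rho> (vtx v) * \<rho> (vtx w) = (if v = w then \<rho> (vtx v) else 0)" if "v \<in> verts E" "w \<in> verts E"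
    for v w
  proof -
    have "\<rho> (vtx v * vtx w) = \<rho> (if v = w then vtx v else 0)"
      using that by (intro rho_relator) (auto simp: lpa_relators_def)
    then show ?thesis using that by (simp add: rho_mult FU_gen rho_zero split: if_splits)
  qed
  show "\<rho> (vtx (tail E e)) * \<rho> (edge e) = \<rho> (edge e)" if "e \<in> arcs E" for e
    using rho_relator[OF arc_relators(1)[OF that]] that by (simp add: rho_mult FU_gen)
  show "\<rho> (edge e) * \<rho> (vtx (head E e)) = \<rho> (edge e)" if "e \<in> arcs E" for e
    using rho_relator[OF arc_relators(2)[OF that]] that by (simp add: rho_mult FU_gen)
  show "\<rho> (vtx (head E e)) * \<rho> (ghost e) = \<rho> (ghost e)" if "e \<in> arcs E" for e
    using rho_relator[OF arc_relators(3)[OF that]] that by (simp add: rho_mult FU_gen)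
  show "\<rho> (ghost e) * \<rho> (vtx (tail E e)) = \<rho> (ghost e)" if "e \<in> arcs E" for e
    using rho_relator[OF arc_relators(4)[OF that]] that by (simp add: rho_mult FU_gen)
  show "\<rho> (ghost e) * \<rho> (edge f) = (if e = f then \<rho> (vtx (head E e)) else 0)" if "e \<in> arcs E"
    "f \<in> arcs E" for e f
  proof -
    have "\<rho> (ghost e * edge f) = \<rho> (if e = f then vtx (head E e) else 0)"
      using that by (intro rho_relator) (auto simp: lpa_relators_def)
    then show ?thesis using that by (simp add: rho_mult FU_gen rho_zero split: if_splits)
  qed
  show "\<rho> (vtx v) = (\<Sum>e\<in>out_arcs E v. \<rho> (edge e) * \<rho> (ghost e))" if v: "regular_vertex E v" for v
  proof -
    have "\<rho> (vtx v) = \<rho> (\<Sum>e\<in>out_arcs E v. edge e * ghost e)"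
      using v by (intro rho_relator, unfold lpa_relators_def, intro UnI2) blast
    also have "\<dots> = (\<Sum>e\<in>out_arcs E v. \<rho> (edge e) * \<rho> (ghost e))"
      unfolding rho_sum by (intro sum.cong) (auto simp: rho_mult FU_gen)
    finally show ?thesis .
  qed
  show "\<rho> (scalar (a + b)) = \<rho> (scalar a) + \<rho> (scalar b)" for a b by (simp add: single_add rho_add)
  show "\<rho> (scalar (a * b)) = \<rho> (scalar a) * \<rho> (scalar b)" for a b
    by (simp add: FU_scalar mult_single flip: rho_mult)
  show "\<rho> (scalar 1) * \<rho> (vtx v) = \<rho> (vtx v)" if "v \<in> verts E" for v
    using rho_mult[OF FU_scalar FU_gen, of "Vertex v" 1] that by simp
  have comm: "\<rho> (gen g) * \<rho> (scalar a) = \<rho> (scalar a) * \<rho> (gen g)" if "g \<in> lpa_gens E" for a g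
  proof -
    have "gen g * scalar a = scalar a * (gen g :: ('v, 'e) lpa_gen word \<Rightarrow>\<^sub>0 'k)"
      by (simp add: gen_def mult_single)
    then show ?thesis using that by (simp add: FU_scalar FU_gen flip: rho_mult)
  qed
  show "\<rho> (vtx v) * \<rho> (scalar a) = \<rho> (scalar a) * \<rho> (vtx v)" if "v \<in> verts E" for a v using that
    by (simp add: comm)
  show "\<rho> (edge e) * \<rho> (scalar a) = \<rho> (scalar a) * \<rho> (edge e)" if "e \<in> arcs E" for a e using that
    by (simp add: comm)
  show "\<rho> (ghost e) * \<rho> (scalar a) = \<rho> (scalar a) * \<rho> (ghost e)" if "e \<in> arcs E" for a e using that
    by (simp add: comm)
  fix v S k p
  assume S: "finite S" "\<And>q. q \<in> S \<Longrightarrow> \<exists>u. awalk u q v"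
    and z: "(\<Sum>q\<in>S. \<rho> (scalar (k q)) * (prod_list (map (\<lambda>e. \<rho> (edge e)) q) * \<rho> (vtx v))) = 0" and p:
      "p \<in> S"
  have q: "set q \<subseteq> arcs E \<and> v \<in> verts E" if "q \<in> S" for q using S(2)[OF that] by auto
  define P where "P = (\<Sum>q\<in>S. scalar (k q) * (prod_list (map edge q) * vtx v))"
  have "\<rho> P = (\<Sum>q\<in>S. \<rho> (scalar (k q)) * (prod_list (map (\<lambda>e. \<rho> (edge e)) q) * \<rho> (vtx v)))"
    unfolding P_def rho_sum using q by (intro sum.cong) (simp_all add: rho_path rho_mult FU_scalar)
  then have "\<rho> P = 0" using z by simp
  moreover have "P \<in> carrier FU"
    unfolding P_def using q by (intro FU_sum FU_mult FU_scalar conjunct2[OF rho_path]) auto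
  ultimately have "P \<in> N" using rho_zero_iff by blast
  then show "k p = 0" using paths_independent[OF S] p unfolding P_def by blast
qed

section \<open>The quotient ring\<close>

abbreviation L :: "(('v, 'e) lpa_gen word \<Rightarrow>\<^sub>0 'k) set ring" where
  "L \<equiv> leavitt_path_algebra TYPE('k) E"

definition residue :: "(('v, 'e) lpa_gen word \<Rightarrow>\<^sub>0 'k) \<Rightarrow> (('v, 'e) lpa_gen word \<Rightarrow>\<^sub>0 'k) set" where
  "residue p = (\<lambda>n. n + p) ` N"

text \<open>Representatives of a coset differ by elements of \<open>N\<close>, which
  \<open>\<rho>\<close> sends to 0, so any choice gives the same value.\<close>

definition h :: "(('v, 'e) lpa_gen word \<Rightarrow>\<^sub>0 'k) set \<Rightarrow> (('v, 'e) lpa_gen word \<Rightarrow>\<^sub>0 'k) endo" where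
  "h X = \<rho> (SOME p. p \<in> X)"

lemma coset_residue: "N +>\<^bsub>FA\<^esub> p = residue p"
  by (auto simp: a_r_coset_def' residue_def)

lemma mem_residue: "q \<in> residue p \<longleftrightarrow> q - p \<in> N"
  unfolding residue_def by (auto simp: image_iff) (metis diff_add_cancel)

lemma residue_eq: "p - q \<in> N \<Longrightarrow> residue p = residue q"
proof -
  assume pq: "p - q \<in> N"
  have "x - p \<in> N \<longleftrightarrow> x - q \<in> N" for x
    using N_add[OF _ pq, of "x - p"] N_diff[OF _ pq, of "x - q"] by auto
  then show ?thesis by (simp add: set_eq_iff mem_residue)
qed

lemma h_residue:
  assumes "p \<in> carrier FU"
  shows "h (residue p) = \<rho> p"
proof -
  have "p \<in> residue p" by (simp add: mem_residue N_zero)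
  then have "(SOME q. q \<in> residue p) \<in> residue p" by (rule someI)
  then have n: "(SOME q. q \<in> residue p) - p \<in> N" by (simp add: mem_residue)
  then have "\<rho> ((SOME q. q \<in> residue p) - p) = 0" using rho_zero_iff N_FU by blast
  then show ?thesis by (simp add: h_def rho_diff)
qed

lemma FA_FU: "p \<in> carrier FA \<Longrightarrow> p \<in> carrier FU"
  by (simp add: FA_carrier)

lemma L_carrier: "carrier L = residue ` carrier FA"
  by (auto simp: leavitt_path_algebra_def FactRing_def A_RCOSETS_def' coset_residue)

lemma L_zero: "\<zero>\<^bsub>L\<^esub> = residue 0"
  by (simp add: leavitt_path_algebra_def FactRing_def residue_def)

lemma L_add: "residue p \<oplus>\<^bsub>L\<^esub> residue q = residue (p + q)"
proof -
  have "set_add FA (residue p) (residue q) = residue (p + q)"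
  proof (rule equalityI; rule subsetI)
    fix x assume "x \<in> set_add FA (residue p) (residue q)"
    then obtain a b where "x = a + b" "a - p \<in> N" "b - q \<in> N"
      by (auto simp: set_add_def' mem_residue)
    then show "x \<in> residue (p + q)" using N_add[of "a - p" "b - q"]
      by (simp add: mem_residue algebra_simps)
  next
    fix x assume "x \<in> residue (p + q)"
    then have "x - q \<in> residue p" by (simp add: mem_residue algebra_simps)
    moreover have "q \<in> residue q" by (simp add: mem_residue N_zero)
    moreover have "x = (x - q) \<oplus>\<^bsub>FA\<^esub> q" by simp
    ultimately show "x \<in> set_add FA (residue p) (residue q)" unfolding set_add_def' by blast
  qed
  then show ?thesis by (simp add: leavitt_path_algebra_def FactRing_def)
qed

text \<open>The product of cosets is a union over all representatives. These stay in
  \<open>carrier FU\<close> because \<open>N\<close> does, and so their products are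
  congruent.\<close>

lemma L_mult:
  assumes p: "p \<in> carrier FU" and q: "q \<in> carrier FU"
  shows "residue p \<otimes>\<^bsub>L\<^esub> residue q = residue (p * q)"
proof -
  have eq: "residue (a * b) = residue (p * q)" if ab: "a \<in> residue p" "b \<in> residue q" for a b
  proof (rule residue_eq)
    have n: "a - p \<in> N" "b - q \<in> N" using ab by (auto simp: mem_residue)
    have "b - q \<in> carrier FU" using n(2) N_FU by blast
    from FU_add[OF this q] have "b \<in> carrier FU" by simp
    then have "(a - p) * b \<in> N" "p * (b - q) \<in> N" using n N_left N_right p by blast+
    then have "(a - p) * b + p * (b - q) \<in> N" by (rule N_add)
    then show "a * b - p * q \<in> N" by (simp add: algebra_simps)
  qed
  have ne: "p \<in> residue p" "q \<in> residue q" by (simp_all add: mem_residue N_zero)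
  have "rcoset_mult FA N (residue p) (residue q) = (\<Union>a\<in>residue p. \<Union>b\<in>residue q. residue (a * b))"
    by (simp add: rcoset_mult_def coset_residue)
  also have "\<dots> = residue (p * q)" using eq ne by blast
  finally show ?thesis by (simp add: leavitt_path_algebra_def FactRing_def)
qed

lemma FA_zero: "0 \<in> carrier FA"
  by (simp add: FA_carrier FU_zero)

lemma FA_add: "p \<in> carrier FA \<Longrightarrow> q \<in> carrier FA \<Longrightarrow> p + q \<in> carrier FA"
  by (simp add: FA_carrier FU_add lookup_add)

lemma FA_uminus: "p \<in> carrier FA \<Longrightarrow> - p \<in> carrier FA"
  by (simp add: FA_carrier FU_uminus)

text \<open>Two words concatenate to the empty one only if both are empty. In consequence a product
  has no constant term as soon as one factor has none.\<close>

lemma lookup_mult_0: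
  "Poly_Mapping.lookup (p * q) (0 :: 'a word) = Poly_Mapping.lookup p 0 * (Poly_Mapping.lookup q 0
    :: 'k)"
proof -
  have "Poly_Mapping.lookup (Poly_Mapping.single w k * q) 0 =
      Poly_Mapping.lookup (Poly_Mapping.single w k) 0 * Poly_Mapping.lookup q 0" for w :: "'a word"
        and k :: 'k and q
  proof (induction q rule: poly_mapping_additive_induct)
    case (add w' k' q)
    have "w + w' = 0 \<longleftrightarrow> w = 0 \<and> w' = 0"
      by (cases w; cases w') (auto simp: plus_word_def zero_word_def)
    then show ?case by (simp add: distrib_left lookup_add mult_single lookup_single when_def add.IH)
  qed simp
  then show ?thesis
    by (induction p rule: poly_mapping_additive_induct) (simp_all add: distrib_right lookup_add)
qed

lemma FA_mult: "p \<in> carrier FU \<Longrightarrow> q \<in> carrier FU \<Longrightarrow> p \<in> carrier FA \<or> q \<in> carrier FA \<Longrightarrow>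
  p * q \<in> carrier FA"
  by (auto simp: FA_carrier FU_mult lookup_mult_0)

lemma FA_gen: "a \<in> lpa_gens E \<Longrightarrow> gen a \<in> carrier FA"
  by (simp add: FA_carrier FU_gen) (simp add: gen_def lookup_single zero_word_def)

lemma embedding: "ring_embedding L h"
  unfolding ring_embedding_def
proof (intro conjI ballI)
  show "inj_on h (carrier L)"
  proof
    fix X Y assume "X \<in> carrier L" "Y \<in> carrier L" and eq: "h X = h Y"
    then obtain p q where pq: "p \<in> carrier FU" "q \<in> carrier FU" "X = residue p" "Y = residue q"
      unfolding L_carrier using FA_FU by blast
    then have "\<rho> (p - q) = 0" using eq by (simp add: h_residue rho_diff)
    moreover have "p - q \<in> carrier FU" using FU_add[OF pq(1) FU_uminus[OF pq(2)]] by simp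
    ultimately show "X = Y" using rho_zero_iff residue_eq pq by blast
  qed
  show "\<zero>\<^bsub>L\<^esub> \<in> carrier L" unfolding L_zero L_carrier using FA_zero by blast
  show "h \<zero>\<^bsub>L\<^esub> = 0" unfolding L_zero by (simp add: h_residue FU_zero rho_zero)
  fix X assume "X \<in> carrier L"
  then obtain p where p: "p \<in> carrier FA" "p \<in> carrier FU" "X = residue p" unfolding L_carrier
    using FA_FU by blast
  have "h (residue (- p)) = - h X" using p by (simp add: h_residue FU_uminus rho_uminus)
  moreover have "residue (- p) \<in> carrier L" unfolding L_carrier using FA_uminus p by blast
  ultimately show "- h X \<in> h ` carrier L" by (metis imageI)
  fix Y assume "Y \<in> carrier L"
  then obtain q where q: "q \<in> carrier FA" "q \<in> carrier FU" "Y = residue q" unfolding L_carrier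
    using FA_FU by blast
  show "X \<oplus>\<^bsub>L\<^esub> Y \<in> carrier L" "X \<otimes>\<^bsub>L\<^esub> Y \<in> carrier L"
    using p q FA_add FA_mult by (auto simp: L_add L_mult L_carrier)
  show "h (X \<oplus>\<^bsub>L\<^esub> Y) = h X + h Y" "h (X \<otimes>\<^bsub>L\<^esub> Y) = h X * h Y"
    using p q by (simp_all add: L_add L_mult h_residue FU_add FU_mult rho_add rho_mult)
qed

lemma rho_el: "set p \<subseteq> arcs E \<Longrightarrow> w \<in> carrier FA \<Longrightarrow>
    \<exists>q\<in>carrier FA. el p * \<rho> w = \<rho> q"
proof (induction p)
  case (Cons e p)
  then obtain q where q: "q \<in> carrier FA" "el p * \<rho> w = \<rho> q" by auto
  then have "el (e # p) * \<rho> w = \<rho> (edge e * q)" using Cons.prems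
    by (simp add: mult.assoc rho_mult FU_gen FA_FU)
  moreover have "edge e * q \<in> carrier FA" using Cons.prems q
    by (intro FA_mult) (auto simp: FU_gen FA_FU)
  ultimately show ?case by blast
qed auto

lemma rho_gl: "set p \<subseteq> arcs E \<Longrightarrow> w \<in> carrier FA \<Longrightarrow> \<exists>q\<in>carrier FA. \<rho> w * gl p = \<rho> q"
proof (induction p)
  case (Cons e p)
  then obtain q where q: "q \<in> carrier FA" "\<rho> w * gl p = \<rho> q" by auto
  then have "\<rho> w * gl (e # p) = \<rho> (q * ghost e)" using Cons.prems
    by (simp add: rho_mult FU_gen FA_FU flip: mult.assoc)
  moreover have "q * ghost e \<in> carrier FA" using Cons.prems q
    by (intro FA_mult) (auto simp: FU_gen FA_FU)
  ultimately show ?case by blast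
qed auto

lemma rho_gen: "a \<in> lpa_gens E \<Longrightarrow> \<rho> (gen a) \<in> A"
proof (cases a)
  case (Ghost e)
  assume "a \<in> lpa_gens E"
  then have e: "e \<in> arcs E" using Ghost by (auto simp: lpa_gens_def)
  then show ?thesis
    using A_Vgl[of "tail E e" "[e]" "head E e"] V_H[OF e] Ghost by (simp add: awalk_simps)
qed (auto simp: lpa_gens_def A_V A_D)

lemma rho_word: "set ls \<subseteq> lpa_gens E \<Longrightarrow> ls \<noteq> [] \<Longrightarrow> \<rho> (Poly_Mapping.single (Word ls) 1) \<in> A"
proof (induction ls)
  case (Cons a ls)
  show ?case
  proof (cases "ls = []")
    case True
    then show ?thesis using Cons.prems rho_gen[of a] by (simp add: gen_def)
  next
    case False
    have "\<rho> (Poly_Mapping.single (Word (a # ls)) 1) = \<rho> (gen a * Poly_Mapping.single (Word ls) 1)"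
      by (simp add: gen_def mult_single plus_word_def)
    also have "\<dots> = \<rho> (gen a) * \<rho> (Poly_Mapping.single (Word ls) 1)"
      using Cons.prems by (intro rho_mult FU_gen FU_single) auto
    finally show ?thesis using Cons False rho_gen[of a] by (simp add: A_mult)
  qed
qed simp

text \<open>Without constant term all words are non-empty, so each maps to a product of generators
  in \<open>A\<close>. Conversely a monomial has \<open>V w\<close> in its middle and thus a
  preimage without constant term even if both paths are empty.\<close>

lemma rho_FA: "\<rho> ` carrier FA = A"
proof
  show "\<rho> ` carrier FA \<subseteq> A"
  proof clarify
    fix p assume p: "p \<in> carrier FA"
    have "p = (\<Sum>w\<in>Poly_Mapping.keys p. Poly_Mapping.single w (Poly_Mapping.lookup p w))"
      by (rule poly_mapping_eqI) (simp add: lookup_sum lookup_single when_def in_keys_iff)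
    then have "\<rho> p = (\<Sum>w\<in>Poly_Mapping.keys p. \<rho> (Poly_Mapping.single w (Poly_Mapping.lookup p w)))"
      by (subst rho_sum[symmetric]) simp
    also have "\<dots> \<in> A"
    proof (intro addsub_sum A_addsub)
      fix w assume w: "w \<in> Poly_Mapping.keys p"
      then have g: "set (letters w) \<subseteq> lpa_gens E" using p by (auto simp: FA_carrier FU_carrier)
      have "letters w \<noteq> []"
      proof
        assume "letters w = []"
        then have "w = 0" by (cases w) (simp add: zero_word_def)
        then show False using p w by (simp add: FA_carrier in_keys_iff)
      qed
      then have r: "\<rho> (Poly_Mapping.single w 1) \<in> A" using rho_word[OF g] by simp
      have eq: "\<rho> (Poly_Mapping.single w k) = \<rho> (scalar k) * \<rho> (Poly_Mapping.single w 1)" for k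
        using rho_mult[OF FU_scalar FU_single[OF g], of k 1] by (simp add: mult_single)
      show "\<rho> (Poly_Mapping.single w (Poly_Mapping.lookup p w)) \<in> A" by (subst eq) (rule A_sc[OF r])
    qed
    finally show "\<rho> p \<in> A" .
  qed
  show "A \<subseteq> \<rho> ` carrier FA"
  proof
    fix x assume "x \<in> A"
    then show "x \<in> \<rho> ` carrier FA"
      unfolding A_def span_def
    proof (rule aspan_least)
      show "addsub (\<rho> ` carrier FA)"
        by (rule addsub_image) (simp_all add: addsub_def FA_zero FA_add FA_uminus rho_add)
      show "{\<rho> (scalar k) * mon p w q |k p w q. w \<in> verts E \<and> (\<exists>u. awalk u p w) \<and>
        (\<exists>u. awalk u q w)} \<subseteq> \<rho> ` carrier FA"
      proof clarify
        fix k p w q u u' assume w: "w \<in> verts E" "awalk u p w" "awalk u' q w"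
        then have pq: "set p \<subseteq> arcs E" "set q \<subseteq> arcs E" by auto
        obtain a where a: "a \<in> carrier FA" "\<rho> (vtx w) * gl q = \<rho> a" using rho_gl[OF pq(2) FA_gen[of
          "Vertex w"]] w(1) by auto
        obtain b where b: "b \<in> carrier FA" "el p * \<rho> a = \<rho> b" using rho_el[OF pq(1) a(1)] by auto
        have "\<rho> (scalar k) * mon p w q = \<rho> (scalar k * b)"
          using a b by (simp add: mon_def rho_mult FU_scalar FA_FU)
        moreover have "scalar k * b \<in> carrier FA" using b(1)
          by (intro FA_mult) (auto simp: FU_scalar FA_FU)
        ultimately show "\<rho> (scalar k) * mon p w q \<in> \<rho> ` carrier FA" by blast
      qed
    qed
  qed
qed

lemma h_L: "h ` carrier L = A"
proof -
  have "h ` carrier L = \<rho> ` carrier FA"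
    unfolding L_carrier image_image by (rule image_cong) (simp_all add: h_residue FA_FU)
  then show ?thesis by (simp add: rho_FA)
qed

lemma h_vertex: "v \<in> verts E \<Longrightarrow> h (lpa_vertex TYPE('k) E v) = \<rho> (vtx v)"
  "v \<in> verts E \<Longrightarrow> lpa_vertex TYPE('k) E v \<in> carrier L"
  unfolding lpa_vertex_def coset_residue L_carrier by (simp_all add: h_residue FU_gen FA_gen)

lemma L_ideal:
  "two_sided_ideal I L \<longleftrightarrow> I \<subseteq> carrier L \<and> addsub (h ` I) \<and>
     (\<forall>a\<in>A. \<forall>x\<in>h ` I. a * x \<in> h ` I \<and> x * a \<in> h ` I)"
  unfolding two_sided_ideal_def emb_left_ideal[OF embedding] emb_right_ideal[OF embedding]
    submod_def h_L[symmetric]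
  by blast

section \<open>Transfer of the results to the quotient ring\<close>

definition Lc :: "(('v, 'e) lpa_gen word \<Rightarrow>\<^sub>0 'k) set set" where
  "Lc = {X \<in> carrier L. h X \<in> Ic}"

lemma h_Lc: "h ` Lc = Ic"
  unfolding Lc_def using emb_preimage[OF embedding, of Ic] Ic_A h_L by simp

lemma Lc_ideal: "two_sided_ideal Lc L"
  unfolding L_ideal h_Lc using Ic_addsub Ic_ideal by (auto simp: Lc_def)

lemma Lc_generated: "generated_ideal L (lpa_vertex TYPE('k) E ` Pc) = Lc"
proof
  have "lpa_vertex TYPE('k) E ` Pc \<subseteq> Lc"
    unfolding Lc_def using h_vertex Ic_V Pc_verts by auto
  then show "generated_ideal L (lpa_vertex TYPE('k) E ` Pc) \<subseteq> Lc"
    unfolding generated_ideal_def using Lc_ideal by blast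
  have "Lc \<subseteq> I" if I: "two_sided_ideal I L" "lpa_vertex TYPE('k) E ` Pc \<subseteq> I" for I
  proof -
    have sub: "I \<subseteq> carrier L" using I(1) L_ideal by blast
    have "Ic \<subseteq> h ` I"
    proof (rule Ic_least)
      fix v assume v: "v \<in> Pc"
      then have "lpa_vertex TYPE('k) E v \<in> I" using I(2) by blast
      then show "\<rho> (vtx v) \<in> h ` I" using h_vertex(1)[of v] v Pc_verts by (metis imageI subsetD)
    qed (use I(1) in \<open>auto simp: L_ideal\<close>)
    then show "Lc \<subseteq> I" unfolding Lc_def using emb_mem[OF embedding sub] by blast
  qed
  then show "Lc \<subseteq> generated_ideal L (lpa_vertex TYPE('k) E ` Pc)"
    unfolding generated_ideal_def by blast
qed

lemma corner_image:
  assumes I: "two_sided_ideal I L" and e: "idempotent (L\<lparr>carrier := I\<rparr>) e"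
  shows "h ` carrier (corner (L\<lparr>carrier := I\<rparr>) e) = {x \<in> h ` I. h e * x = x \<and> x * h e = x}"
  using emb_image_corner[OF emb_subring[OF embedding I] e] by simp

lemma left_noetherian_corner:
  assumes I: "two_sided_ideal I L" and e: "idempotent (L\<lparr>carrier := I\<rparr>) e"
  shows "left_noetherian_ring (corner (L\<lparr>carrier := I\<rparr>) e) \<longleftrightarrow>
    acc (*) {x \<in> h ` I. h e * x = x \<and> x * h e = x} {x \<in> h ` I. h e * x = x \<and> x * h e = x}"
  unfolding emb_left_noetherian[OF emb_corner[OF emb_subring[OF embedding I] e]]
    corner_image[OF I e]
  using ring_corner[OF emb_subring[OF embedding I] e] by blast

lemma right_noetherian_corner:
  assumes I: "two_sided_ideal I L" and e: "idempotent (L\<lparr>carrier := I\<rparr>) e"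
  shows "right_noetherian_ring (corner (L\<lparr>carrier := I\<rparr>) e) \<longleftrightarrow>
    acc (\<lambda>x y. y * x) {x \<in> h ` I. h e * x = x \<and> x * h e = x} {x \<in> h ` I. h e * x = x \<and> x * h e = x}"
  unfolding emb_right_noetherian[OF emb_corner[OF emb_subring[OF embedding I] e]]
    corner_image[OF I e]
  using ring_corner[OF emb_subring[OF embedding I] e] by blast

lemma idempotent_ideal:
  "two_sided_ideal I L \<Longrightarrow> idempotent (L\<lparr>carrier := I\<rparr>) e \<longleftrightarrow> e \<in> I \<and> h e * h e = h e"
  using emb_idempotent[OF emb_subring[OF embedding, of I], of e] by simp

lemma Lc_locally_noetherian:
  assumes "finite X" "X \<subseteq> Lc"
  shows "\<exists>e. idempotent (L\<lparr>carrier := Lc\<rparr>) e \<and> X \<subseteq> carrier (corner (L\<lparr>carrier := Lc\<rparr>) e) \<and>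
    left_noetherian_ring (corner (L\<lparr>carrier := Lc\<rparr>) e) \<and>
      right_noetherian_ring (corner (L\<lparr>carrier := Lc\<rparr>) e)"
proof -
  have "finite (h ` X)" "h ` X \<subseteq> Ic" using assms h_Lc by auto
  then obtain e' where e': "e' \<in> Ic" "e' * e' = e'" "h ` X \<subseteq> {x \<in> Ic. e' * x = x \<and> x * e' = x}"
    "acc (*) {x \<in> Ic. e' * x = x \<and> x * e' = x} {x \<in> Ic. e' * x = x \<and> x * e' = x}"
    "acc (\<lambda>x y. y * x) {x \<in> Ic. e' * x = x \<and> x * e' = x} {x \<in> Ic. e' * x = x \<and> x * e' = x}"
    by (rule Ic_locally_noetherian)
  obtain e where e: "e \<in> Lc" "e' = h e" using e'(1) h_Lc by blast
  have id: "idempotent (L\<lparr>carrier := Lc\<rparr>) e" using e e'(2) idempotent_ideal[OF Lc_ideal] by simp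
  have emb: "ring_embedding (L\<lparr>carrier := Lc\<rparr>) h" by (rule emb_subring[OF embedding Lc_ideal])
  have "X \<subseteq> carrier (corner (L\<lparr>carrier := Lc\<rparr>) e)"
  proof
    fix x assume x: "x \<in> X"
    then have "h x \<in> h ` carrier (corner (L\<lparr>carrier := Lc\<rparr>) e)"
      using e'(3) unfolding corner_image[OF Lc_ideal id] h_Lc e(2) by blast
    moreover have "carrier (corner (L\<lparr>carrier := Lc\<rparr>) e) \<subseteq> carrier (L\<lparr>carrier := Lc\<rparr>)"
      using e(1) emb_simps(5)[OF emb] by (auto simp: carrier_corner)
    moreover have "x \<in> carrier (L\<lparr>carrier := Lc\<rparr>)" using x assms(2) by auto
    ultimately show "x \<in> carrier (corner (L\<lparr>carrier := Lc\<rparr>) e)" using emb_mem[OF emb] by blast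
  qed
  then show ?thesis
    using id e' e(2) left_noetherian_corner[OF Lc_ideal id] right_noetherian_corner[OF Lc_ideal id]
      h_Lc by auto
qed

lemma Lc_locally_left_noetherian: "locally_left_noetherian (L\<lparr>carrier := Lc\<rparr>)"
  and Lc_locally_right_noetherian: "locally_right_noetherian (L\<lparr>carrier := Lc\<rparr>)"
proof -
  have "X \<subseteq> Lc" if "X \<subseteq> carrier (L\<lparr>carrier := Lc\<rparr>)" for X using that by simp
  then show "locally_left_noetherian (L\<lparr>carrier := Lc\<rparr>)"
    "locally_right_noetherian (L\<lparr>carrier := Lc\<rparr>)"
    unfolding locally_left_noetherian_def locally_right_noetherian_def using Lc_locally_noetherian
      by meson+
qed

text \<open>Units of a corner are expressed by products in \<open>A\<close>, where the inverse must
  be two-sided and lie in the same corner; \<open>h e \<noteq> 0\<close> is what keeps 0 from being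
  a unit.\<close>

lemma minimal_idempotent_iff:
  "minimal_idempotent L e \<longleftrightarrow> e \<in> carrier L \<and> h e * h e = h e \<and> h e \<noteq> 0 \<and>
     (\<forall>x\<in>A. h e * x = x \<longrightarrow> x * h e = x \<longrightarrow> x \<noteq> 0 \<longrightarrow>
       (\<exists>y\<in>A. h e * y = y \<and> y * h e = y \<and> x * y = h e \<and> y * x = h e))"
proof (cases "idempotent L e \<and> e \<noteq> \<zero>\<^bsub>L\<^esub>")
  case False
  then have "\<not> (e \<in> carrier L \<and> h e * h e = h e \<and> h e \<noteq> 0)"
    using emb_idempotent[OF embedding, of e] emb_simps(1,2)[OF embedding] emb_inj[OF embedding, of e
      "\<zero>\<^bsub>L\<^esub>"] by auto
  then show ?thesis using False by (auto simp: minimal_idempotent_def)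
next
  case True
  then have id: "idempotent L e" and e: "e \<in> carrier L" "h e * h e = h e" "h e \<noteq> 0"
    using emb_idempotent[OF embedding, of e] emb_simps(1,2)[OF embedding] emb_inj[OF embedding, of e
      "\<zero>\<^bsub>L\<^esub>"] by auto
  let ?C = "corner L e"
  have emb: "ring_embedding ?C h" by (rule emb_corner[OF embedding id])
  have ring: "ring ?C" by (rule ring_corner[OF embedding id])
  have im: "h ` carrier ?C = {x \<in> A. h e * x = x \<and> x * h e = x}"
    unfolding emb_image_corner[OF embedding id] h_L ..
  have one: "\<one>\<^bsub>?C\<^esub> = e" and zero: "\<zero>\<^bsub>?C\<^esub> = \<zero>\<^bsub>L\<^esub>" by (simp_all add: corner_def)
  have "e = e \<otimes>\<^bsub>L\<^esub> e \<otimes>\<^bsub>L\<^esub> e" using id by (simp add: idempotent_def)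
  then have eC: "e \<in> carrier ?C" using e(1) unfolding carrier_corner by blast
  have prod: "x \<otimes>\<^bsub>?C\<^esub> y = \<one>\<^bsub>?C\<^esub> \<longleftrightarrow> h x * h y = h e" if "x \<in> carrier ?C" "y \<in> carrier ?C" for x y
    using emb_inj[OF emb, of "x \<otimes>\<^bsub>?C\<^esub> y" e] emb_simps(5,6)[OF emb that] eC by (simp add: one)
  have z: "x = \<zero>\<^bsub>?C\<^esub> \<longleftrightarrow> h x = 0" if "x \<in> carrier ?C" for x
    using emb_inj[OF emb that emb_simps(1)[OF emb]] emb_simps(2)[OF emb] by simp
  have units: "Units ?C = {x \<in> carrier ?C. \<exists>y\<in>carrier ?C. h x * h y = h e \<and> h y * h x = h e}"
    unfolding Units_def using prod by blast
  have "Units ?C = carrier ?C - {\<zero>\<^bsub>?C\<^esub>} \<longleftrightarrow>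
      (\<forall>x\<in>carrier ?C. h x \<noteq> 0 \<longrightarrow> (\<exists>y\<in>carrier ?C. h x * h y = h e \<and> h y * h x = h e))"
    unfolding units using z e(3) emb_simps(1,2)[OF emb] by auto
  also have "\<dots> \<longleftrightarrow> (\<forall>x\<in>h ` carrier ?C. x \<noteq> 0 \<longrightarrow> (\<exists>y\<in>h ` carrier ?C. x * y = h e \<and> y * x = h e))"
    by blast
  also have "\<dots> \<longleftrightarrow> (\<forall>x\<in>A. h e * x = x \<longrightarrow> x * h e = x \<longrightarrow> x \<noteq> 0 \<longrightarrow>
       (\<exists>y\<in>A. h e * y = y \<and> y * h e = y \<and> x * y = h e \<and> y * x = h e))"
    unfolding im Ball_def Bex_def mem_Collect_eq by meson
  finally have iff: "Units ?C = carrier ?C - {\<zero>\<^bsub>?C\<^esub>} \<longleftrightarrow> (\<forall>x\<in>A. h e * x = x \<longrightarrow> x * h e = x \<longrightarrow> x \<noteq> 0 \<longrightarrow>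
       (\<exists>y\<in>A. h e * y = y \<and> y * h e = y \<and> x * y = h e \<and> y * x = h e))" .
  have "minimal_idempotent L e \<longleftrightarrow> Units ?C = carrier ?C - {\<zero>\<^bsub>?C\<^esub>}"
    using id True ring unfolding minimal_idempotent_def skew_field_def skew_field_axioms_def by simp
  then show ?thesis using e iff by simp
qed

lemma Lc_no_minimal_idempotent: "e \<in> Lc \<Longrightarrow> \<not> minimal_idempotent L e"
proof
  assume "e \<in> Lc" and m: "minimal_idempotent L e"
  then have e: "h e \<in> Ic" "h e * h e = h e" "h e \<noteq> 0" by (auto simp: Lc_def minimal_idempotent_iff)
  obtain z where "z \<in> A" "h e * z = z" "z * h e = z" "z \<noteq> 0" "\<And>y. y \<in> A \<Longrightarrow> y * z \<noteq> h e"
    using Ic_no_division[OF e] by blast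
  then show False using m unfolding minimal_idempotent_iff by blast
qed

text \<open>A sequence below \<open>h e\<close> lies in the corner of the ideal at \<open>e\<close>,
  because \<open>f n = h e * f n\<close>; there either chain condition contradicts it.\<close>

lemma no_orthogonal_below:
  assumes I: "two_sided_ideal I L" and e: "idempotent (L\<lparr>carrier := I\<rparr>) e"
    and n: "left_noetherian_ring (corner (L\<lparr>carrier := I\<rparr>) e) \<or>
      right_noetherian_ring (corner (L\<lparr>carrier := I\<rparr>) e)"
  shows "\<not> orthogonal_below (h e) f"
proof
  assume f: "orthogonal_below (h e) f"
  define B where "B = {x \<in> h ` I. h e * x = x \<and> x * h e = x}"
  have hI: "addsub (h ` I)" "\<And>a x. a \<in> A \<Longrightarrow> x \<in> h ` I \<Longrightarrow> a * x \<in> h ` I \<and> x * a \<in> h ` I" "h ` I \<subseteq> A"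
    using I h_L unfolding L_ideal by blast+
  have add: "addsub B" using hI(1) by (auto simp: B_def addsub_def distrib_left distrib_right)
  have mult: "x * y \<in> B" if "x \<in> B" "y \<in> B" for x y
  proof -
    have "x * y \<in> h ` I" using that hI(2,3) unfolding B_def by blast
    then show ?thesis using that by (simp add: B_def mult.assoc) (simp flip: mult.assoc)
  qed
  have eI: "h e \<in> h ` I" using e idempotent_ideal[OF I] by blast
  have fB: "f n \<in> B" for n
  proof -
    have "f n \<in> A" "h e * f n = f n" "f n * h e = f n" using f by (auto simp: orthogonal_below_def)
    moreover then have "h e * f n \<in> h ` I" using hI(2) eI by blast
    ultimately show ?thesis by (simp add: B_def)
  qed
  have fo: "\<And>n. f n \<noteq> 0" "\<And>n. f n * f n = f n" "\<And>i j. i \<noteq> j \<Longrightarrow> f i * f j = 0"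
    using f by (auto simp: orthogonal_below_def)
  show False
    using n unfolding left_noetherian_corner[OF I e] right_noetherian_corner[OF I e]
      B_def[symmetric]
  proof
    assume "acc (*) B B"
    then show False by (rule mult.no_orthogonal_sequence[where f = f, OF _ add mult fB fo])
  next
    assume "acc (\<lambda>x y. y * x) B B"
    then show False
      by (rule opp_mult.no_orthogonal_sequence[where f =
        f, OF _ add mult fB fo(1,2) fo(3)[OF not_sym]])
  qed
qed

text \<open>Asking each corner to be noetherian on one side or the other is weaker than both local
  conditions, so a single statement gives maximality for both.\<close>

lemma Lc_largest:
  assumes I: "two_sided_ideal I L"
    and loc: "\<And>X. X \<subseteq> I \<Longrightarrow> finite X \<Longrightarrow> \<exists>e. idempotent (L\<lparr>carrier := I\<rparr>) e \<and>
      X \<subseteq> carrier (corner (L\<lparr>carrier := I\<rparr>) e) \<and>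
      (left_noetherian_ring (corner (L\<lparr>carrier := I\<rparr>) e) \<or>
        right_noetherian_ring (corner (L\<lparr>carrier := I\<rparr>) e))"
    and nomin: "\<And>e. e \<in> I \<Longrightarrow> \<not> minimal_idempotent L e"
  shows "I \<subseteq> Lc"
proof -
  have sub: "I \<subseteq> carrier L" using I L_ideal by blast
  have "h ` I \<subseteq> Ic"
  proof (rule J_subset)
    show "h ` I \<subseteq> A" using sub h_L by blast
    show "addsub (h ` I)" "\<And>a x. a \<in> A \<Longrightarrow> x \<in> h ` I \<Longrightarrow> a * x \<in> h ` I"
      "\<And>a x. a \<in> A \<Longrightarrow> x \<in> h ` I \<Longrightarrow> x * a \<in> h ` I" using I unfolding L_ideal by blast+
  next
    fix x assume "x \<in> h ` I"
    then obtain X where X: "X \<in> I" "x = h X" by blast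
    obtain e where e: "idempotent (L\<lparr>carrier := I\<rparr>) e" "{X} \<subseteq> carrier (corner (L\<lparr>carrier := I\<rparr>) e)"
      "left_noetherian_ring (corner (L\<lparr>carrier := I\<rparr>) e) \<or>
        right_noetherian_ring (corner (L\<lparr>carrier := I\<rparr>) e)"
      using loc[of "{X}"] X by auto
    have "h X \<in> h ` carrier (corner (L\<lparr>carrier := I\<rparr>) e)" using e(2) by blast
    then have "h e * x = x" "x * h e = x" unfolding corner_image[OF I e(1)] X by auto
    moreover have "h e \<in> h ` I" "h e * h e = h e" using e(1) idempotent_ideal[OF I] by auto
    ultimately show "\<exists>e\<in>h ` I. e * e = e \<and> e * x = x \<and> x * e = x \<and> (\<nexists>f. orthogonal_below e f)"
      using no_orthogonal_below[OF I e(1,3)] by blast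
  next
    fix e' assume e': "e' \<in> h ` I" "e' * e' = e'" "e' \<noteq> 0"
    then obtain e where e: "e \<in> I" "e' = h e" by blast
    have "e \<in> carrier L" using e(1) sub by blast
    with nomin[OF e(1)] e'(2,3) have "\<not> (\<forall>x\<in>A. e' * x = x \<longrightarrow> x * e' = x \<longrightarrow> x \<noteq> 0 \<longrightarrow>
       (\<exists>y\<in>A. e' * y = y \<and> y * e' = y \<and> x * y = e' \<and> y * x = e'))"
      unfolding minimal_idempotent_iff e(2) by simp
    then obtain x where x: "x \<in> A" "e' * x = x" "x * e' = x" "x \<noteq> 0"
      "\<not> (\<exists>y\<in>A. e' * y = y \<and> y * e' = y \<and> x * y = e' \<and> y * x = e')" by blast
    show "\<exists>x\<in>A. e' * x = x \<and> x * e' = x \<and> x \<noteq> 0 \<and>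
        (\<forall>y\<in>A. e' * y = y \<longrightarrow> y * e' = y \<longrightarrow> x * y = e' \<longrightarrow> y * x \<noteq> e')"
      by (rule bexI[OF _ x(1)]) (use x in simp)
  qed
  then show ?thesis using sub by (auto simp: Lc_def)
qed

end

theorem corollary3p4:
  fixes E :: "('v, 'e) pre_digraph"
    and L :: "(('v, 'e) lpa_gen word \<Rightarrow>\<^sub>0 'k::field) set ring"
    and I\<^sub>c :: "(('v, 'e) lpa_gen word \<Rightarrow>\<^sub>0 'k) set set"
  assumes "wf_digraph E"
    and "L = leavitt_path_algebra TYPE('k) E"
    and "I\<^sub>c = generated_ideal L (lpa_vertex TYPE('k) E ` verts_on_cycles_without_exits E)"
  shows "largest_ideal_with L
           (\<lambda>I. locally_left_noetherian (L\<lparr>carrier := I\<rparr>) \<and> (\<forall>e\<in>I. \<not> minimal_idempotent L e)) I\<^sub>c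
       \<and> largest_ideal_with L
           (\<lambda>I. locally_right_noetherian (L\<lparr>carrier := I\<rparr>) \<and> (\<forall>e\<in>I. \<not> minimal_idempotent L e)) I\<^sub>c"
proof -
  interpret wf_digraph E by fact
  interpret lpa_construction E "TYPE('k)" by unfold_locales
  have Ic: "I\<^sub>c = Lc" using assms(2,3) Lc_generated by simp
  have "locally_left_noetherian (L\<lparr>carrier := Lc\<rparr>)" "locally_right_noetherian (L\<lparr>carrier := Lc\<rparr>)"
    using Lc_locally_left_noetherian Lc_locally_right_noetherian assms(2) by simp_all
  moreover have "J \<subseteq> Lc" if J: "two_sided_ideal J L" "\<forall>e\<in>J. \<not> minimal_idempotent L e"
    "locally_left_noetherian (L\<lparr>carrier := J\<rparr>) \<or> locally_right_noetherian (L\<lparr>carrier := J\<rparr>)" for J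
  proof (rule Lc_largest)
    show "two_sided_ideal J (leavitt_path_algebra TYPE('k) E)" using J(1) assms(2) by simp
    show "\<not> minimal_idempotent (leavitt_path_algebra TYPE('k) E) e" if "e \<in> J" for e
      using J(2) that assms(2) by simp
    fix X assume X: "X \<subseteq> J" "finite X"
    then have "X \<subseteq> carrier (L\<lparr>carrier := J\<rparr>)" by simp
    with X(2) J(3) show "\<exists>e. idempotent (leavitt_path_algebra TYPE('k) E\<lparr>carrier := J\<rparr>) e \<and>
        X \<subseteq> carrier (corner (leavitt_path_algebra TYPE('k) E\<lparr>carrier := J\<rparr>) e) \<and>
        (left_noetherian_ring (corner (leavitt_path_algebra TYPE('k) E\<lparr>carrier := J\<rparr>) e) \<or>
         right_noetherian_ring (corner (leavitt_path_algebra TYPE('k) E\<lparr>carrier := J\<rparr>) e))"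
      unfolding locally_left_noetherian_def locally_right_noetherian_def assms(2) by meson
  qed
  moreover have "\<forall>e\<in>Lc. \<not> minimal_idempotent L e" using Lc_no_minimal_idempotent assms(2) by simp
  moreover have "two_sided_ideal Lc L" using Lc_ideal assms(2) by simp
  ultimately show ?thesis
    unfolding largest_ideal_with_def Ic by simp
qed

end
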